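(* Let $0<\alpha<n$. There is a constant $c>0$, depending only on $n$ and $\alpha$, such that for every $\Omega\in L^{n,\infty}(\mathbb S^{n-1})$ with mean zero, every $f\in C_c^\infty(\mathbb R^n)$ and every $x\in\mathbb R^n$, $$|T_{\Omega,\alpha}f(x)|\le c\,\|\Omega\|_{L^{n,\infty}(\mathbb S^{n-1})}\,I_\alpha(|\nabla f|)(x).$$
   Context: $n$ is a positive integer; $\sigma=\mathcal H^{n-1}$ is surface measure on the unit sphere $\mathbb S^{n-1}\subset\mathbb R^n$. "Mean zero" means $\int_{\mathbb S^{n-1}}\Omega\,d\sigma=0$ (with $\Omega\in L^1(\mathbb S^{n-1})$). $\|\Omega\|_{L^{n,\infty}(\mathbb S^{n-1})}=\sup_{t>0}t\,\sigma(\{y'\in\mathbb S^{n-1}:|\Omega(y')|>t\})^{1/n}$. The rough fractional singular integral operator is $$T_{\Omega,\alpha}f(x)=\mathrm{p.v.}\int_{\mathbb R^n}\frac{\Omega(y')}{|y|^{n+1-\alpha}}f(x-y)\,dy=\lim_{\varepsilon\to0^+}\int_{|y|>\varepsilon}\frac{\Omega(y')}{|y|^{n+1-\alpha}}f(x-y)\,dy,\qquad y'=y/|y|.$$ The Riesz potential is $I_\alpha g(x)=c_{n,\alpha}\int_{\mathbb R^n}\frac{g(y)}{|x-y|^{n-\alpha}}\,dy$, where the constant $c_{n,\alpha}>0$ is chosen so that $\widehat{I_\alpha g}(\xi)=|\xi|^{-\alpha}\hat g(\xi)$. *)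

theory Defs
  imports "HOL-Analysis.Analysis"
begin

section \<open>Surface measure on the unit sphere\<close>

text \<open>
  The \<open>m\<close>-dimensional Hausdorff measure, normalised so that it agrees with Lebesgue
  measure on \<open>\<real>\<^sup>m\<close>.  Covering sets have to be bounded because \<^const>\<open>diameter\<close> is
  unspecified on unbounded sets; empty sets get weight 0 explicitly because \<open>0 ^ 0 = 1\<close>.
  That convention is what makes the case \<open>m = 0\<close> (two-point sphere in \<open>\<real>\<^sup>1\<close>)
  counting measure.
\<close>

definition hausdorff_weight :: "nat \<Rightarrow> 'a::metric_space set \<Rightarrow> ennreal" where
  "hausdorff_weight m E =
    (if E = {} then 0 else ennreal (unit_ball_vol (real m) * (diameter E / 2) ^ m))"

definition hausdorff_pre :: "nat \<Rightarrow> real \<Rightarrow> 'a::metric_space set \<Rightarrow> ennreal" where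
  "hausdorff_pre m \<delta> A =
    (INF E \<in> {E :: nat \<Rightarrow> 'a set. A \<subseteq> (\<Union>i. E i) \<and> (\<forall>i. bounded (E i) \<and> diameter (E i) \<le> \<delta>)}.
       \<Sum>i. hausdorff_weight m (E i))"

definition hausdorff_outer :: "nat \<Rightarrow> 'a::metric_space set \<Rightarrow> ennreal" where
  "hausdorff_outer m A = (SUP \<delta>\<in>{0<..}. hausdorff_pre m \<delta> A)"

definition hausdorff_measure :: "nat \<Rightarrow> 'a::metric_space measure" where
  "hausdorff_measure m = measure_of UNIV (sets borel) (hausdorff_outer m)"

text \<open>\<open>\<sigma> = \<H>\<^sup>n\<^sup>-\<^sup>1\<close> on \<open>\<S>\<^sup>n\<^sup>-\<^sup>1\<close>, completed (as \<^const>\<open>lebesgue\<close> is)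
  so that measurable functions are not restricted to Borel ones.\<close>

definition sphere_measure :: "(real ^ 'n) measure" where
  "sphere_measure =
    completion (restrict_space (hausdorff_measure (CARD('n) - 1)) (sphere 0 1))"


section \<open>The weak space and the mean-zero condition\<close>

text \<open>The sphere has finite surface measure, so the real-valued \<^const>\<open>measure\<close> is adequate.\<close>

definition weak_norm :: "(real ^ 'n \<Rightarrow> real) \<Rightarrow> ennreal" where
  "weak_norm \<Omega> =
    (SUP t\<in>{0<..}. ennreal
      (t * measure sphere_measure {y \<in> sphere 0 1. \<bar>\<Omega> y\<bar> > t} powr (1 / real CARD('n))))"

definition weak_space :: "(real ^ 'n \<Rightarrow> real) set" where
  "weak_space = {\<Omega> \<in> borel_measurable sphere_measure. weak_norm \<Omega> < \<infinity>}"

definition mean_zero :: "(real ^ 'n \<Rightarrow> real) \<Rightarrow> bool" where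
  "mean_zero \<Omega> \<longleftrightarrow> integrable sphere_measure \<Omega> \<and> integral\<^sup>L sphere_measure \<Omega> = 0"


section \<open>Test functions and gradients\<close>

definition partial_deriv :: "'n \<Rightarrow> (real ^ 'n \<Rightarrow> real) \<Rightarrow> real ^ 'n \<Rightarrow> real" where
  "partial_deriv i f x = frechet_derivative f (at x) (axis i 1)"

definition gradient :: "(real ^ 'n \<Rightarrow> real) \<Rightarrow> real ^ 'n \<Rightarrow> real ^ 'n" where
  "gradient f x = (\<chi> i. partial_deriv i f x)"

primrec C_k :: "nat \<Rightarrow> (real ^ 'n \<Rightarrow> real) \<Rightarrow> bool" where
  "C_k 0 f \<longleftrightarrow> continuous_on UNIV f"
| "C_k (Suc k) f \<longleftrightarrow>
     (\<forall>x. f differentiable (at x)) \<and> (\<forall>i. C_k k (partial_deriv i f))"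

definition Cc_smooth :: "(real ^ 'n \<Rightarrow> real) set" where
  "Cc_smooth = {f. (\<forall>k. C_k k f) \<and> compact (closure {x. f x \<noteq> 0})}"


section \<open>The rough fractional singular integral\<close>

definition truncated_op ::
    "(real ^ 'n \<Rightarrow> real) \<Rightarrow> real \<Rightarrow> (real ^ 'n \<Rightarrow> real) \<Rightarrow> real ^ 'n \<Rightarrow> real \<Rightarrow> real" where
  "truncated_op \<Omega> \<alpha> f x \<epsilon> =
    (LINT y:{y. norm y > \<epsilon>}|lebesgue.
       \<Omega> (y /\<^sub>R norm y) / norm y powr (real CARD('n) + 1 - \<alpha>) * f (x - y))"

definition rough_op ::
    "(real ^ 'n \<Rightarrow> real) \<Rightarrow> real \<Rightarrow> (real ^ 'n \<Rightarrow> real) \<Rightarrow> real ^ 'n \<Rightarrow> real" where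
  "rough_op \<Omega> \<alpha> f x = Lim (at_right 0) (truncated_op \<Omega> \<alpha> f x)"


section \<open>The Riesz potential\<close>

definition riesz_integral ::
    "real \<Rightarrow> (real ^ 'n \<Rightarrow> 'b::{banach, second_countable_topology}) \<Rightarrow> real ^ 'n \<Rightarrow> 'b" where
  "riesz_integral \<alpha> g x =
    (LINT y|lebesgue. (1 / norm (x - y) powr (real CARD('n) - \<alpha>)) *\<^sub>R g y)"

definition fourier :: "(real ^ 'n \<Rightarrow> complex) \<Rightarrow> real ^ 'n \<Rightarrow> complex" where
  "fourier g \<xi> = (LINT x|lebesgue. cis (- 2 * pi * (x \<bullet> \<xi>)) * g x)"

definition inverse_fourier :: "(real ^ 'n \<Rightarrow> complex) \<Rightarrow> real ^ 'n \<Rightarrow> complex" where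
  "inverse_fourier h x = (LINT \<xi>|lebesgue. cis (2 * pi * (x \<bullet> \<xi>)) * h \<xi>)"

text \<open>
  The multiplier \<open>|\<xi>|\<^sup>-\<^sup>\<alpha>\<close> times the transform of \<open>g\<close> is required to be the Fourier transform
  of the Riesz potential.  Since the potential of \<open>g\<close> is in general not
  integrable, this is read through Fourier inversion, for every \<open>g\<close> for which both sides converge
  absolutely at each point.  All Schwartz functions are of this kind.
\<close>

definition riesz_multiplier :: "real \<Rightarrow> (real ^ 'n \<Rightarrow> complex) \<Rightarrow> real ^ 'n \<Rightarrow> complex" where
  "riesz_multiplier \<alpha> g \<xi> = norm \<xi> powr (- \<alpha>) *\<^sub>R fourier g \<xi>"

definition is_riesz_const :: "'n::finite itself \<Rightarrow> real \<Rightarrow> real \<Rightarrow> bool" where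
  "is_riesz_const _ \<alpha> \<kappa> \<longleftrightarrow> \<kappa> > 0 \<and>
    (\<forall>g :: real ^ 'n \<Rightarrow> complex.
       integrable lebesgue g \<and> bounded (range g) \<and>
       integrable lebesgue (riesz_multiplier \<alpha> g) \<longrightarrow>
         (\<forall>x. \<kappa> *\<^sub>R riesz_integral \<alpha> g x = inverse_fourier (riesz_multiplier \<alpha> g) x))"

definition riesz_const :: "'n::finite itself \<Rightarrow> real \<Rightarrow> real" where
  "riesz_const N \<alpha> = (SOME \<kappa>. is_riesz_const N \<alpha> \<kappa>)"

definition riesz_potential :: "real \<Rightarrow> (real ^ 'n \<Rightarrow> real) \<Rightarrow> real ^ 'n \<Rightarrow> real" where
  "riesz_potential \<alpha> g x = riesz_const TYPE('n) \<alpha> * riesz_integral \<alpha> g x"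

end

theory Submission
  imports Defs "HOL-Probability.Characteristic_Functions"
begin

text \<open>
  Put \<open>s = n + 1 - \<alpha>\<close>, fix \<open>x\<close> and let \<open>F(y) = f(x - y)\<close>.  The idea is to read the weight
  \<open>|y|\<^sup>-\<^sup>s\<close> as a superposition of indicators of balls, \<open>|y|\<^sup>-\<^sup>s = \<integral>\<^sub>r\<^sub>>\<^sub>|\<^sub>y\<^sub>| s r\<^sup>-\<^sup>s\<^sup>-\<^sup>1 dr\<close>.  The truncated
  integral is then the integral over \<open>r > \<epsilon>\<close> of \<open>s r\<^sup>-\<^sup>s\<^sup>-\<^sup>1\<close> times the integral of \<open>\<Omega>(y') F(y)\<close> over
  \<open>\<epsilon> < |y| < r\<close>.  As \<open>\<Omega>\<close> has mean zero, \<open>F\<close> may be replaced by \<open>F - c\<close> in the latter, for any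
  constant \<open>c\<close> that may depend on \<open>r\<close>.  With \<open>c\<close> the average of \<open>F\<close> over \<open>B\<^sub>r\<close>, a Poincare
  inequality with the weight \<open>|\<Omega>(y')|\<close> bounds it by a multiple of
  \<open>\<parallel>\<Omega>\<parallel> r \<integral>\<^sub>B\<^sub>r |\<nabla>F|\<close>, and integrating in \<open>r\<close> gives \<open>\<parallel>\<Omega>\<parallel> \<integral> |\<nabla>F(z)| |z|\<^sup>1\<^sup>-\<^sup>s dz\<close>, where
  \<open>1 - s = \<alpha> - n\<close> is the exponent of the Riesz kernel.  The two bounds on \<open>\<alpha>\<close> enter as
  \<open>1 < s < n + 1\<close>: the first makes the last integral in \<open>r\<close> converge, the second makes the
  limit \<open>\<epsilon> \<rightarrow> 0\<close> exist.

  The weighted Poincare inequality (\<open>weighted_poincare\<close>) rests on the Morrey bound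
  \<open>\<integral>\<^sub>B\<^sub>(\<^sub>z\<^sub>,\<^sub>\<rho>\<^sub>) |\<Omega>(y')| dy \<le> C \<parallel>\<Omega>\<parallel> \<rho>\<^sup>\<beta>\<close> with \<open>\<beta> = n - 1 + 1/n\<close> (\<open>morrey\<close>).  An exponent above \<open>n - 1\<close>
  is what is needed, and weak \<open>L\<^sup>n\<close> on \<open>\<real>\<^sup>n\<close> alone gives just \<open>n - 1\<close>.  The gain comes from
  homogeneity: the level sets of \<open>|\<Omega>(y')|\<close> are cones, and a cone meets a ball of radius
  \<open>\<rho>\<close> inside a shell of thickness \<open>2\<rho>\<close>, hence in a set that is also small in proportion to
  the aperture of the cone.

  This argument takes place in \<open>\<real>\<^sup>n\<close> with Lebesgue measure.  The hypotheses on the sphere are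
  carried over by comparing \<open>\<H>\<^sup>n\<^sup>-\<^sup>1\<close> on the sphere with the measure
  \<open>A \<mapsto> |{y \<in> B\<^sub>1. y' \<in> A}|\<close>.  The two are proportional
  (\<open>hausdorff_measure_sphere_eq_cone_measure\<close>), which suffices because the mean-zero condition and,
  up to a constant, the weak norm are insensitive to a positive factor.  Proportionality
  holds because both are finite, nonzero and give to a ball centred on the sphere a mass that depends
  on the radius only, and two such measures agree up to a factor by double counting
  (\<open>uniform_measures_proportional\<close>).

  The Riesz potential is normalised by its Fourier multiplier, so the right-hand side is
  meaningful only once a positive normalising constant exists (\<open>riesz_const_pos\<close>).  It is found by writing
  \<open>|\<xi>|\<^sup>-\<^sup>\<alpha>\<close> as an integral of Gaussians.
\<close>

section \<open>Hausdorff measure as a Borel measure\<close>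

lemma hausdorff_pre_le:
  assumes "A \<subseteq> (\<Union>i. E i)" "\<And>i. bounded (E i)" "\<And>i. diameter (E i) \<le> \<delta>"
  shows "hausdorff_pre m \<delta> A \<le> (\<Sum>i. hausdorff_weight m (E i))"
  unfolding hausdorff_pre_def using assms by (intro INF_lower) auto

lemma hausdorff_pre_mono: "A \<subseteq> B \<Longrightarrow> hausdorff_pre m \<delta> A \<le> hausdorff_pre m \<delta> B"
  unfolding hausdorff_pre_def by (rule INF_superset_mono) auto

lemma hausdorff_pre_antimono: "\<delta> \<le> \<delta>' \<Longrightarrow> hausdorff_pre m \<delta>' A \<le> hausdorff_pre m \<delta> A"
  unfolding hausdorff_pre_def by (rule INF_superset_mono) (auto intro: order_trans)

lemma hausdorff_pre_empty:
  assumes "\<delta> \<ge> 0" shows "hausdorff_pre m \<delta> {} = 0"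
proof -
  have "hausdorff_pre m \<delta> ({}::'a set) \<le> (\<Sum>i::nat. hausdorff_weight m ({}::'a set))"
    using assms by (intro hausdorff_pre_le) auto
  then show ?thesis by (simp add: hausdorff_weight_def)
qed

lemma hausdorff_pre_countable_subadditive:
  "hausdorff_pre m \<delta> (\<Union>i::nat. A i) \<le> (\<Sum>i. hausdorff_pre m \<delta> (A i))"
proof (rule ennreal_le_epsilon)
  fix e :: real assume fin: "(\<Sum>i. hausdorff_pre m \<delta> (A i)) < top" and e: "e > 0"
  have "\<exists>E. A i \<subseteq> (\<Union>j. E j) \<and> (\<forall>j. bounded (E j) \<and> diameter (E j) \<le> \<delta>) \<and>
        (\<Sum>j. hausdorff_weight m (E j)) \<le> hausdorff_pre m \<delta> (A i) + ennreal (e * (1/2)^Suc i)" for i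
  proof -
    have "hausdorff_pre m \<delta> (A i) < top"
      using fin by (meson ennreal_suminf_lessD)
    then have "hausdorff_pre m \<delta> (A i) < hausdorff_pre m \<delta> (A i) + ennreal (e * (1/2)^Suc i)"
      using e ennreal_add_left_cancel_less[of "hausdorff_pre m \<delta> (A i)" 0] by simp
    then show ?thesis
      unfolding hausdorff_pre_def[of m \<delta> "A i"] INF_less_iff by (auto intro: less_imp_le)
  qed
  then obtain E where E: "\<And>i. A i \<subseteq> (\<Union>j. E i j)" "\<And>i j. bounded (E i j)" "\<And>i j. diameter (E i j) \<le> \<delta>"
     "\<And>i. (\<Sum>j. hausdorff_weight m (E i j)) \<le> hausdorff_pre m \<delta> (A i) + ennreal (e * (1/2)^Suc i)"
    by metis
  have "hausdorff_pre m \<delta> (\<Union>i. A i) \<le> (\<Sum>k. hausdorff_weight m (case_prod E (prod_decode k)))"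
  proof (rule hausdorff_pre_le)
    show "(\<Union>i. A i) \<subseteq> (\<Union>k. case_prod E (prod_decode k))"
    proof
      fix x assume "x \<in> (\<Union>i. A i)"
      then obtain i j where "x \<in> E i j" using E(1) by blast
      then have "x \<in> case_prod E (prod_decode (prod_encode (i,j)))" by simp
      then show "x \<in> (\<Union>k. case_prod E (prod_decode k))" by (rule UN_I[OF UNIV_I])
    qed
  qed (simp_all add: case_prod_beta E(2,3))
  also have "\<dots> = (\<Sum>i. \<Sum>j. hausdorff_weight m (E i j))"
    using suminf_ennreal_2dimen[of "\<lambda>i. \<Sum>j. hausdorff_weight m (E i j)" "\<lambda>p. hausdorff_weight m (case_prod E p)"]
    by (simp add: comp_def)
  also have "\<dots> \<le> (\<Sum>i. hausdorff_pre m \<delta> (A i) + ennreal (e * (1/2)^Suc i))"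
    by (intro suminf_le E(4)) auto
  also have "\<dots> = (\<Sum>i. hausdorff_pre m \<delta> (A i)) + (\<Sum>i. ennreal (e * (1/2)^Suc i))"
    by (rule suminf_add[symmetric]) auto
  also have "(\<Sum>i. ennreal (e * (1/2)^Suc i)) = ennreal e"
    using e sums_mult[OF power_half_series, of e] by (intro suminf_ennreal_eq) auto
  finally show "hausdorff_pre m \<delta> (\<Union>i. A i) \<le> (\<Sum>i. hausdorff_pre m \<delta> (A i)) + ennreal e" .
qed

text \<open>
  A covering set of diameter at most \<open>\<delta>\<close> cannot meet two sets that are more than \<open>\<delta>\<close> apart, so
  every admissible covering of the union splits into coverings of the two parts.
\<close>

lemma hausdorff_pre_separated:
  assumes "\<delta> \<ge> 0" and sep: "\<And>a b. a \<in> A \<Longrightarrow> b \<in> B \<Longrightarrow> \<delta> < dist a b"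
  shows "hausdorff_pre m \<delta> A + hausdorff_pre m \<delta> B \<le> hausdorff_pre m \<delta> (A \<union> B)"
  unfolding hausdorff_pre_def[of m \<delta> "A \<union> B"]
proof (rule INF_greatest)
  fix E :: "nat \<Rightarrow> 'a set"
  assume "E \<in> {E. A \<union> B \<subseteq> (\<Union>i. E i) \<and> (\<forall>i. bounded (E i) \<and> diameter (E i) \<le> \<delta>)}"
  then have cov: "A \<union> B \<subseteq> (\<Union>i. E i)" and bd: "\<And>i. bounded (E i)" and dm: "\<And>i. diameter (E i) \<le> \<delta>"
    by auto
  define EA where "EA i = (if E i \<inter> A = {} then {} else E i)" for i
  define EB where "EB i = (if E i \<inter> B = {} then {} else E i)" for i
  have "hausdorff_pre m \<delta> A \<le> (\<Sum>i. hausdorff_weight m (EA i))"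
    using cov bd dm \<open>\<delta> \<ge> 0\<close> by (intro hausdorff_pre_le) (fastforce simp: EA_def)+
  moreover have "hausdorff_pre m \<delta> B \<le> (\<Sum>i. hausdorff_weight m (EB i))"
    using cov bd dm \<open>\<delta> \<ge> 0\<close> by (intro hausdorff_pre_le) (fastforce simp: EB_def)+
  ultimately have "hausdorff_pre m \<delta> A + hausdorff_pre m \<delta> B
      \<le> (\<Sum>i. hausdorff_weight m (EA i)) + (\<Sum>i. hausdorff_weight m (EB i))"
    by (rule add_mono)
  also have "\<dots> = (\<Sum>i. hausdorff_weight m (EA i) + hausdorff_weight m (EB i))"
    by (rule suminf_add) auto
  also have "\<dots> \<le> (\<Sum>i. hausdorff_weight m (E i))"
  proof (intro suminf_le)
    fix i
    have "E i \<inter> A = {} \<or> E i \<inter> B = {}"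
    proof (rule ccontr)
      assume "\<not> ?thesis"
      then obtain a b where "a \<in> E i" "a \<in> A" "b \<in> E i" "b \<in> B" by blast
      then show False
        using sep[of a b] dm[of i] diameter_bounded_bound[OF bd[of i], of a b] by linarith
    qed
    then show "hausdorff_weight m (EA i) + hausdorff_weight m (EB i) \<le> hausdorff_weight m (E i)"
      by (auto simp: EA_def EB_def hausdorff_weight_def)
  qed auto
  finally show "hausdorff_pre m \<delta> A + hausdorff_pre m \<delta> B \<le> (\<Sum>i. hausdorff_weight m (E i))" .
qed

lemma hausdorff_pre_le_outer: "\<delta> > 0 \<Longrightarrow> hausdorff_pre m \<delta> A \<le> hausdorff_outer m A"
  unfolding hausdorff_outer_def by (rule SUP_upper) auto

lemma hausdorff_outer_mono: "A \<subseteq> B \<Longrightarrow> hausdorff_outer m A \<le> hausdorff_outer m B"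
  unfolding hausdorff_outer_def by (intro SUP_mono) (auto intro: hausdorff_pre_mono)

lemma hausdorff_outer_empty: "hausdorff_outer m {} = 0"
proof -
  have "hausdorff_outer m ({}::'a set) \<le> 0"
    unfolding hausdorff_outer_def by (rule SUP_least) (simp add: hausdorff_pre_empty)
  then show ?thesis by simp
qed

lemma hausdorff_outer_countable_subadditive:
  "hausdorff_outer m (\<Union>i::nat. A i) \<le> (\<Sum>i. hausdorff_outer m (A i))"
  unfolding hausdorff_outer_def[of m "\<Union>i. A i"]
proof (rule SUP_least)
  fix \<delta> :: real assume "\<delta> \<in> {0<..}"
  then show "hausdorff_pre m \<delta> (\<Union>i. A i) \<le> (\<Sum>i. hausdorff_outer m (A i))"
    by (intro order_trans[OF hausdorff_pre_countable_subadditive] suminf_le hausdorff_pre_le_outer) auto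
qed

lemma hausdorff_outer_subadditive:
  "hausdorff_outer m (A \<union> B) \<le> hausdorff_outer m A + hausdorff_outer m B"
proof -
  have "hausdorff_outer m (\<Union>i. binaryset A B i) \<le> (\<Sum>i. hausdorff_outer m (binaryset A B i))"
    by (rule hausdorff_outer_countable_subadditive)
  then show ?thesis
    by (simp add: UN_binaryset_eq suminf_binaryset_eq hausdorff_outer_empty)
qed

text \<open>
  Metric additivity, the property that makes Borel sets measurable.  The supremum over \<open>\<delta>\<close> is
  taken along a decreasing sequence below the distance of the two sets, where it commutes with
  the sum.
\<close>

lemma hausdorff_outer_separated:
  assumes "d > 0" and sep: "\<And>a b. a \<in> A \<Longrightarrow> b \<in> B \<Longrightarrow> d \<le> dist a b"
  shows "hausdorff_outer m A + hausdorff_outer m B \<le> hausdorff_outer m (A \<union> B)"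
proof -
  define \<delta> where "\<delta> k = min (d / 2) (1 / real (Suc k))" for k
  have \<delta>: "\<delta> k > 0" "\<delta> k < d" for k using assms(1) by (auto simp: \<delta>_def)
  have dec: "\<delta> l \<le> \<delta> k" if "k \<le> l" for k l
    using that unfolding \<delta>_def by (intro min.mono) (auto simp: field_simps)
  have seq: "hausdorff_outer m X = (SUP k. hausdorff_pre m (\<delta> k) X)" for X :: "'a set"
  proof (rule antisym)
    show "hausdorff_outer m X \<le> (SUP k. hausdorff_pre m (\<delta> k) X)"
      unfolding hausdorff_outer_def
    proof (rule SUP_least)
      fix \<eta> :: real assume "\<eta> \<in> {0<..}"
      then obtain k where "1 / real (Suc k) < \<eta>" using nat_approx_posE by auto
      then have "\<delta> k \<le> \<eta>" by (simp add: \<delta>_def)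
      then show "hausdorff_pre m \<eta> X \<le> (SUP k. hausdorff_pre m (\<delta> k) X)"
        by (intro SUP_upper2[of k] hausdorff_pre_antimono) auto
    qed
  qed (auto intro!: SUP_least hausdorff_pre_le_outer \<delta>)
  have inc: "incseq (\<lambda>k. hausdorff_pre m (\<delta> k) X)" for X :: "'a set"
    by (auto simp: incseq_def intro!: hausdorff_pre_antimono dec)
  have "hausdorff_outer m A + hausdorff_outer m B
      = (SUP k. hausdorff_pre m (\<delta> k) A + hausdorff_pre m (\<delta> k) B)"
    unfolding seq by (rule ennreal_SUP_add[symmetric]) (rule inc)+
  also have "\<dots> \<le> (SUP k. hausdorff_pre m (\<delta> k) (A \<union> B))"
  proof (rule SUP_mono')
    fix k
    show "hausdorff_pre m (\<delta> k) A + hausdorff_pre m (\<delta> k) B \<le> hausdorff_pre m (\<delta> k) (A \<union> B)"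
      using \<delta>[of k] sep by (intro hausdorff_pre_separated) (force intro: less_le_trans)+
  qed
  finally show ?thesis unfolding seq .
qed

text \<open>
  Caratheodory's argument for metric outer measures: \<open>A - F\<close> is exhausted by the parts at distance
  at least \<open>1/(k+1)\<close> from \<open>F\<close>, on which metric additivity applies.  The error is controlled by the layers between
  consecutive distances: layers of equal parity are separated from each other, so
  their outer measures have a finite sum and the tails of that sum vanish.
\<close>

lemma closed_hausdorff_measurable:
  fixes F A :: "'a::metric_space set"
  assumes "closed F"
  shows "hausdorff_outer m (F \<inter> A) + hausdorff_outer m (A - F) \<le> hausdorff_outer m A"
proof (cases "F = {} \<or> hausdorff_outer m A = top")
  case True
  then show ?thesis by (auto simp: hausdorff_outer_empty)
next
  case False
  then have ne: "F \<noteq> {}" and fin: "hausdorff_outer m A < top" by (auto simp: top.not_eq_extremum)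
  \<comment> \<open>\<open>R j\<close> is the layer by which \<open>K (j+1)\<close> exceeds \<open>K j\<close>.\<close>
  define K where "K k = {x\<in>A. 1 / real (k+1) \<le> infdist x F}" for k :: nat
  define R where "R j = {x\<in>A. 1 / real (j+2) \<le> infdist x F \<and> infdist x F < 1 / real (j+1)}" for j :: nat
  have gap: "infdist x F - infdist y F \<le> dist x y" for x y
    using infdist_triangle[of x F y] by simp
  have 1: "hausdorff_outer m (F \<inter> A) + hausdorff_outer m (K k) \<le> hausdorff_outer m A" for k
  proof -
    have "hausdorff_outer m (F \<inter> A) + hausdorff_outer m (K k) \<le> hausdorff_outer m ((F \<inter> A) \<union> K k)"
    proof (rule hausdorff_outer_separated)
      show "1 / real (k+1) \<le> dist a b" if "a \<in> F \<inter> A" "b \<in> K k" for a b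
        using that infdist_le[of a F b] by (auto simp: K_def dist_commute)
    qed auto
    also have "\<dots> \<le> hausdorff_outer m A" by (rule hausdorff_outer_mono) (auto simp: K_def)
    finally show ?thesis .
  qed
  have parity: "(\<Sum>j<N. hausdorff_outer m (R (2*j+p))) \<le> hausdorff_outer m (\<Union>j<N. R (2*j+p))" for N p
  proof (induction N)
    case (Suc N)
    have "(\<Sum>j<Suc N. hausdorff_outer m (R (2*j+p)))
        \<le> hausdorff_outer m (\<Union>j<N. R (2*j+p)) + hausdorff_outer m (R (2*N+p))"
      using Suc by (simp add: add_mono)
    also have "\<dots> \<le> hausdorff_outer m ((\<Union>j<N. R (2*j+p)) \<union> R (2*N+p))"
    proof (cases "N = 0")
      case True
      then show ?thesis by (simp add: hausdorff_outer_empty)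
    next
      case False
      show ?thesis
      proof (rule hausdorff_outer_separated)
        show "1 / real (2*N+p) - 1 / real (2*N+p+1) > 0"
          using False by (simp add: frac_less2 del: of_nat_add of_nat_mult)
        fix a b assume a: "a \<in> (\<Union>j<N. R (2*j+p))" and b: "b \<in> R (2*N+p)"
        then obtain j where "j < N" "1 / real (2*j+p+2) \<le> infdist a F" by (auto simp: R_def)
        moreover have "1 / real (2*N+p) \<le> 1 / real (2*j+p+2)"
          using \<open>j < N\<close> by (intro divide_left_mono) auto
        moreover have "infdist b F < 1 / real (2*N+p+1)" using b by (auto simp: R_def)
        ultimately show "1 / real (2*N+p) - 1 / real (2*N+p+1) \<le> dist a b"
          using gap[of a b] by linarith
      qed
    qed
    also have "(\<Union>j<N. R (2*j+p)) \<union> R (2*N+p) = (\<Union>j<Suc N. R (2*j+p))"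
      by (auto simp: lessThan_Suc)
    finally show ?case .
  qed (simp add: hausdorff_outer_empty)
  have sums: "(\<Sum>j<N. hausdorff_outer m (R (2*j+p))) \<le> hausdorff_outer m A" for N p
    by (rule order_trans[OF parity hausdorff_outer_mono]) (auto simp: R_def)
  have Rfin: "(\<Sum>j. hausdorff_outer m (R j)) \<le> 2 * hausdorff_outer m A"
  proof (rule suminf_le_const)
    fix N
    have "(\<Sum>j<N. hausdorff_outer m (R j)) \<le> (\<Sum>j<2*N. hausdorff_outer m (R j))"
      by (rule sum_mono2) auto
    also have "\<dots> = (\<Sum>j<N. hausdorff_outer m (R (2*j+0))) + (\<Sum>j<N. hausdorff_outer m (R (2*j+1)))"
      by (induction N) (auto simp: ac_simps)
    also have "\<dots> \<le> hausdorff_outer m A + hausdorff_outer m A"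
      by (intro add_mono sums)
    finally show "(\<Sum>j<N. hausdorff_outer m (R j)) \<le> 2 * hausdorff_outer m A" by (simp add: mult_2)
  qed auto
  then have Rfin': "(\<Sum>j. hausdorff_outer m (R j)) < top"
    by (rule le_less_trans) (use fin in \<open>auto simp: ennreal_mult_less_top\<close>)
  define r where "r j = enn2real (hausdorff_outer m (R j))" for j
  have r: "hausdorff_outer m (R j) = ennreal (r j)" "r j \<ge> 0" for j
    using ennreal_suminf_lessD[OF Rfin', of j] by (auto simp: r_def)
  have summ: "summable r"
    using Rfin' unfolding r(1) by (metis r(2) less_top summable_suminf_not_top)
  show ?thesis
  proof (rule ennreal_le_epsilon)
    fix e :: real assume "e > 0"
    then obtain k where "norm (\<Sum>j. r (j + k)) < e"
      using suminf_exist_split[OF _ summ] by blast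
    then have tail: "(\<Sum>j. hausdorff_outer m (R (j+k))) \<le> ennreal e"
      unfolding r(1) using summ r(2)
      by (subst suminf_ennreal2) (auto simp: summable_iff_shift intro!: ennreal_leI)
    have "A - F \<subseteq> K k \<union> (\<Union>j. R (j+k))"
    proof
      fix x assume x: "x \<in> A - F"
      then have pos: "infdist x F > 0" using ne assms infdist_pos_not_in_closed by blast
      show "x \<in> K k \<union> (\<Union>j. R (j+k))"
      proof (cases "x \<in> K k")
        case False
        define l where "l = (LEAST l. 1 / real (l+1) \<le> infdist x F)"
        obtain l0 where "1 / real (Suc l0) < infdist x F" using nat_approx_posE[OF pos] by blast
        then have "1 / real (l0+1) \<le> infdist x F" by simp
        then have l: "1 / real (l+1) \<le> infdist x F" unfolding l_def by (rule LeastI)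
        have nl: "\<not> 1 / real (i+1) \<le> infdist x F" if "i < l" for i
          using that not_less_Least unfolding l_def by blast
        have "k < l"
        proof (rule ccontr)
          assume "\<not> k < l"
          then have "1 / real (k+1) \<le> 1 / real (l+1)" by (simp add: field_simps)
          with l False x show False by (auto simp: K_def)
        qed
        then obtain j where j: "l = Suc (j + k)" using less_iff_Suc_add by (metis add.commute)
        have "x \<in> R (j+k)" using x l nl[of "j+k"] by (auto simp: R_def j not_le)
        then show ?thesis by blast
      qed simp
    qed
    then have "hausdorff_outer m (A - F) \<le> hausdorff_outer m (K k \<union> (\<Union>j. R (j+k)))"
      by (rule hausdorff_outer_mono)
    also have "\<dots> \<le> hausdorff_outer m (K k) + (\<Sum>j. hausdorff_outer m (R (j+k)))"
      by (intro order_trans[OF hausdorff_outer_subadditive] add_left_mono hausdorff_outer_countable_subadditive)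
    also have "\<dots> \<le> hausdorff_outer m (K k) + ennreal e" by (intro add_left_mono tail)
    finally have "hausdorff_outer m (F \<inter> A) + hausdorff_outer m (A - F)
       \<le> hausdorff_outer m (F \<inter> A) + (hausdorff_outer m (K k) + ennreal e)" by (rule add_left_mono)
    also have "\<dots> \<le> hausdorff_outer m A + ennreal e"
      using 1[of k] by (simp add: add.assoc[symmetric] add_right_mono)
    finally show "hausdorff_outer m (F \<inter> A) + hausdorff_outer m (A - F) \<le> hausdorff_outer m A + ennreal e" .
  qed
qed

lemma measure_space_hausdorff: "measure_space UNIV (sets borel) (hausdorff_outer m :: 'a::metric_space set \<Rightarrow> _)"
proof -
  interpret P: sigma_algebra UNIV "UNIV :: 'a set set" using sigma_algebra_Pow[of "UNIV::'a set"] by simp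
  let ?L = "lambda_system UNIV UNIV (hausdorff_outer m :: 'a set \<Rightarrow> _)"
  have oms: "outer_measure_space UNIV (hausdorff_outer m :: 'a set \<Rightarrow> _)"
    unfolding outer_measure_space_def positive_def increasing_def countably_subadditive_def
    by (auto simp: hausdorff_outer_empty hausdorff_outer_mono hausdorff_outer_countable_subadditive)
  have L: "measure_space UNIV ?L (hausdorff_outer m)"
    using P.caratheodory_lemma[OF oms] .
  interpret L: sigma_algebra UNIV ?L using L by (simp add: measure_space_def)
  have "F \<in> ?L" if "closed F" for F
    unfolding lambda_system_def
  proof (clarsimp, rule antisym)
    fix A :: "'a set"
    show "hausdorff_outer m (F \<inter> A) + hausdorff_outer m ((UNIV - F) \<inter> A) \<le> hausdorff_outer m A"
      using closed_hausdorff_measurable[OF that, of m A] by (simp add: Diff_eq Int_commute)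
    have "hausdorff_outer m A \<le> hausdorff_outer m ((F \<inter> A) \<union> ((UNIV - F) \<inter> A))"
      by (rule hausdorff_outer_mono) auto
    also have "\<dots> \<le> hausdorff_outer m (F \<inter> A) + hausdorff_outer m ((UNIV - F) \<inter> A)"
      by (rule hausdorff_outer_subadditive)
    finally show "hausdorff_outer m A \<le> hausdorff_outer m (F \<inter> A) + hausdorff_outer m ((UNIV - F) \<inter> A)" .
  qed
  then have "sigma_sets UNIV (Collect closed) \<subseteq> ?L"
    by (intro L.sigma_sets_subset) auto
  then have "sets borel \<subseteq> ?L"
    by (simp add: borel_eq_closed)
  then show ?thesis
    using L by (rule measure_down[rotated 2]) (use sets.sigma_algebra_axioms[of "borel :: 'a measure"] in simp)
qed

lemma sets_hausdorff_measure [simp, measurable_cong]: "sets (hausdorff_measure m) = sets borel"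
  and space_hausdorff_measure [simp]: "space (hausdorff_measure m) = UNIV"
  unfolding hausdorff_measure_def
   apply (simp_all add: sets_measure_of_conv space_measure_of_conv)
  using sets.sigma_sets_eq[of borel] by simp

lemma emeasure_hausdorff_measure:
  fixes A :: "'a::metric_space set"
  assumes "A \<in> sets borel"
  shows "emeasure (hausdorff_measure m) A = hausdorff_outer m A"
proof (rule emeasure_measure_of_sigma[of UNIV "sets borel" "hausdorff_outer m" A, folded hausdorff_measure_def])
  note * = measure_space_hausdorff[of m, where ?'a = 'a, unfolded measure_space_def]
  show "sigma_algebra UNIV (sets borel :: 'a set set)" using * by blast
  show "positive (sets borel) (hausdorff_outer m :: 'a set \<Rightarrow> _)" using * by blast
  show "countably_additive (sets borel) (hausdorff_outer m :: 'a set \<Rightarrow> _)" using * by blast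
qed (rule assms)

section \<open>Measures that give equal mass to balls of equal radius\<close>

lemma borel_measurable_sgn_vector [measurable]:
  "(sgn :: 'a::euclidean_space \<Rightarrow> 'a) \<in> borel_measurable borel"
  unfolding sgn_div_norm[abs_def] by measurable

lemma nn_integral_lborel_affine:
  fixes t :: "'a::euclidean_space"
  assumes [measurable]: "f \<in> borel_measurable borel" and "c \<noteq> 0"
  shows "(\<integral>\<^sup>+x. f x \<partial>lborel) = ennreal (\<bar>c\<bar> ^ DIM('a)) * (\<integral>\<^sup>+x. f (t + c *\<^sub>R x) \<partial>lborel)"
  by (subst lborel_affine[OF \<open>c \<noteq> 0\<close>, of t])
     (simp add: nn_integral_density nn_integral_distr nn_integral_cmult)

lemma emeasure_cone_ball:
  fixes C :: "'a::euclidean_space set"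
  assumes [measurable]: "C \<in> sets borel"
    and cone: "\<And>c y. c > 0 \<Longrightarrow> c *\<^sub>R y \<in> C \<longleftrightarrow> y \<in> C" and "r \<ge> 0"
  shows "emeasure lborel (C \<inter> ball 0 r) = ennreal (r ^ DIM('a)) * emeasure lborel (C \<inter> ball 0 1)"
proof (cases "r = 0")
  case False
  with \<open>r \<ge> 0\<close> have r: "r > 0" by simp
  have "emeasure lborel (C \<inter> ball 0 r) = (\<integral>\<^sup>+x. indicator (C \<inter> ball 0 r) x \<partial>lborel)"
    by simp
  also have "\<dots> = ennreal (\<bar>r\<bar> ^ DIM('a)) * (\<integral>\<^sup>+x. indicator (C \<inter> ball 0 r) (0 + r *\<^sub>R x) \<partial>lborel)"
    using r by (intro nn_integral_lborel_affine) (measurable, auto)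
  also have "(\<lambda>x. indicator (C \<inter> ball 0 r) (0 + r *\<^sub>R x) :: ennreal) = indicator (C \<inter> ball 0 1)"
    using r cone by (auto simp: fun_eq_iff indicator_def)
  finally show ?thesis using r by simp
qed simp

text \<open>
  The substitute for polar coordinates used throughout: for a cone, the radial and the spherical
  extent separate.
\<close>

lemma emeasure_cone_annulus:
  fixes C :: "'a::euclidean_space set"
  assumes C[measurable]: "C \<in> sets borel"
    and cone: "\<And>c y. c > 0 \<Longrightarrow> c *\<^sub>R y \<in> C \<longleftrightarrow> y \<in> C" and ab: "0 \<le> a" "a \<le> b"
  shows "emeasure lborel (C \<inter> (ball 0 b - ball 0 a))
    = ennreal (b ^ DIM('a) - a ^ DIM('a)) * emeasure lborel (C \<inter> ball 0 1)"
proof -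
  have fin: "emeasure lborel (C \<inter> ball 0 r) \<noteq> \<infinity>" for r
    using le_less_trans[OF emeasure_mono[of "C \<inter> ball 0 r" "ball 0 r" lborel] emeasure_lborel_ball_finite[of 0 r]]
    by (auto simp: less_top)
  have "C \<inter> (ball 0 b - ball 0 a) = (C \<inter> ball 0 b) - (C \<inter> ball 0 a)" by auto
  then have "emeasure lborel (C \<inter> (ball 0 b - ball 0 a))
      = emeasure lborel (C \<inter> ball 0 b) - emeasure lborel (C \<inter> ball 0 a)"
    using fin[of a] subset_ball[OF ab(2), of "0::'a"] by (simp add: emeasure_Diff le_infI2 Int_mono)
  also have "\<dots> = ennreal (b ^ DIM('a)) * emeasure lborel (C \<inter> ball 0 1)
      - ennreal (a ^ DIM('a)) * emeasure lborel (C \<inter> ball 0 1)"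
    using ab emeasure_cone_ball[OF C cone, of a] emeasure_cone_ball[OF C cone, of b] by simp
  also have "\<dots> = ennreal (b ^ DIM('a) - a ^ DIM('a)) * emeasure lborel (C \<inter> ball 0 1)"
    using fin[of 1] ab
    by (cases "emeasure lborel (C \<inter> ball 0 1)")
       (auto simp: ennreal_mult[symmetric] ennreal_minus left_diff_distrib power_mono)
  finally show ?thesis .
qed

text \<open>
  Both sides are the mass, under the product of \<open>M\<close> and \<open>N\<close>, of the pairs \<open>(x, y)\<close> with \<open>x \<in> A\<close> at
  distance less than \<open>r\<close>.
\<close>

lemma double_counting:
  fixes M N :: "'a::euclidean_space measure"
  assumes "sigma_finite_measure M" "sigma_finite_measure N"
    and [measurable_cong]: "sets M = sets borel" "sets N = sets borel" and [measurable]: "A \<in> sets borel"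
  shows "(\<integral>\<^sup>+x. indicator A x * emeasure N (ball x r) \<partial>M) = (\<integral>\<^sup>+y. emeasure M (A \<inter> ball y r) \<partial>N)"
proof -
  interpret M: sigma_finite_measure M by fact
  interpret N: sigma_finite_measure N by fact
  interpret pair_sigma_finite M N ..
  let ?f = "\<lambda>x y. indicator A x * indicator {p. dist (fst p) (snd p) < r} (x, y) :: ennreal"
  have "(\<integral>\<^sup>+x. indicator A x * emeasure N (ball x r) \<partial>M) = (\<integral>\<^sup>+x. \<integral>\<^sup>+y. ?f x y \<partial>N \<partial>M)"
  proof (rule nn_integral_cong)
    fix x
    have "(\<integral>\<^sup>+y. ?f x y \<partial>N) = (\<integral>\<^sup>+y. indicator A x * indicator (ball x r) y \<partial>N)"
      by (intro nn_integral_cong) (auto simp: indicator_def)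
    then show "indicator A x * emeasure N (ball x r) = (\<integral>\<^sup>+y. ?f x y \<partial>N)"
      by (simp add: nn_integral_cmult_indicator)
  qed
  also have "\<dots> = (\<integral>\<^sup>+y. \<integral>\<^sup>+x. ?f x y \<partial>M \<partial>N)"
    by (rule Fubini'[symmetric]) (simp add: case_prod_beta, measurable)
  also have "\<dots> = (\<integral>\<^sup>+y. emeasure M (A \<inter> ball y r) \<partial>N)"
  proof (rule nn_integral_cong)
    fix y
    have "(\<integral>\<^sup>+x. ?f x y \<partial>M) = (\<integral>\<^sup>+x. indicator (A \<inter> ball y r) x \<partial>M)"
      by (intro nn_integral_cong) (auto simp: indicator_def dist_commute)
    then show "(\<integral>\<^sup>+x. ?f x y \<partial>M) = emeasure M (A \<inter> ball y r)" by simp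
  qed
  finally show ?thesis .
qed

text \<open>
  Count the pairs \<open>(x, y)\<close> at distance less than \<open>r\<close> with \<open>B(x, r) \<subseteq> U\<close>.  Summing over \<open>y\<close> first
  gives \<open>g(r)\<close> times the mass of all such \<open>x\<close>; summing over \<open>x\<close> first gives at most \<open>g(r)\<close>
  times the mass of \<open>U\<close>, as \<open>y\<close> lies in \<open>U\<close>.  It remains to divide by \<open>g(r)\<close> and
  let \<open>r \<rightarrow> 0\<close>.
\<close>

lemma equal_balls_imp_le_open:
  fixes M N :: "'a::euclidean_space measure"
  assumes sf: "sigma_finite_measure M" "sigma_finite_measure N"
    and sets [measurable_cong]: "sets M = sets borel" "sets N = sets borel"
    and X: "AE x in M. x \<in> X" "AE x in N. x \<in> X"
    and balls: "\<And>x r. x \<in> X \<Longrightarrow> r > 0 \<Longrightarrow> emeasure M (ball x r) = g r"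
               "\<And>x r. x \<in> X \<Longrightarrow> r > 0 \<Longrightarrow> emeasure N (ball x r) = g r"
    and g: "\<And>r. r > 0 \<Longrightarrow> 0 < g r" "\<And>r. r > 0 \<Longrightarrow> g r < \<infinity>"
    and U: "open U"
  shows "emeasure M U \<le> emeasure N U"
proof -
  define V where "V r = {x. ball x r \<subseteq> U}" for r
  have "- V r = (\<Union>z\<in>-U. ball z r)" for r by (auto simp: V_def dist_commute)
  then have "closed (V r)" for r by (auto simp: closed_def)
  then have V[measurable]: "V r \<in> sets borel" for r by auto
  have [measurable]: "U \<in> sets borel" using U by auto
  have le: "emeasure M (V r) \<le> emeasure N U" if r: "r > 0" for r
  proof -
    have "g r * emeasure M (V r) = (\<integral>\<^sup>+x. g r * indicator (V r) x \<partial>M)"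
      by (simp add: nn_integral_cmult sets)
    also have "\<dots> = (\<integral>\<^sup>+x. indicator (V r) x * emeasure N (ball x r) \<partial>M)"
      using X(1) balls(2) r by (intro nn_integral_cong_AE) (auto simp: mult.commute)
    also have "\<dots> = (\<integral>\<^sup>+y. emeasure M (V r \<inter> ball y r) \<partial>N)"
      by (rule double_counting[OF sf sets V])
    also have "\<dots> \<le> (\<integral>\<^sup>+y. g r * indicator U y \<partial>N)"
    proof (rule nn_integral_mono_AE)
      show "AE y in N. emeasure M (V r \<inter> ball y r) \<le> g r * indicator U y"
        using X(2)
      proof (eventually_elim)
        fix y assume y: "y \<in> X"
        show "emeasure M (V r \<inter> ball y r) \<le> g r * indicator U y"
        proof (cases "y \<in> U")
          case True
          have "emeasure M (V r \<inter> ball y r) \<le> emeasure M (ball y r)"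
            by (rule emeasure_mono) (auto simp: sets)
          then show ?thesis using balls(1)[OF y r] True by simp
        next
          case False
          then have "V r \<inter> ball y r = {}" by (auto simp: V_def dist_commute)
          then show ?thesis by simp
        qed
      qed
    qed
    also have "\<dots> = g r * emeasure N U" by (simp add: nn_integral_cmult sets)
    finally show ?thesis using g[OF r] by (subst (asm) ennreal_mult_le_mult_iff) auto
  qed
  have "U = (\<Union>k. V (1 / real (Suc k)))"
  proof safe
    fix x assume "x \<in> U"
    then obtain e where "e > 0" "ball x e \<subseteq> U" using U open_contains_ball by blast
    moreover obtain k where "1 / real (Suc k) < e" using nat_approx_posE[OF \<open>e > 0\<close>] by blast
    ultimately show "x \<in> (\<Union>k. V (1 / real (Suc k)))"
      by (intro UN_I[of k]) (auto simp: V_def)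
  next
    fix x k assume "x \<in> V (1 / real (Suc k))"
    then show "x \<in> U" using centre_in_ball[of x "1 / real (Suc k)"] by (auto simp: V_def simp del: centre_in_ball)
  qed
  moreover have "incseq (\<lambda>k. V (1 / real (Suc k)))"
    unfolding incseq_def V_def
  proof clarsimp
    fix i j :: nat and x z assume ij: "i \<le> j" and sub: "ball x (1 / (1 + real i)) \<subseteq> U" and z: "dist x z < 1 / (1 + real j)"
    have "1 / (1 + real j) \<le> 1 / (1 + real i)" using ij by (simp add: field_simps)
    with sub z show "z \<in> U" by auto
  qed
  ultimately have "emeasure M U = (SUP k. emeasure M (V (1 / real (Suc k))))"
    by (simp add: SUP_emeasure_incseq sets image_subset_iff)
  also have "\<dots> \<le> emeasure N U" by (intro SUP_least le) simp
  finally show ?thesis .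
qed

lemma equal_balls_imp_eq:
  fixes M N :: "'a::euclidean_space measure"
  assumes sf: "sigma_finite_measure M" "sigma_finite_measure N"
    and sets: "sets M = sets borel" "sets N = sets borel"
    and X: "AE x in M. x \<in> X" "AE x in N. x \<in> X"
    and balls: "\<And>x r. x \<in> X \<Longrightarrow> r > 0 \<Longrightarrow> emeasure M (ball x r) = g r"
               "\<And>x r. x \<in> X \<Longrightarrow> r > 0 \<Longrightarrow> emeasure N (ball x r) = g r"
    and g: "\<And>r. r > 0 \<Longrightarrow> 0 < g r" "\<And>r. r > 0 \<Longrightarrow> g r < \<infinity>"
    and fin: "\<And>r. emeasure M (ball 0 r) \<noteq> \<infinity>"
  shows "M = N"
proof (rule measure_eqI_generator_eq[where \<Omega> = UNIV and E = "Collect open" and A = "\<lambda>i. ball 0 (real i)"])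
  show "Int_stable (Collect open :: 'a set set)" by (auto simp: Int_stable_def)
  show "sets M = sigma_sets UNIV (Collect open)" "sets N = sigma_sets UNIV (Collect open)"
    by (simp_all add: sets borel_def)
  show "emeasure M U = emeasure N U" if "U \<in> Collect open" for U
    using that
    by (intro antisym equal_balls_imp_le_open[OF sf sets X balls g]
          equal_balls_imp_le_open[OF sf(2,1) sets(2,1) X(2,1) balls(2,1) g]) auto
  show "(\<Union>i. ball 0 (real i)) = (UNIV :: 'a set)" by (auto simp: reals_Archimedean2)
qed (use fin in auto)

text \<open>
  An orthogonal map permutes the balls of a given radius, so the image measure has the same mass on
  balls as Lebesgue measure.
\<close>

lemma lborel_distr_orthogonal:
  fixes T :: "'a::euclidean_space \<Rightarrow> 'a"
  assumes T: "orthogonal_transformation T"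
  shows "distr lborel borel T = lborel"
proof -
  have lin: "linear T" using T by (rule orthogonal_transformation_linear)
  then have [measurable]: "T \<in> borel_measurable borel"
    by (intro borel_measurable_continuous_onI linear_continuous_on linear_conv_bounded_linear[THEN iffD1])
  obtain T' where T': "\<And>x. T (T' x) = x"
    using orthogonal_transformation_surj[OF T] by (metis surjD)
  have iso: "dist (T x) (T y) = dist x y" for x y
    using T lin by (simp add: dist_norm orthogonal_transformation_norm linear_diff[symmetric])
  have ball: "T -` ball x r = ball (T' x) r" for x r
    using iso T' by (auto simp: set_eq_iff) metis+
  have b: "emeasure (distr lborel borel T) (ball x r) = ennreal (unit_ball_vol (DIM('a)) * r ^ DIM('a))"
    if "r > 0" for x r
    using that by (simp add: emeasure_distr ball emeasure_ball)
  show ?thesis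
  proof (rule sym, rule equal_balls_imp_eq[where X = UNIV and g = "\<lambda>r. ennreal (unit_ball_vol (DIM('a)) * r ^ DIM('a))"])
    show "sigma_finite_measure (distr lborel borel T)"
    proof (unfold sigma_finite_measure_def, intro exI conjI)
      show "countable (range (\<lambda>i::nat. ball 0 (real i) :: 'a set))" by simp
      show "range (\<lambda>i::nat. ball 0 (real i) :: 'a set) \<subseteq> sets (distr lborel borel T)" by auto
      show "\<Union> (range (\<lambda>i::nat. ball 0 (real i) :: 'a set)) = space (distr lborel borel T)"
        by (auto simp: reals_Archimedean2)
      show "\<forall>a\<in>range (\<lambda>i::nat. ball 0 (real i)). emeasure (distr lborel borel T) a \<noteq> \<infinity>"
        by (auto simp: emeasure_distr ball emeasure_ball)
    qed
    show "emeasure lborel (ball (0::'a) r) \<noteq> \<infinity>" for r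
      using emeasure_lborel_ball_finite[of "0::'a" r] by simp
    show "emeasure (distr lborel borel T) (ball x r) = ennreal (unit_ball_vol (DIM('a)) * r ^ DIM('a))"
      if "r > 0" for x r using b that .
    show "emeasure lborel (ball x r) = ennreal (unit_ball_vol (DIM('a)) * r ^ DIM('a))"
      if "r > 0" for x :: 'a and r using that by (simp add: emeasure_ball)
    show "0 < ennreal (unit_ball_vol (DIM('a)) * r ^ DIM('a))" if "r > 0" for r
      using that by (simp add: unit_ball_vol_pos)
    show "sigma_finite_measure (lborel :: 'a measure)" by (rule sigma_finite_lborel)
    show "ennreal (unit_ball_vol (DIM('a)) * r ^ DIM('a)) < \<infinity>" for r by (simp add: less_top[symmetric])
  qed simp_all
qed

text \<open>
  Double counting over all pairs at distance less than \<open>r\<close> shows that the masses of balls under \<open>M\<close>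
  and \<open>N\<close> are in the ratio of the total masses.  After rescaling, the measures
  agree on balls and therefore everywhere.
\<close>

lemma uniform_measures_proportional:
  fixes M N :: "'a::euclidean_space measure"
  assumes fin: "finite_measure M" "finite_measure N"
    and sets [measurable_cong]: "sets M = sets borel" "sets N = sets borel"
    and S: "compact S" "AE x in M. x \<in> S" "AE x in N. x \<in> S"
    and balls: "\<And>x y r. x \<in> S \<Longrightarrow> y \<in> S \<Longrightarrow> emeasure M (ball x r) = emeasure M (ball y r)"
               "\<And>x y r. x \<in> S \<Longrightarrow> y \<in> S \<Longrightarrow> emeasure N (ball x r) = emeasure N (ball y r)"
    and pos: "emeasure M UNIV \<noteq> 0" "emeasure N UNIV \<noteq> 0"
    and A: "A \<in> sets borel"
  shows "emeasure N UNIV * emeasure M A = emeasure M UNIV * emeasure N A"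
proof -
  interpret M: finite_measure M by fact
  interpret N: finite_measure N by fact
  have sf: "sigma_finite_measure M" "sigma_finite_measure N" ..
  have spaces: "space M = UNIV" "space N = UNIV" using sets by (auto dest: sets_eq_imp_space_eq)
  have [measurable]: "S \<in> sets borel" using S(1) by (simp add: borel_compact)
  have null: "emeasure M (- S) = 0" "emeasure N (- S) = 0"
    using S(2,3) by (auto simp: AE_iff_measurable[OF _ refl] spaces sets Collect_neg_eq)
  obtain p where p: "p \<in> S"
  proof (cases "S = {}")
    case True
    then have "emeasure M (space M) = 0" using null spaces by simp
    then show ?thesis using pos sets_eq_imp_space_eq[OF sets(1)] by simp
  qed auto
  have key: "emeasure N UNIV * emeasure M (ball x r) = emeasure M UNIV * emeasure N (ball y r)"
    if "x \<in> S" "y \<in> S" for x y r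
  proof -
    have "emeasure M UNIV * emeasure N (ball y r) = (\<integral>\<^sup>+z. emeasure N (ball y r) \<partial>M)"
      using sets_eq_imp_space_eq[OF sets(1)] by (simp add: mult.commute)
    also have "\<dots> = (\<integral>\<^sup>+z. indicator UNIV z * emeasure N (ball z r) \<partial>M)"
    proof (rule nn_integral_cong_AE)
      show "AE z in M. emeasure N (ball y r) = indicator UNIV z * emeasure N (ball z r)"
        using S(2) by eventually_elim (use balls(2)[OF that(2)] in simp)
    qed
    also have "\<dots> = (\<integral>\<^sup>+z. emeasure M (UNIV \<inter> ball z r) \<partial>N)"
      by (rule double_counting[OF sf sets]) simp
    also have "\<dots> = (\<integral>\<^sup>+z. emeasure M (ball x r) \<partial>N)"
    proof (rule nn_integral_cong_AE)
      show "AE z in N. emeasure M (UNIV \<inter> ball z r) = emeasure M (ball x r)"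
        using S(3) by eventually_elim (use balls(1)[OF that(1)] in simp)
    qed
    also have "\<dots> = emeasure N UNIV * emeasure M (ball x r)"
      using sets_eq_imp_space_eq[OF sets(2)] by (simp add: mult.commute)
    finally show ?thesis ..
  qed
  have ballpos: "emeasure M (ball p r) \<noteq> 0" if r: "r > 0" for r
  proof
    assume 0: "emeasure M (ball p r) = 0"
    obtain K where K: "K \<subseteq> S" "finite K" "S \<subseteq> (\<Union>x\<in>K. ball x r)"
    proof (rule compactE_image[OF S(1), of S "\<lambda>x. ball x r"])
      show "S \<subseteq> (\<Union>x\<in>S. ball x r)"
        using r by (intro subsetI UN_I) auto
    qed auto
    have "emeasure M UNIV = emeasure M (\<Union>x\<in>K. ball x r)"
    proof (rule emeasure_eq_AE)
      show "AE x in M. x \<in> UNIV \<longleftrightarrow> x \<in> (\<Union>x\<in>K. ball x r)"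
        using S(2) by eventually_elim (use K(3) in blast)
    qed (use K(2) in \<open>auto simp: sets intro!: borel_open open_UN\<close>)
    also have "\<dots> \<le> (\<Sum>x\<in>K. emeasure M (ball x r))"
      using K by (intro emeasure_subadditive_finite) (auto simp: sets)
    also have "\<dots> = 0"
    proof (intro sum.neutral ballI)
      show "emeasure M (ball x r) = 0" if "x \<in> K" for x
        using balls(1)[OF p, of x r] 0 K(1) that by auto
    qed
    finally show False using pos by simp
  qed
  let ?M = "scale_measure (emeasure N UNIV) M" and ?N = "scale_measure (emeasure M UNIV) N"
  have fM: "emeasure M X \<noteq> top" "emeasure N X \<noteq> top" for X
    using M.emeasure_finite N.emeasure_finite by auto
  have "?M = ?N"
  proof (rule equal_balls_imp_eq[where X = S and g = "\<lambda>r. emeasure N UNIV * emeasure M (ball p r)"])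
    show "sigma_finite_measure ?M"
      by (rule finite_measure.axioms(1), rule finite_measureI) (use fM in \<open>simp add: ennreal_mult_eq_top_iff\<close>)
    show "sigma_finite_measure ?N"
      by (rule finite_measure.axioms(1), rule finite_measureI) (use fM in \<open>simp add: ennreal_mult_eq_top_iff\<close>)
    show "AE x in ?M. x \<in> S" by (rule AE_I[of _ _ "- S"]) (auto simp: null sets)
    show "AE x in ?N. x \<in> S" by (rule AE_I[of _ _ "- S"]) (auto simp: null sets)
    show "emeasure ?M (ball x r) = emeasure N UNIV * emeasure M (ball p r)" if "x \<in> S" for x r
      using balls(1)[OF p that, of r] by simp
    show "emeasure ?N (ball x r) = emeasure N UNIV * emeasure M (ball p r)" if "x \<in> S" for x r
      using key[OF p that] by simp
    show "0 < emeasure N UNIV * emeasure M (ball p r)" if "r > 0" for r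
      using ballpos[OF that] pos by (simp add: zero_less_iff_neq_zero)
    show "emeasure N UNIV * emeasure M (ball p r) < \<infinity>" for r
      using fM by (simp add: ennreal_mult_eq_top_iff less_top[symmetric])
    show "emeasure ?M (ball 0 r) \<noteq> \<infinity>" for r using fM by (auto simp: ennreal_mult_eq_top_iff)
  qed (auto simp: sets)
  from arg_cong[OF this, of "\<lambda>m. emeasure m A"] show ?thesis by simp
qed

section \<open>Surface measure and the measure of cones\<close>

lemma unit_ball_vol_nonzero [simp]: "unit_ball_vol (real k) \<noteq> 0"
  by (rule less_imp_neq[symmetric], rule unit_ball_vol_pos) simp

text \<open>
  The push-forward of Lebesgue measure on the unit ball under \<open>y \<mapsto> y / |y|\<close>, a
  multiple of the surface measure.
\<close>

definition cone_measure :: "'a::euclidean_space measure" where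
  "cone_measure = distr (restrict_space lborel (ball 0 1)) borel sgn"

lemma sets_cone_measure [simp, measurable_cong]: "sets cone_measure = sets borel"
  and space_cone_measure [simp]: "space cone_measure = UNIV"
  by (simp_all add: cone_measure_def)

lemma measurable_sgn_ball [measurable]:
  "(sgn :: 'a::euclidean_space \<Rightarrow> 'a) \<in> restrict_space lborel (ball 0 1) \<rightarrow>\<^sub>M borel"
  by (rule measurable_restrict_space1) simp

lemma emeasure_cone_measure:
  fixes A :: "'a::euclidean_space set"
  assumes [measurable]: "A \<in> sets borel"
  shows "emeasure cone_measure A = emeasure lborel (sgn -` A \<inter> ball 0 1)"
  unfolding cone_measure_def
  by (subst emeasure_distr)
     (auto simp: emeasure_restrict_space space_restrict_space intro!: arg_cong[where f="emeasure lborel"])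

lemma emeasure_cone_measure_UNIV:
  "emeasure (cone_measure :: 'a::euclidean_space measure) UNIV = ennreal (unit_ball_vol (DIM('a)))"
  using emeasure_ball[of 1 "0::'a"] by (simp add: emeasure_cone_measure)

lemma finite_measure_cone_measure: "finite_measure (cone_measure :: 'a::euclidean_space measure)"
  by (rule finite_measureI) (simp add: emeasure_cone_measure_UNIV)

lemma sgn_pos_scaleR: "c > 0 \<Longrightarrow> sgn (c *\<^sub>R y) = sgn y" for y :: "'a::real_normed_vector"
  by (simp add: sgn_scaleR)

lemma AE_cone_measure_sphere: "AE x in cone_measure. x \<in> sphere (0::'a::euclidean_space) 1"
proof -
  have "emeasure cone_measure (- sphere (0::'a) 1) = emeasure lborel (sgn -` (- sphere (0::'a) 1) \<inter> ball 0 1)"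
    by (rule emeasure_cone_measure) auto
  also have "sgn -` (- sphere (0::'a) 1) \<inter> ball 0 1 = {0}"
    by (auto simp: norm_sgn split: if_splits)
  finally show ?thesis by (intro AE_I[of _ _ "- sphere 0 1"]) auto
qed

lemma cone_measure_ball_invariant:
  fixes x y :: "real ^ 'n"
  assumes "x \<in> sphere 0 1" "y \<in> sphere 0 1"
  shows "emeasure cone_measure (ball x r) = emeasure cone_measure (ball y r)"
proof -
  obtain T where T: "orthogonal_transformation T" and Tx: "T x = y"
    using orthogonal_transformation_exists_1[of x y] assms by auto
  have lin: "linear T" using T by (rule orthogonal_transformation_linear)
  then have T_meas: "T \<in> borel_measurable borel"
    by (intro borel_measurable_continuous_onI linear_continuous_on linear_conv_bounded_linear[THEN iffD1])
  have nT: "norm (T z) = norm z" for z using T by (rule orthogonal_transformation_norm)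
  have sT: "sgn (T z) = T (sgn z)" for z
    by (simp add: sgn_div_norm nT linear_scale[OF lin])
  have dT: "dist y (T z) = dist x z" for z
    by (simp add: dist_norm Tx[symmetric] linear_diff[OF lin, symmetric] nT)
  have m: "sgn -` ball y r \<inter> ball 0 1 \<in> sets borel"
    using measurable_sets[OF borel_measurable_sgn_vector, of "ball y r"] by auto
  have "emeasure cone_measure (ball y r) = emeasure (distr lborel borel T) (sgn -` ball y r \<inter> ball 0 1)"
    by (simp add: emeasure_cone_measure lborel_distr_orthogonal[OF T])
  also have "\<dots> = emeasure lborel (T -` (sgn -` ball y r \<inter> ball 0 1) \<inter> space lborel)"
    using T_meas m by (intro emeasure_distr) auto
  also have "T -` (sgn -` ball y r \<inter> ball 0 1) \<inter> space lborel = sgn -` ball x r \<inter> ball 0 1"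
    by (auto simp: sT dT nT)
  finally show ?thesis by (simp add: emeasure_cone_measure)
qed

text \<open>
  The cone over a cap of radius \<open>r\<close>, restricted to \<open>1 - r \<le> |y| < 1\<close>, lies in a ball of radius \<open>2r\<close>
  and carries at least the fraction \<open>r\<close> of the volume of the cone in the unit ball.
\<close>

lemma emeasure_cone_measure_cball_le:
  fixes p :: "'a::euclidean_space"
  assumes p: "norm p = 1" and r: "0 < r" "r \<le> 1"
  shows "emeasure cone_measure (cball p r) \<le> ennreal (unit_ball_vol (DIM('a)) * 2 ^ DIM('a) * r ^ (DIM('a) - 1))"
proof -
  let ?n = "DIM('a)"
  define C where "C = sgn -` cball p r - {0::'a}"
  have C[measurable]: "C \<in> sets borel"
    using measurable_sets[OF borel_measurable_sgn_vector, of "cball p r"] by (auto simp: C_def)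
  have cone: "c *\<^sub>R y \<in> C \<longleftrightarrow> y \<in> C" if "c > 0" for c y
    using that by (auto simp: C_def sgn_pos_scaleR)
  have eq: "emeasure cone_measure (cball p r) = emeasure lborel (C \<inter> ball 0 1)"
  proof -
    have "emeasure cone_measure (cball p r) = emeasure lborel (sgn -` cball p r \<inter> ball 0 1)"
      by (rule emeasure_cone_measure) auto
    also have "\<dots> = emeasure lborel (C \<inter> ball 0 1)"
    proof (rule emeasure_eq_AE)
      show "AE x in lborel. x \<in> sgn -` cball p r \<inter> ball 0 1 \<longleftrightarrow> x \<in> C \<inter> ball 0 1"
        using AE_lborel_singleton[of "0::'a"] by eventually_elim (auto simp: C_def)
      show "sgn -` cball p r \<inter> ball 0 1 \<in> sets lborel"
        using measurable_sets[OF borel_measurable_sgn_vector, of "cball p r"] by auto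
    qed auto
    finally show ?thesis .
  qed
  have "C \<inter> (ball 0 1 - ball 0 (1 - r)) \<subseteq> cball p (2 * r)"
  proof
    fix y assume y: "y \<in> C \<inter> (ball 0 1 - ball 0 (1 - r))"
    then have y': "y \<noteq> 0" "dist p (sgn y) \<le> r" "norm y < 1" "1 - r \<le> norm y"
      by (auto simp: C_def)
    have "sgn y - y = (1 - norm y) *\<^sub>R sgn y"
      using y' by (simp add: sgn_div_norm algebra_simps)
    then have "dist (sgn y) y = \<bar>1 - norm y\<bar>"
      using y' by (simp add: dist_norm norm_sgn)
    then show "y \<in> cball p (2 * r)"
      using y' dist_triangle[of p y "sgn y"] by simp
  qed
  then have "emeasure lborel (C \<inter> (ball 0 1 - ball 0 (1 - r))) \<le> emeasure lborel (cball p (2 * r))"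
    by (intro emeasure_mono) auto
  also have "\<dots> = ennreal (unit_ball_vol ?n * (2 * r) ^ ?n)"
    using r by (intro emeasure_cball) simp
  finally have "ennreal (1 - (1 - r) ^ ?n) * emeasure cone_measure (cball p r)
      \<le> ennreal (unit_ball_vol ?n * (2 * r) ^ ?n)"
    using emeasure_cone_annulus[OF C cone, of "1 - r" 1] r by (simp add: eq)
  moreover have "r \<le> 1 - (1 - r) ^ ?n"
    using power_decreasing[of 1 ?n "1 - r"] r by (simp add: Suc_leI)
  ultimately have "ennreal r * emeasure cone_measure (cball p r) \<le> ennreal (unit_ball_vol ?n * (2 * r) ^ ?n)"
    by (meson ennreal_leI mult_right_mono order_trans zero_le)
  also have "\<dots> = ennreal r * ennreal (unit_ball_vol ?n * 2 ^ ?n * r ^ (?n - 1))"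
    using r power_minus_mult[of ?n r] by (simp add: ennreal_mult[symmetric] power_mult_distrib mult_ac)
  finally show ?thesis
    using r by (subst (asm) ennreal_mult_le_mult_iff) auto
qed

text \<open>
  Up to a constant, the cone measure of a set is at most its Hausdorff weight: the set lies in a
  ball around a point of its closure whose radius exceeds its diameter by as little as desired.
  Closures are taken to stay within Borel sets.  The limit in the radius also covers
  sets of diameter 0, where the ball would degenerate to a point.
\<close>

lemma cone_measure_le_hausdorff_weight:
  fixes E :: "'a::euclidean_space set"
  defines "n \<equiv> DIM('a)"
  assumes bd: "bounded E" and d: "diameter E \<le> 1/2"
  shows "emeasure cone_measure (closure E)
    \<le> ennreal (unit_ball_vol n * 4 ^ n / unit_ball_vol (real (n - 1))) * hausdorff_weight (n - 1) E"
proof -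
  interpret finite_measure "cone_measure :: 'a measure" by (rule finite_measure_cone_measure)
  let ?K = "unit_ball_vol n * 2 ^ n"
  have pos: "unit_ball_vol (real (n-1)) > 0" "unit_ball_vol (real n) > 0" by (simp_all add: unit_ball_vol_pos)
  show ?thesis
  proof (cases "closure E \<inter> sphere 0 1 = {}")
    case True
    have "AE x in cone_measure. x \<notin> closure E"
      by (rule eventually_mono[OF AE_cone_measure_sphere]) (use True in blast)
    then have "emeasure cone_measure (closure E) = 0"
      by (subst (asm) AE_iff_measurable[OF _ refl]) auto
    then show ?thesis by simp
  next
    case False
    then obtain p where p: "p \<in> closure E" "norm p = 1" by auto
    then have ne: "E \<noteq> {}" by auto
    let ?d = "diameter E"
    have d0: "?d \<ge> 0" using bd by (rule diameter_ge_0)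
    have step: "measure cone_measure (closure E) \<le> ?K * r ^ (n - 1)" if r: "?d < r" "r \<le> 1" for r
    proof -
      have "closure E \<subseteq> cball p r"
        using p diameter_bounded_bound[of "closure E"] bd r by (fastforce simp: diameter_closure)
      then have "emeasure cone_measure (closure E) \<le> emeasure cone_measure (cball p r)"
        by (intro emeasure_mono) auto
      also have "\<dots> \<le> ennreal (?K * r ^ (n - 1))"
        using emeasure_cone_measure_cball_le[of p r] p r d0 by (simp add: n_def)
      finally show ?thesis using r d0 pos by (subst (asm) emeasure_eq_measure) (simp add: ennreal_le_iff)
    qed
    have "measure cone_measure (closure E) \<le> ?K * ?d ^ (n - 1)"
    proof (rule tendsto_lowerbound)
      show "((\<lambda>r. ?K * r ^ (n - 1)) \<longlongrightarrow> ?K * ?d ^ (n - 1)) (at_right ?d)"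
        by (intro tendsto_intros)
      show "\<forall>\<^sub>F r in at_right ?d. measure cone_measure (closure E) \<le> ?K * r ^ (n - 1)"
        using d by (intro eventually_at_rightI[of ?d 1] step) auto
    qed simp
    also have "\<dots> = ?K * 2 ^ (n - 1) / unit_ball_vol (real (n-1)) * (unit_ball_vol (real (n-1)) * (?d / 2) ^ (n - 1))"
      using pos by (simp add: power_divide)
    also have "\<dots> \<le> (unit_ball_vol n * 4 ^ n / unit_ball_vol (real (n - 1))) * (unit_ball_vol (real (n-1)) * (?d / 2) ^ (n - 1))"
    proof (intro mult_right_mono divide_right_mono)
      have "(2::real) ^ (n - 1) \<le> 2 ^ n" by (rule power_increasing) auto
      then have "?K * 2 ^ (n - 1) \<le> ?K * 2 ^ n" using pos by (intro mult_left_mono) auto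
      also have "\<dots> = unit_ball_vol n * 4 ^ n" by (simp add: power_mult_distrib[symmetric])
      finally show "?K * 2 ^ (n - 1) \<le> unit_ball_vol n * 4 ^ n" .
    qed (use pos d0 in auto)
    finally show ?thesis
      using pos d0 ne unfolding hausdorff_weight_def
      by (subst emeasure_eq_measure) (simp add: ennreal_mult[symmetric] ennreal_leI)
  qed
qed

lemma hausdorff_outer_sphere_pos: "hausdorff_outer (DIM('a) - 1) (sphere (0::'a::euclidean_space) 1) > 0"
proof -
  let ?n = "DIM('a)" and ?N = "cone_measure :: 'a measure"
  define c where "c = unit_ball_vol ?n * 4 ^ ?n / unit_ball_vol (real (?n - 1))"
  have c: "c > 0" by (simp add: c_def unit_ball_vol_pos)
  have "ennreal (1 / c) * emeasure ?N UNIV \<le> hausdorff_pre (?n - 1) (1/2) (sphere (0::'a) 1)"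
    unfolding hausdorff_pre_def
  proof (rule INF_greatest)
    fix E :: "nat \<Rightarrow> 'a set"
    assume "E \<in> {E. sphere 0 1 \<subseteq> (\<Union>i. E i) \<and> (\<forall>i. bounded (E i) \<and> diameter (E i) \<le> 1/2)}"
    then have E: "sphere 0 1 \<subseteq> (\<Union>i. E i)" "\<And>i. bounded (E i)" "\<And>i. diameter (E i) \<le> 1/2" by auto
    have "emeasure ?N UNIV \<le> emeasure ?N (\<Union>i. closure (E i))"
    proof (rule emeasure_mono_AE)
      show "AE x in ?N. x \<in> UNIV \<longrightarrow> x \<in> (\<Union>i. closure (E i))"
        using AE_cone_measure_sphere by eventually_elim (use E(1) closure_subset in blast)
    qed auto
    also have "\<dots> \<le> (\<Sum>i. emeasure ?N (closure (E i)))"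
      by (rule emeasure_subadditive_countably) auto
    also have "\<dots> \<le> (\<Sum>i. ennreal c * hausdorff_weight (?n - 1) (E i))"
      unfolding c_def by (intro suminf_le cone_measure_le_hausdorff_weight E) auto
    also have "\<dots> = ennreal c * (\<Sum>i. hausdorff_weight (?n - 1) (E i))" by simp
    finally have "ennreal (1 / c) * emeasure ?N UNIV
      \<le> ennreal (1 / c) * (ennreal c * (\<Sum>i. hausdorff_weight (?n - 1) (E i)))"
      by (rule mult_left_mono) simp
    also have "\<dots> = (\<Sum>i. hausdorff_weight (?n - 1) (E i))"
      using c by (simp add: mult.assoc[symmetric] ennreal_mult[symmetric])
    finally show "ennreal (1 / c) * emeasure ?N UNIV \<le> (\<Sum>i. hausdorff_weight (?n - 1) (E i))" .
  qed
  also have "\<dots> \<le> hausdorff_outer (?n - 1) (sphere (0::'a) 1)"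
    by (rule hausdorff_pre_le_outer) simp
  finally have "ennreal (1 / c) * emeasure ?N UNIV \<le> hausdorff_outer (?n - 1) (sphere (0::'a) 1)" .
  moreover have "ennreal (1 / c) * emeasure ?N UNIV > 0"
    using c by (simp add: emeasure_cone_measure_UNIV ennreal_mult[symmetric] unit_ball_vol_pos)
  ultimately show ?thesis by (rule order.strict_trans2[rotated])
qed

text \<open>
  The balls of radius \<open>r/2\<close> about the points are disjoint and lie in a shell of thickness \<open>r\<close> around the
  sphere, so their number is at most of the order \<open>r / r\<^sup>n\<close>.
\<close>

lemma separated_sphere_card:
  fixes P :: "'a::euclidean_space set"
  assumes P: "finite P" "P \<subseteq> sphere 0 1" and sep: "\<And>x y. x \<in> P \<Longrightarrow> y \<in> P \<Longrightarrow> x \<noteq> y \<Longrightarrow> r \<le> dist x y"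
    and r: "0 < r" "r \<le> 1"
  shows "real (card P) * r ^ (DIM('a) - 1) \<le> DIM('a) * 4 ^ DIM('a)"
proof -
  let ?n = "DIM('a)" and ?\<omega> = "unit_ball_vol (DIM('a))"
  have "disjoint_family_on (\<lambda>p. ball p (r/2)) P"
    unfolding disjoint_family_on_def
  proof (intro ballI impI)
    fix x y assume xy: "x \<in> P" "y \<in> P" "x \<noteq> y"
    show "ball x (r/2) \<inter> ball y (r/2) = {}"
    proof (rule ccontr)
      assume "ball x (r/2) \<inter> ball y (r/2) \<noteq> {}"
      then obtain z where "dist x z < r/2" "dist y z < r/2" by auto
      then have "dist x y < r" using dist_triangle2[of x y z] by linarith
      then show False using sep[OF xy] by simp
    qed
  qed
  then have "(\<Sum>p\<in>P. emeasure lborel (ball p (r/2))) = emeasure lborel (\<Union>p\<in>P. ball p (r/2))"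
    using P by (intro sum_emeasure) auto
  also have "\<dots> \<le> emeasure lborel (UNIV \<inter> (ball (0::'a) (1 + r/2) - ball 0 (1 - r/2)))"
  proof (rule emeasure_mono)
    show "(\<Union>p\<in>P. ball p (r/2)) \<subseteq> UNIV \<inter> (ball 0 (1 + r/2) - ball 0 (1 - r/2))"
    proof
      fix z assume "z \<in> (\<Union>p\<in>P. ball p (r/2))"
      then obtain p where "p \<in> P" and z: "z \<in> ball p (r/2)" by blast
      then have "norm p = 1" using P by auto
      moreover have "dist p z < r/2" using z by simp
      moreover have "norm z \<le> norm p + dist p z" "norm p \<le> norm z + dist p z"
        using norm_triangle_ineq[of p "z - p"] norm_triangle_ineq[of z "p - z"] by (auto simp: dist_norm norm_minus_commute)
      ultimately show "z \<in> UNIV \<inter> (ball 0 (1 + r/2) - ball 0 (1 - r/2))" by auto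
    qed
  qed auto
  also have "\<dots> = ennreal ((1 + r/2) ^ ?n - (1 - r/2) ^ ?n) * emeasure lborel (UNIV \<inter> ball (0::'a) 1)"
    using r by (intro emeasure_cone_annulus) auto
  also have "\<dots> = ennreal (((1 + r/2) ^ ?n - (1 - r/2) ^ ?n) * ?\<omega>)"
    using emeasure_ball[of 1 "0::'a"] r by (simp add: ennreal_mult[symmetric] power_mono)
  finally have "(\<Sum>p\<in>P. ennreal (?\<omega> * (r/2) ^ ?n)) \<le> ennreal (((1 + r/2) ^ ?n - (1 - r/2) ^ ?n) * ?\<omega>)"
    using r by (simp add: emeasure_ball)
  then have "real (card P) * (?\<omega> * (r/2) ^ ?n) \<le> ((1 + r/2) ^ ?n - (1 - r/2) ^ ?n) * ?\<omega>"
    using r by (simp add: sum_ennreal ennreal_of_nat_eq_real_of_nat ennreal_mult[symmetric] ennreal_le_iff power_mono)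
  then have 1: "real (card P) * (r/2) ^ ?n \<le> (1 + r/2) ^ ?n - (1 - r/2) ^ ?n"
    using unit_ball_vol_pos[of "real ?n"] by (simp add: mult_ac)
  have "((1 + r/2)/2) ^ ?n - ((1 - r/2)/2) ^ ?n \<le> norm (((1 + r/2)/2) ^ ?n - ((1 - r/2)/2) ^ ?n)" by simp
  also have "\<dots> \<le> ?n * norm ((1 + r/2)/2 - (1 - r/2)/2)"
    using r by (intro norm_power_diff) auto
  also have "\<dots> = ?n * (r / 2)" using r by (simp add: field_simps)
  finally have "((1 + r/2)/2) ^ ?n - ((1 - r/2)/2) ^ ?n \<le> ?n * (r / 2)" .
  then have "2 ^ ?n * (((1 + r/2)/2) ^ ?n - ((1 - r/2)/2) ^ ?n) \<le> 2 ^ ?n * (?n * (r / 2))"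
    by (rule mult_left_mono) simp
  then have 2: "(1 + r/2) ^ ?n - (1 - r/2) ^ ?n \<le> 2 ^ ?n * ?n * (r / 2)"
    by (simp add: power_divide right_diff_distrib)
  have four: "(2::real) ^ ?n * 2 ^ ?n = 4 ^ ?n" by (simp add: power_mult_distrib[symmetric])
  have "real (card P) * r ^ (?n - 1) * r = real (card P) * (r/2) ^ ?n * 2 ^ ?n"
    using power_minus_mult[of ?n r] by (simp add: power_divide)
  also have "\<dots> \<le> 2 ^ ?n * ?n * (r / 2) * 2 ^ ?n" using 1 2 by (intro mult_right_mono) auto
  also have "\<dots> \<le> (?n * 4 ^ ?n) * r"
    using r by (simp add: four[symmetric] mult_ac)
  finally show ?thesis using r by simp
qed

text \<open>
  An \<open>r\<close>-separated subset of maximal cardinality is an \<open>r\<close>-net.  The balls around its points cover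
  the sphere, and by \<open>separated_sphere_card\<close> their total weight stays bounded as \<open>r \<rightarrow> 0\<close>.
\<close>

lemma hausdorff_outer_sphere_finite: "hausdorff_outer (DIM('a) - 1) (sphere (0::'a::euclidean_space) 1) < \<infinity>"
proof -
  let ?n = "DIM('a)"
  define K where "K = ?n * 4 ^ ?n * unit_ball_vol (real (?n - 1))"
  have "hausdorff_outer (?n - 1) (sphere (0::'a) 1) \<le> ennreal K"
    unfolding hausdorff_outer_def
  proof (rule SUP_least)
    fix \<delta> :: real assume "\<delta> \<in> {0<..}"
    define r where "r = min (\<delta>/2) 1"
    have r: "0 < r" "r \<le> 1" "2 * r \<le> \<delta>" using \<open>\<delta> \<in> {0<..}\<close> by (auto simp: r_def)
    define Q where "Q P \<longleftrightarrow> finite P \<and> P \<subseteq> sphere (0::'a) 1 \<and> (\<forall>x\<in>P. \<forall>y\<in>P. x \<noteq> y \<longrightarrow> r \<le> dist x y)" for P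
    have card: "real (card P) * r ^ (?n - 1) \<le> ?n * 4 ^ ?n" if "Q P" for P
      using that r by (intro separated_sphere_card) (auto simp: Q_def)
    obtain b :: nat where b: "real ?n * 4 ^ ?n / r ^ (?n - 1) < real b" using reals_Archimedean2 by blast
    have "card P < b" if "Q P" for P
    proof -
      have "real (card P) \<le> real ?n * 4 ^ ?n / r ^ (?n - 1)" using card[OF that] r by (simp add: field_simps)
      then show ?thesis using b by linarith
    qed
    moreover have "Q {}" by (simp add: Q_def)
    ultimately obtain P where P: "Q P" "\<And>P'. Q P' \<Longrightarrow> card P' \<le> card P"
      using ex_has_greatest_nat[of Q "{}" card b] by (metis less_imp_le)
    have cov: "sphere 0 1 \<subseteq> (\<Union>p\<in>P. ball p r)"
    proof (rule ccontr)
      assume "\<not> ?thesis"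
      then obtain x where x: "x \<in> sphere 0 1" "x \<notin> (\<Union>p\<in>P. ball p r)" by blast
      have "Q (insert x P)" using P(1) x by (auto simp: Q_def not_less dist_commute)
      moreover have "x \<notin> P" using x r by auto
      moreover have "finite P" using P(1) by (simp add: Q_def)
      ultimately show False using P(2)[of "insert x P"] by simp
    qed
    have fin: "finite P" using P(1) by (simp add: Q_def)
    then obtain e where e: "bij_betw e {0..<card P} P" using ex_bij_betw_nat_finite by blast
    define E where "E i = (if i < card P then ball (e i) r else {})" for i
    have "hausdorff_pre (?n - 1) \<delta> (sphere (0::'a) 1) \<le> (\<Sum>i. hausdorff_weight (?n - 1) (E i))"
    proof (rule hausdorff_pre_le)
      show "sphere 0 1 \<subseteq> (\<Union>i. E i)"
      proof
        fix x :: 'a assume "x \<in> sphere 0 1"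
        then obtain p where "p \<in> P" "x \<in> ball p r" using cov by blast
        moreover from \<open>p \<in> P\<close> have "p \<in> e ` {0..<card P}"
          using e by (simp add: bij_betw_imp_surj_on)
        then obtain i where "i < card P" "e i = p" by auto
        ultimately have "x \<in> E i" by (simp add: E_def)
        then show "x \<in> (\<Union>i. E i)" by blast
      qed
      show "bounded (E i)" "diameter (E i) \<le> \<delta>" for i using r by (auto simp: E_def diameter_ball)
    qed
    also have "\<dots> = (\<Sum>i<card P. hausdorff_weight (?n - 1) (E i))"
      by (rule suminf_finite) (auto simp: E_def hausdorff_weight_def)
    also have "\<dots> = (\<Sum>i<card P. ennreal (unit_ball_vol (real (?n - 1)) * r ^ (?n - 1)))"
      using r by (intro sum.cong) (auto simp: E_def hausdorff_weight_def diameter_ball)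
    also have "\<dots> = ennreal (real (card P) * (unit_ball_vol (real (?n - 1)) * r ^ (?n - 1)))"
      using r by (simp add: ennreal_of_nat_eq_real_of_nat ennreal_mult[symmetric])
    also have "\<dots> \<le> ennreal K"
      using mult_right_mono[OF card[OF P(1)], of "unit_ball_vol (real (?n - 1))"]
      by (intro ennreal_leI) (simp add: K_def mult_ac)
    finally show "hausdorff_pre (?n - 1) \<delta> (sphere (0::'a) 1) \<le> ennreal K" .
  qed
  then show ?thesis by (simp add: le_less_trans)
qed

lemma diameter_isometry:
  assumes "\<And>x y. dist (T x) (T y) = dist x y"
  shows "diameter (T ` E) = diameter E"
proof -
  have "(\<lambda>(x, y). dist x y) ` (T ` E \<times> T ` E) = (\<lambda>(x, y). dist x y) ` (E \<times> E)"
    using assms by (force simp: image_iff)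
  then show ?thesis by (simp add: diameter_def)
qed

lemma hausdorff_outer_isometry_le:
  assumes T: "\<And>x y. dist (T x) (T y) = dist x y"
  shows "hausdorff_outer m (T ` A) \<le> hausdorff_outer m A"
  unfolding hausdorff_outer_def
proof (rule SUP_mono')
  fix \<delta>
  show "hausdorff_pre m \<delta> (T ` A) \<le> hausdorff_pre m \<delta> A"
    unfolding hausdorff_pre_def[of m \<delta> A]
  proof (rule INF_greatest)
    fix E :: "nat \<Rightarrow> 'a set" assume "E \<in> {E. A \<subseteq> (\<Union>i. E i) \<and> (\<forall>i. bounded (E i) \<and> diameter (E i) \<le> \<delta>)}"
    then have E: "A \<subseteq> (\<Union>i. E i)" "\<And>i. bounded (E i)" "\<And>i. diameter (E i) \<le> \<delta>" by auto
    have "hausdorff_pre m \<delta> (T ` A) \<le> (\<Sum>i. hausdorff_weight m (T ` E i))"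
    proof (rule hausdorff_pre_le)
      show "T ` A \<subseteq> (\<Union>i. T ` E i)" using E(1) by blast
      show "bounded (T ` E i)" for i
        using E(2)[of i] unfolding bounded_any_center[where a = "T undefined"] bounded_any_center[where a = undefined]
        by (auto simp: T)
    qed (simp add: diameter_isometry[of T, OF T] E)
    also have "\<dots> = (\<Sum>i. hausdorff_weight m (E i))"
      by (intro arg_cong[where f = suminf] ext) (simp add: hausdorff_weight_def diameter_isometry[of T, OF T] split: if_split)
    finally show "hausdorff_pre m \<delta> (T ` A) \<le> (\<Sum>i. hausdorff_weight m (E i))" .
  qed
qed

text \<open>
  Some orthogonal map takes \<open>x\<close> to \<open>y\<close>, and it preserves both the sphere and the outer measure.
\<close>

lemma hausdorff_sphere_ball_invariant:
  fixes x y :: "real ^ 'n"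
  assumes "x \<in> sphere 0 1" "y \<in> sphere 0 1"
  shows "hausdorff_outer m (sphere 0 1 \<inter> ball x r) = hausdorff_outer m (sphere 0 1 \<inter> ball y r)"
proof -
  have le: "hausdorff_outer m (sphere 0 1 \<inter> ball y r) \<le> hausdorff_outer m (sphere 0 1 \<inter> ball x r)"
    if xy: "x \<in> sphere 0 1" "y \<in> sphere 0 1" for x y :: "real ^ 'n"
  proof -
    obtain T where T: "orthogonal_transformation T" and Tx: "T x = y"
      using orthogonal_transformation_exists_1[of x y] xy by auto
    have iso: "dist (T a) (T b) = dist a b" for a b
      using T by (simp add: dist_norm orthogonal_transformation_norm orthogonal_transformation_linear linear_diff[symmetric])
    have nT: "norm (T z) = norm z" for z using T by (rule orthogonal_transformation_norm)
    have "sphere 0 1 \<inter> ball y r \<subseteq> T ` (sphere 0 1 \<inter> ball x r)"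
    proof
      fix z assume z: "z \<in> sphere 0 1 \<inter> ball y r"
      obtain w where w: "z = T w" using orthogonal_transformation_surj[OF T] by (metis surjD)
      have "w \<in> sphere 0 1 \<inter> ball x r"
        using z iso[of x w] nT[of w] by (simp add: w Tx)
      then show "z \<in> T ` (sphere 0 1 \<inter> ball x r)" using w by blast
    qed
    then have "hausdorff_outer m (sphere 0 1 \<inter> ball y r) \<le> hausdorff_outer m (T ` (sphere 0 1 \<inter> ball x r))"
      by (rule hausdorff_outer_mono)
    also have "\<dots> \<le> hausdorff_outer m (sphere 0 1 \<inter> ball x r)" by (rule hausdorff_outer_isometry_le[OF iso])
    finally show ?thesis .
  qed
  show ?thesis using assms by (intro antisym le)
qed

lemma hausdorff_measure_sphere_eq_cone_measure:
  "\<exists>k>0. \<forall>A\<in>sets borel. emeasure (hausdorff_measure (CARD('n) - 1)) (sphere (0::real^'n) 1 \<inter> A) = ennreal k * emeasure cone_measure A"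
proof -
  let ?S = "sphere (0::real^'n) 1" and ?N = "cone_measure :: (real^'n) measure"
  let ?H = "hausdorff_measure (CARD('n) - 1) :: (real^'n) measure"
  define M where "M = density ?H (indicator ?S)"
  have MA: "emeasure M A = hausdorff_outer (CARD('n) - 1) (?S \<inter> A)" if "A \<in> sets borel" for A
    using that by (simp add: M_def emeasure_restricted emeasure_hausdorff_measure)
  have MU: "emeasure M UNIV = hausdorff_outer (CARD('n) - 1) ?S" by (simp add: MA)
  have MUpos: "emeasure M UNIV > 0" and MUfin: "emeasure M UNIV < \<infinity>"
    using hausdorff_outer_sphere_pos[where ?'a = "real^'n"] hausdorff_outer_sphere_finite[where ?'a = "real^'n"]
    by (simp_all add: MU)
  have spM: "space M = UNIV" by (simp add: M_def)
  have proportional: "emeasure ?N UNIV * emeasure M A = emeasure M UNIV * emeasure ?N A" if A: "A \<in> sets borel" for A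
  proof (rule uniform_measures_proportional[where S = ?S])
    show "finite_measure M" using MUfin by (intro finite_measureI) (simp add: spM less_top)
    show "finite_measure ?N" by (rule finite_measure_cone_measure)
    have ind: "(indicator ?S :: _ \<Rightarrow> ennreal) \<in> borel_measurable ?H" by (rule borel_measurable_indicator) simp
    show "AE x in M. x \<in> ?S"
      unfolding M_def AE_density[OF ind] by (auto simp: indicator_def split: if_splits)
    show "AE x in ?N. x \<in> ?S" by (rule AE_cone_measure_sphere)
    show "emeasure M (ball x r) = emeasure M (ball y r)" if "x \<in> ?S" "y \<in> ?S" for x y r
      using hausdorff_sphere_ball_invariant[OF that] by (simp add: MA)
    show "emeasure ?N (ball x r) = emeasure ?N (ball y r)" if "x \<in> ?S" "y \<in> ?S" for x y r
      using cone_measure_ball_invariant[OF that] .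
    show "emeasure M UNIV \<noteq> 0" using MUpos by simp
    show "emeasure ?N UNIV \<noteq> 0" by (simp add: emeasure_cone_measure_UNIV unit_ball_vol_pos not_le)
  qed (use A in \<open>auto simp: M_def\<close>)
  define a where "a = unit_ball_vol (real CARD('n))"
  define b where "b = enn2real (emeasure M UNIV)"
  have ab: "a > 0" "b > 0" "emeasure M UNIV = ennreal b" "emeasure ?N UNIV = ennreal a"
    using MUpos MUfin by (auto simp: a_def b_def unit_ball_vol_pos enn2real_positive_iff emeasure_cone_measure_UNIV)
  show ?thesis
  proof (intro exI[of _ "b / a"] conjI ballI)
    fix A :: "(real^'n) set" assume A: "A \<in> sets borel"
    have "ennreal a * emeasure M A = ennreal a * (ennreal (b / a) * emeasure ?N A)"
      using proportional[OF A] ab by (simp add: mult.assoc[symmetric] ennreal_mult[symmetric])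
    then have "emeasure M A = ennreal (b / a) * emeasure ?N A"
      using ab by (subst (asm) ennreal_mult_cancel_left) auto
    then show "emeasure ?H (?S \<inter> A) = ennreal (b / a) * emeasure ?N A"
      using A by (simp add: MA emeasure_hausdorff_measure)
  qed (use ab in auto)
qed

section \<open>A Morrey bound for homogeneous functions of weak type\<close>

definition morrey_const :: "nat \<Rightarrow> real" where
  "morrey_const n = unit_ball_vol (real n) + 4 * real n"

definition morrey_exponent :: "nat \<Rightarrow> real" where
  "morrey_exponent n = real n - 1 + 1 / real n"

text \<open>
  Truncation at height \<open>\<tau>\<close> plus a dyadic decomposition of the part above it; the heights
  \<open>2\<^sup>j\<tau>\<close> below \<open>a\<close>, together with \<open>\<tau>\<close>, add up to the first such height that is at least \<open>a\<close>.
\<close>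

lemma dyadic_layers:
  assumes "\<tau> > 0" "a \<ge> 0"
  shows "ennreal a \<le> ennreal \<tau> + (\<Sum>j. ennreal (2 ^ j * \<tau>) * indicator {t. t < a} (2 ^ j * \<tau>))"
proof (cases "a \<le> \<tau>")
  case True
  then show ?thesis by (intro order_trans[OF ennreal_leI[OF True]]) simp
next
  case False
  define J where "J = (LEAST j. a \<le> 2 ^ j * \<tau>)"
  obtain j0 where "a / \<tau> < 2 ^ j0" using real_arch_pow[of 2 "a / \<tau>"] by auto
  then have "a \<le> 2 ^ j0 * \<tau>" using assms by (simp add: field_simps)
  then have J: "a \<le> 2 ^ J * \<tau>" unfolding J_def by (rule LeastI)
  have less: "2 ^ j * \<tau> < a" if "j < J" for j
    using not_less_Least[of j "\<lambda>j. a \<le> 2 ^ j * \<tau>"] that by (simp add: J_def)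
  have geom: "2 ^ k * \<tau> = \<tau> + (\<Sum>j<k. 2 ^ j * \<tau>)" for k :: nat
    by (induction k) (auto simp: algebra_simps)
  have "ennreal a \<le> ennreal (\<tau> + (\<Sum>j<J. 2 ^ j * \<tau>))" using J geom[of J] by (intro ennreal_leI) linarith
  also have "\<dots> = ennreal \<tau> + (\<Sum>j<J. ennreal (2 ^ j * \<tau>))"
    using assms by (simp add: sum_nonneg)
  also have "(\<Sum>j<J. ennreal (2 ^ j * \<tau>)) = (\<Sum>j<J. ennreal (2 ^ j * \<tau>) * indicator {t. t < a} (2 ^ j * \<tau>))"
    using less by (intro sum.cong) auto
  also have "ennreal \<tau> + (\<Sum>j<J. ennreal (2 ^ j * \<tau>) * indicator {t. t < a} (2 ^ j * \<tau>))
      \<le> ennreal \<tau> + (\<Sum>j. ennreal (2 ^ j * \<tau>) * indicator {t. t < a} (2 ^ j * \<tau>))"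
    by (intro add_left_mono sum_le_suminf) auto
  finally show ?thesis .
qed

lemma ball_borel [measurable]: "ball (x::'a::metric_space) r \<in> sets borel" by simp

text \<open>
  The volume of a cone in the unit ball is the cone measure of its trace on the sphere, so \<open>weak\<close> says
  that \<open>\<omega>\<close> has norm at most \<open>M\<close> in weak \<open>L\<^sup>n\<close> of the sphere.
\<close>

locale weak_cone_function =
  fixes \<omega> :: "'a::euclidean_space \<Rightarrow> real" and M :: real
  assumes \<omega>_borel [measurable]: "\<omega> \<in> borel_measurable borel"
    and homogeneous: "\<And>c y. c > 0 \<Longrightarrow> \<omega> (c *\<^sub>R y) = \<omega> y"
    and M_pos: "M > 0"
    and weak: "\<And>t. t > 0 \<Longrightarrow> emeasure lborel ({y. \<bar>\<omega> y\<bar> > t} \<inter> ball 0 1) \<le> ennreal ((M / t) ^ DIM('a))"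
begin

text \<open>
  The point where homogeneity improves on the weak-type bound: the level set is a cone, and the small ball lies in
  a shell of thickness \<open>2\<rho>\<close>.
\<close>

lemma level_set_ball:
  fixes \<rho> :: real
  assumes z: "norm z < 1" and \<rho>: "0 < \<rho>" and t: "t > 0"
  shows "emeasure lborel ({y. \<bar>\<omega> y\<bar> > t} \<inter> (ball 0 1 \<inter> ball z \<rho>)) \<le> ennreal (2 * DIM('a) * \<rho> * (M / t) ^ DIM('a))"
proof -
  let ?n = "DIM('a)"
  define a where "a = max 0 (norm z - \<rho>)"
  define b where "b = min 1 (norm z + \<rho>)"
  have ab: "0 \<le> a" "a \<le> b" "b \<le> 1" "a \<le> 1" "b - a \<le> 2 * \<rho>" using z \<rho> by (auto simp: a_def b_def)
  have "{y. \<bar>\<omega> y\<bar> > t} \<inter> (ball 0 1 \<inter> ball z \<rho>) \<subseteq> {y. \<bar>\<omega> y\<bar> > t} \<inter> (ball 0 b - ball 0 a)"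
  proof
    fix y assume y: "y \<in> {y. \<bar>\<omega> y\<bar> > t} \<inter> (ball 0 1 \<inter> ball z \<rho>)"
    have "norm y \<le> norm z + dist z y" "norm z \<le> norm y + dist z y"
      using norm_triangle_ineq[of z "y - z"] norm_triangle_ineq[of y "z - y"] by (auto simp: dist_norm norm_minus_commute)
    then show "y \<in> {y. \<bar>\<omega> y\<bar> > t} \<inter> (ball 0 b - ball 0 a)" using y by (auto simp: a_def b_def max_def split: if_splits)
  qed
  then have "emeasure lborel ({y. \<bar>\<omega> y\<bar> > t} \<inter> (ball 0 1 \<inter> ball z \<rho>))
      \<le> emeasure lborel ({y. \<bar>\<omega> y\<bar> > t} \<inter> (ball 0 b - ball 0 a))"
    by (rule emeasure_mono) measurable
  also have "\<dots> = ennreal (b ^ ?n - a ^ ?n) * emeasure lborel ({y. \<bar>\<omega> y\<bar> > t} \<inter> ball 0 1)"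
    using ab by (intro emeasure_cone_annulus) (auto simp: homogeneous)
  also have "\<dots> \<le> ennreal (2 * ?n * \<rho>) * ennreal ((M / t) ^ ?n)"
  proof (intro mult_mono ennreal_leI weak t)
    have "b ^ ?n - a ^ ?n \<le> norm (b ^ ?n - a ^ ?n)" by simp
    also have "\<dots> \<le> ?n * norm (b - a)" using ab by (intro norm_power_diff) auto
    also have "\<dots> \<le> ?n * (2 * \<rho>)" using ab by (intro mult_left_mono) auto
    finally show "b ^ ?n - a ^ ?n \<le> 2 * ?n * \<rho>" by simp
  qed auto
  also have "\<dots> = ennreal (2 * ?n * \<rho> * (M / t) ^ ?n)"
    using \<rho> t M_pos by (simp add: ennreal_mult)
  finally show ?thesis .
qed

text \<open>
  In dimension one the integrals of weak-type bounds diverge logarithmically, but there the sphere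
  consists of two points: every nonempty level set contains a half-line, which has measure at least 1 in the unit ball.
\<close>

lemma bounded_dim_1:
  assumes "DIM('a) = 1" "y \<noteq> 0"
  shows "\<bar>\<omega> y\<bar> \<le> M"
proof (rule field_le_epsilon, rule ccontr)
  fix e :: real assume e: "e > 0" and "\<not> \<bar>\<omega> y\<bar> \<le> M + e"
  then have y: "\<bar>\<omega> y\<bar> > M + e" by simp
  define t where "t = M + e"
  have t: "t > M" "t > 0" using e M_pos by (auto simp: t_def)
  define C where "C = {y. \<bar>\<omega> y\<bar> > t}"
  have C[measurable]: "C \<in> sets borel" unfolding C_def by measurable
  obtain b :: 'a where b: "Basis = {b}" using assms(1) card_1_singletonE by blast
  have ex: "\<exists>s. x = s *\<^sub>R y" for x
  proof -
    have rep: "x = (x \<bullet> b) *\<^sub>R b" for x using euclidean_representation[of x] by (simp add: b)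
    have "y \<bullet> b \<noteq> 0" using rep[of y] assms(2) by (metis scaleR_zero_left)
    then have "x = ((x \<bullet> b) / (y \<bullet> b)) *\<^sub>R y" by (subst rep[of x], subst rep[of y]) simp
    then show ?thesis by blast
  qed
  have "x \<in> C \<or> - x \<in> C" if "x \<noteq> 0" for x
  proof -
    obtain s where s: "x = s *\<^sub>R y" using ex by blast
    then have "s > 0 \<or> - s > 0" using that by auto
    then show ?thesis
      using homogeneous[of s y] homogeneous[of "- s" y] y by (auto simp: s C_def t_def)
  qed
  then have sub: "ball 0 1 - {0} \<subseteq> (C \<inter> ball 0 1) \<union> (uminus -` C \<inter> ball 0 1)" by auto
  have refl: "emeasure lborel (uminus -` C \<inter> ball 0 1) = emeasure lborel (C \<inter> ball 0 1)"
  proof -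
    have [measurable]: "uminus -` C \<in> sets borel"
      using measurable_sets[of uminus borel borel C] by simp
    have "emeasure lborel (C \<inter> ball 0 1) = (\<integral>\<^sup>+x. indicator (C \<inter> ball 0 1) x \<partial>lborel)" by simp
    also have "\<dots> = ennreal (\<bar>-1\<bar> ^ DIM('a)) * (\<integral>\<^sup>+x. indicator (C \<inter> ball 0 1) (0 + (-1) *\<^sub>R x) \<partial>lborel)"
      using C by (intro nn_integral_lborel_affine borel_measurable_indicator sets.Int) simp_all
    also have "(\<lambda>x. indicator (C \<inter> ball 0 1) (0 + (-1) *\<^sub>R x) :: ennreal) = indicator (uminus -` C \<inter> ball 0 1)"
      by (auto simp: fun_eq_iff indicator_def)
    finally show ?thesis by simp
  qed
  have [measurable]: "uminus -` C \<in> sets borel"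
    using measurable_sets[of uminus borel borel C] by simp
  have "ennreal 2 = emeasure lborel (ball (0::'a) 1)"
    using emeasure_ball[of 1 "0::'a"] assms(1) by (simp add: unit_ball_vol_1)
  also have "\<dots> = emeasure lborel (ball (0::'a) 1 - {0})"
    by (intro emeasure_Diff_null_set[symmetric]) (auto simp: null_sets_def)
  also have "\<dots> \<le> emeasure lborel ((C \<inter> ball 0 1) \<union> (uminus -` C \<inter> ball 0 1))"
    by (rule emeasure_mono[OF sub]) measurable
  also have "\<dots> \<le> emeasure lborel (C \<inter> ball 0 1) + emeasure lborel (uminus -` C \<inter> ball 0 1)"
    by (rule emeasure_subadditive) measurable
  also have "\<dots> \<le> ennreal (M / t) + ennreal (M / t)"
    unfolding refl using weak[OF t(2)] assms(1) by (intro add_mono) (simp_all add: C_def)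
  also have "\<dots> = ennreal (2 * (M / t))" using M_pos t by (simp flip: ennreal_plus)
  finally have "2 \<le> 2 * (M / t)" using M_pos t by (subst (asm) ennreal_le_iff) auto
  then show False using t by (simp add: field_simps)
qed

text \<open>
  In dimension one \<open>\<omega>\<close> is bounded.  Otherwise, the part of \<open>|\<omega>|\<close> below a height \<open>\<tau>\<close> is integrated over the
  whole small ball and the part above it dyadically by means of \<open>level_set_ball\<close>; the
  dyadic series converges because \<open>n \<ge> 2\<close>.
\<close>

lemma morrey:
  fixes \<rho> :: real
  assumes z: "norm z < 1" and \<rho>: "0 < \<rho>"
  shows "(\<integral>\<^sup>+y. ennreal \<bar>\<omega> y\<bar> * indicator (ball 0 1 \<inter> ball z \<rho>) y \<partial>lborel)
    \<le> ennreal (morrey_const DIM('a) * M * \<rho> powr morrey_exponent DIM('a))"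
proof (cases "DIM('a) = 1")
  case True
  have "(\<integral>\<^sup>+y. ennreal \<bar>\<omega> y\<bar> * indicator (ball 0 1 \<inter> ball z \<rho>) y \<partial>lborel)
      \<le> (\<integral>\<^sup>+y. ennreal M * indicator (ball z \<rho>) y \<partial>lborel)"
  proof (rule nn_integral_mono_AE)
    show "AE y in lborel. ennreal \<bar>\<omega> y\<bar> * indicator (ball 0 1 \<inter> ball z \<rho>) y \<le> ennreal M * indicator (ball z \<rho>) y"
      using AE_lborel_singleton[of "0::'a"]
      by eventually_elim (auto simp: indicator_def intro!: ennreal_leI bounded_dim_1[OF True])
  qed
  also have "\<dots> = ennreal (M * (2 * \<rho>))"
    using \<rho> M_pos True by (simp add: nn_integral_cmult_indicator emeasure_ball unit_ball_vol_1 ennreal_mult[symmetric])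
  also have "\<dots> \<le> ennreal (morrey_const DIM('a) * M * \<rho> powr morrey_exponent DIM('a))"
    using \<rho> M_pos True by (intro ennreal_leI) (simp add: morrey_const_def morrey_exponent_def unit_ball_vol_1)
  finally show ?thesis .
next
  case False
  let ?n = "DIM('a)"
  define n where "n = DIM('a)"
  have n: "n \<ge> 2" using False DIM_positive[where 'a = 'a] unfolding n_def by linarith
  let ?A = "ball 0 1 \<inter> ball z \<rho>"
  \<comment> \<open>The choice \<open>\<tau> = M / \<theta>\<close> balances the contributions from below and above the height \<open>\<tau>\<close>.\<close>
  define \<theta> where "\<theta> = \<rho> powr ((real n - 1) / real n)"
  define \<tau> where "\<tau> = M / \<theta>"
  have \<theta>: "\<theta> > 0" using \<rho> by (simp add: \<theta>_def)
  have \<tau>: "\<tau> > 0" using M_pos \<theta> by (simp add: \<tau>_def)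
  let ?I = "\<lambda>j y. indicator ({y. \<bar>\<omega> y\<bar> > 2 ^ j * \<tau>} \<inter> ?A) y :: ennreal"
  have "(\<integral>\<^sup>+y. ennreal \<bar>\<omega> y\<bar> * indicator ?A y \<partial>lborel)
     \<le> (\<integral>\<^sup>+y. ennreal \<tau> * indicator (ball z \<rho>) y + (\<Sum>j. ennreal (2 ^ j * \<tau>) * ?I j y) \<partial>lborel)"
  proof (rule nn_integral_mono)
    fix y
    show "ennreal \<bar>\<omega> y\<bar> * indicator ?A y \<le> ennreal \<tau> * indicator (ball z \<rho>) y + (\<Sum>j. ennreal (2 ^ j * \<tau>) * ?I j y)"
    proof (cases "y \<in> ?A")
      case True
      then have "(\<lambda>j. ennreal (2 ^ j * \<tau>) * ?I j y) = (\<lambda>j. ennreal (2 ^ j * \<tau>) * indicator {t. t < \<bar>\<omega> y\<bar>} (2 ^ j * \<tau>))"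
        by (auto simp: indicator_def)
      then show ?thesis using True dyadic_layers[OF \<tau>, of "\<bar>\<omega> y\<bar>"] by simp
    qed simp
  qed
  also have "\<dots> = (\<integral>\<^sup>+y. ennreal \<tau> * indicator (ball z \<rho>) y \<partial>lborel) + (\<integral>\<^sup>+y. (\<Sum>j. ennreal (2 ^ j * \<tau>) * ?I j y) \<partial>lborel)"
    by (rule nn_integral_add) measurable
  also have "(\<integral>\<^sup>+y. (\<Sum>j. ennreal (2 ^ j * \<tau>) * ?I j y) \<partial>lborel) = (\<Sum>j. \<integral>\<^sup>+y. ennreal (2 ^ j * \<tau>) * ?I j y \<partial>lborel)"
    by (rule nn_integral_suminf) measurable
  also have "(\<lambda>j. \<integral>\<^sup>+y. ennreal (2 ^ j * \<tau>) * ?I j y \<partial>lborel)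
      = (\<lambda>j. ennreal (2 ^ j * \<tau>) * emeasure lborel ({y. \<bar>\<omega> y\<bar> > 2 ^ j * \<tau>} \<inter> ?A))"
    by (intro ext nn_integral_cmult_indicator) measurable
  also have "(\<Sum>j. ennreal (2 ^ j * \<tau>) * emeasure lborel ({y. \<bar>\<omega> y\<bar> > 2 ^ j * \<tau>} \<inter> ?A))
      \<le> (\<Sum>j. ennreal (2 * n * \<rho> * M * \<theta> ^ (n - 1) * (1/2) ^ j))"
  proof (rule suminf_le)
    fix j :: nat
    have t: "2 ^ j * \<tau> > 0" using \<tau> by simp
    have "ennreal (2 ^ j * \<tau>) * emeasure lborel ({y. \<bar>\<omega> y\<bar> > 2 ^ j * \<tau>} \<inter> ?A)
        \<le> ennreal (2 ^ j * \<tau>) * ennreal (2 * n * \<rho> * (M / (2 ^ j * \<tau>)) ^ n)"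
      unfolding n_def by (intro mult_left_mono level_set_ball z \<rho> t) simp
    also have "\<dots> = ennreal (2 ^ j * \<tau> * (2 * n * \<rho> * (M / (2 ^ j * \<tau>)) ^ n))"
      using t \<rho> M_pos by (simp add: ennreal_mult)
    also have "\<dots> \<le> ennreal (2 * n * \<rho> * M * \<theta> ^ (n - 1) * (1/2) ^ j)"
    proof (rule ennreal_leI)
      obtain k where k: "n = Suc (Suc k)" using n by (metis Suc_le_D numeral_2_eq_2 Suc_le_mono)
      have q: "M / (2 ^ j * \<tau>) = \<theta> * (1/2) ^ j" using M_pos \<theta> by (simp add: \<tau>_def power_divide)
      have e: "2 ^ j * \<tau> * (\<theta> * (1/2) ^ j) = M" using \<theta> by (simp add: \<tau>_def power_divide)
      have "2 ^ j * \<tau> * (2 * n * \<rho> * (M / (2 ^ j * \<tau>)) ^ n)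
          = 2 * n * \<rho> * (2 ^ j * \<tau> * (\<theta> * (1/2) ^ j)) * (\<theta> * (1/2) ^ j) ^ (n - 1)"
        unfolding q by (simp add: k)
      also have "\<dots> = 2 * n * \<rho> * M * \<theta> ^ (n - 1) * ((1/2) ^ j) ^ (n - 1)"
        unfolding e by (simp add: power_mult_distrib)
      also have "\<dots> \<le> 2 * n * \<rho> * M * \<theta> ^ (n - 1) * ((1/2) ^ j) ^ 1"
        using n \<rho> M_pos \<theta> by (intro mult_left_mono power_decreasing) (auto intro!: power_le_one)
      finally show "2 ^ j * \<tau> * (2 * n * \<rho> * (M / (2 ^ j * \<tau>)) ^ n) \<le> 2 * n * \<rho> * M * \<theta> ^ (n - 1) * (1/2) ^ j"
        by simp
    qed
    finally show "ennreal (2 ^ j * \<tau>) * emeasure lborel ({y. \<bar>\<omega> y\<bar> > 2 ^ j * \<tau>} \<inter> ?A)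
      \<le> ennreal (2 * n * \<rho> * M * \<theta> ^ (n - 1) * (1/2) ^ j)" .
  qed auto
  also have "(\<Sum>j. ennreal (2 * n * \<rho> * M * \<theta> ^ (n - 1) * (1/2) ^ j)) = ennreal (2 * n * \<rho> * M * \<theta> ^ (n - 1) * 2)"
  proof (rule suminf_ennreal_eq)
    show "(\<lambda>j. 2 * n * \<rho> * M * \<theta> ^ (n - 1) * (1/2) ^ j) sums (2 * n * \<rho> * M * \<theta> ^ (n - 1) * 2)"
      using geometric_sums[of "1/2::real"] by (intro sums_mult) simp
  qed (use \<rho> M_pos \<theta> in simp)
  also have "(\<integral>\<^sup>+y. ennreal \<tau> * indicator (ball z \<rho>) y \<partial>lborel) = ennreal (\<tau> * (unit_ball_vol n * \<rho> ^ n))"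
    using \<rho> \<tau> unfolding n_def by (simp add: nn_integral_cmult_indicator emeasure_ball ennreal_mult[symmetric])
  also have "\<dots> + ennreal (2 * n * \<rho> * M * \<theta> ^ (n - 1) * 2) = ennreal (\<tau> * (unit_ball_vol n * \<rho> ^ n) + 2 * n * \<rho> * M * \<theta> ^ (n - 1) * 2)"
    using \<rho> \<tau> M_pos \<theta> by (intro ennreal_plus[symmetric]) auto
  also have "\<tau> * (unit_ball_vol n * \<rho> ^ n) + 2 * n * \<rho> * M * \<theta> ^ (n - 1) * 2 = morrey_const n * M * \<rho> powr morrey_exponent n"
  proof -
    have "\<rho> ^ n / \<theta> = \<rho> powr (real n - (real n - 1) / real n)"
      using \<rho> by (simp add: \<theta>_def powr_diff powr_realpow)
    also have "real n - (real n - 1) / real n = morrey_exponent n"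
      using n by (simp add: morrey_exponent_def field_simps)
    finally have 1: "\<rho> ^ n / \<theta> = \<rho> powr morrey_exponent n" .
    have "\<rho> * \<theta> ^ (n - 1) = \<rho> powr 1 * (\<theta> powr real (n - 1))" using \<rho> \<theta> by (simp add: powr_realpow)
    also have "\<dots> = \<rho> powr (1 + (real n - 1) / real n * real (n - 1))"
      using \<rho> by (simp only: \<theta>_def powr_powr powr_add)
    also have "1 + (real n - 1) / real n * real (n - 1) = morrey_exponent n"
      using n by (simp add: morrey_exponent_def of_nat_diff field_simps)
    finally have 2: "\<rho> * \<theta> ^ (n - 1) = \<rho> powr morrey_exponent n" .
    have "\<tau> * (unit_ball_vol n * \<rho> ^ n) + 2 * n * \<rho> * M * \<theta> ^ (n - 1) * 2
       = M * unit_ball_vol n * (\<rho> ^ n / \<theta>) + 4 * n * M * (\<rho> * \<theta> ^ (n - 1))"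
      by (simp add: \<tau>_def)
    also have "\<dots> = morrey_const n * M * \<rho> powr morrey_exponent n"
      unfolding 1 2 by (simp add: morrey_const_def algebra_simps)
    finally show ?thesis .
  qed
  finally show ?thesis unfolding n_def by (simp add: add_left_mono)
qed

end

section \<open>A weighted Poincare inequality\<close>

lemma morrey_const_pos: "n > 0 \<Longrightarrow> morrey_const n > 0"
  by (simp add: morrey_const_def add_pos_pos unit_ball_vol_pos)

definition poincare_const :: "nat \<Rightarrow> real" where
  "poincare_const n = 2 * morrey_const n * 2 powr morrey_exponent n * real n / unit_ball_vol (real n)"

lemma poincare_const_pos: "n > 0 \<Longrightarrow> poincare_const n > 0"
  by (simp add: poincare_const_def morrey_const_pos unit_ball_vol_pos)

text \<open>
  The fundamental theorem of calculus along the segment from \<open>y\<close> to \<open>v\<close>.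
\<close>

lemma increment_le_segment_integral:
  fixes F :: "'a::euclidean_space \<Rightarrow> real"
  assumes F: "\<And>y. (F has_derivative F' y) (at y)"
    and bound: "\<And>y h. \<bar>F' y h\<bar> \<le> G y * norm h"
    and G: "continuous_on UNIV G" "\<And>y. G y \<ge> 0"
  shows "ennreal \<bar>F v - F y\<bar>
    \<le> (\<integral>\<^sup>+t. ennreal (G (y + t *\<^sub>R (v - y)) * norm (v - y)) * indicator {0..1} t \<partial>lborel)"
proof -
  let ?p = "\<lambda>t::real. y + t *\<^sub>R (v - y)"
  let ?g = "\<lambda>t. G (?p t) * norm (v - y)"
  have "((\<lambda>t. F (?p t)) has_vector_derivative F' (?p t) (v - y)) (at t within {0..1})" for t
  proof -
    have "(?p has_vector_derivative (v - y)) (at t within {0..1})"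
      by (auto intro!: derivative_eq_intros)
    then show ?thesis
      using has_derivative_at_withinI[OF F]
      by (rule vector_derivative_diff_chain_within[unfolded o_def])
  qed
  then have "((\<lambda>t. F' (?p t) (v - y)) has_integral (F (?p 1) - F (?p 0))) {0..1}"
    by (intro fundamental_theorem_of_calculus) auto
  then have FTC: "(\<lambda>t. F' (?p t) (v - y)) integrable_on {0..1}" "integral {0..1} (\<lambda>t. F' (?p t) (v - y)) = F v - F y"
    by (auto simp: integral_unique)
  have cont: "continuous_on {0..1} ?g"
    by (intro continuous_intros continuous_on_compose2[OF G(1)]) auto
  have "\<bar>F v - F y\<bar> = norm (integral {0..1} (\<lambda>t. F' (?p t) (v - y)))" by (simp add: FTC)
  also have "\<dots> \<le> integral {0..1} ?g"
    using bound by (intro integral_norm_bound_integral FTC integrable_continuous_interval cont) auto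
  finally have le: "\<bar>F v - F y\<bar> \<le> integral {0..1} ?g" .
  have si: "set_integrable lborel {0..1} ?g"
    using borel_integrable_compact[OF _ cont] by (simp add: set_integrable_def)
  have "ennreal (integral {0..1} ?g) = ennreal (LINT t:{0..1}|lborel. ?g t)"
    by (rule arg_cong[where f = ennreal], rule set_borel_integral_eq_integral(2)[OF si, symmetric])
  also have "\<dots> = (\<integral>\<^sup>+t. ennreal (indicator {0..1} t *\<^sub>R ?g t) \<partial>lborel)"
    unfolding set_lebesgue_integral_def using si G(2)
    by (intro nn_integral_eq_integral[symmetric]) (auto simp: set_integrable_def)
  also have "\<dots> = (\<integral>\<^sup>+t. ennreal (?g t) * indicator {0..1} t \<partial>lborel)"
    by (intro nn_integral_cong) (auto simp: indicator_def)
  finally show ?thesis using le by (metis ennreal_leI)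
qed

lemma nn_integral_powr_0_1:
  assumes "a > 0"
  shows "(\<integral>\<^sup>+t. ennreal (t powr (a - 1)) * indicator {0..1} t \<partial>lborel) = ennreal (1 / a)"
proof -
  have "((\<lambda>t::real. t powr (a - 1)) has_integral 1 powr (a - 1 + 1) / (a - 1 + 1)) {0..1}"
    using assms by (intro has_integral_powr_from_0) auto
  then show ?thesis
    by (intro nn_integral_has_integral_lebesgue') simp_all
qed

context weak_cone_function
begin

text \<open>
  The constant \<open>c\<close> is the average of \<open>F\<close>.  Write \<open>F(v) - F(y)\<close> as an integral over the segment and, for each fixed
  parameter \<open>t\<close>, substitute the intermediate point \<open>z = y + t (v - y)\<close> for \<open>v\<close>.  As \<open>|z - y| < 2t\<close>, integration
  in \<open>y\<close> first leaves the weight of a ball of radius \<open>2t\<close>.  The Morrey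
  bound then gives \<open>t\<^sup>-\<^sup>n t\<^sup>\<beta>\<close>, which is integrable at 0 as \<open>\<beta> > n - 1\<close>.
\<close>

lemma weighted_poincare_unit_ball:
  assumes F: "\<And>y. (F has_derivative F' y) (at y)"
    and bound: "\<And>y h. \<bar>F' y h\<bar> \<le> G y * norm h"
    and G: "continuous_on UNIV G" "\<And>y. G y \<ge> 0"
  shows "\<exists>c. (\<integral>\<^sup>+y. ennreal \<bar>\<omega> y\<bar> * ennreal \<bar>F y - c\<bar> * indicator (ball 0 1) y \<partial>lborel)
      \<le> ennreal (poincare_const DIM('a) * M) * (\<integral>\<^sup>+z. ennreal (G z) * indicator (ball 0 1) z \<partial>lborel)"
proof -
  define n where "n = DIM('a)"
  have n: "n > 0" by (simp add: n_def)
  define \<beta> where "\<beta> = morrey_exponent n"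
  define V where "V = unit_ball_vol (real n)"
  have V: "V > 0" by (simp add: V_def unit_ball_vol_pos)
  let ?B = "ball (0::'a) 1"
  let ?diff = "\<lambda>y. \<integral>\<^sup>+v. ennreal \<bar>F v - F y\<bar> * indicator ?B v \<partial>lborel"
  let ?u = "\<lambda>y v. ennreal \<bar>\<omega> y\<bar> * indicator ?B y * indicator ?B v :: ennreal" and ?seg = "\<lambda>t y v. ennreal (G (y + t *\<^sub>R (v - y)) * norm (v - y))"
  let ?c = "2 * morrey_const n * M * 2 powr \<beta>" and ?P = "\<lambda>t. 2 * morrey_const n * M * (2 * t) powr \<beta>"
  have Vm: "emeasure lborel ?B = ennreal V" using emeasure_ball[of 1 "0::'a"] by (simp add: V_def n_def)
  have Fc: "continuous_on UNIV F" using F has_derivative_continuous by (blast intro: continuous_at_imp_continuous_on)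
  have [measurable]: "F \<in> borel_measurable borel" using Fc by (rule borel_measurable_continuous_onI)
  have [measurable]: "G \<in> borel_measurable borel" using G(1) by (rule borel_measurable_continuous_onI)
  have Fint: "integrable lborel (\<lambda>v. indicator ?B v *\<^sub>R F v)"
  proof -
    have "integrable lborel (\<lambda>v. indicator (cball (0::'a) 1) v *\<^sub>R F v)"
      by (rule borel_integrable_compact) (auto intro: continuous_on_subset[OF Fc])
    then show ?thesis
      by (rule Bochner_Integration.integrable_bound) (auto simp: indicator_def)
  qed
  have oneint: "integrable lborel (\<lambda>v. indicator ?B v * d)" for d :: real
    using emeasure_lborel_ball_finite[of "0::'a" 1] by (intro integrable_mult_left) (auto simp: integrable_indicator_iff)
  define c where "c = (LINT v|lborel. indicator ?B v *\<^sub>R F v) / V"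
  have avg: "ennreal \<bar>F y - c\<bar> \<le> ennreal (1 / V) * ?diff y" for y
  proof -
    have "measure lborel ?B = V" using Vm V by (simp add: measure_def)
    moreover have "(LINT v|lborel. indicator ?B v * F y) = measure lborel ?B * F y" by simp
    ultimately have avg_const: "(LINT v|lborel. indicator ?B v * F y) = V * F y" by metis
    have "V * (c - F y) = (LINT v|lborel. indicator ?B v *\<^sub>R F v) - (LINT v|lborel. indicator ?B v * F y)"
      unfolding avg_const using V by (simp add: c_def right_diff_distrib)
    also have "\<dots> = (LINT v|lborel. indicator ?B v * (F v - F y))"
      using Fint oneint by (subst Bochner_Integration.integral_diff[symmetric]) (auto simp: right_diff_distrib)
    finally have eq: "V * (c - F y) = (LINT v|lborel. indicator ?B v * (F v - F y))" .
    have "integrable lborel (\<lambda>v. indicator ?B v * (F v - F y))"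
      using Bochner_Integration.integrable_diff[OF Fint oneint[of "F y"]] by (simp add: right_diff_distrib)
    then have "ennreal (norm (LINT v|lborel. indicator ?B v * (F v - F y)))
        \<le> (\<integral>\<^sup>+v. ennreal (norm (indicator ?B v * (F v - F y))) \<partial>lborel)"
      by (rule integral_norm_bound_ennreal)
    also have "\<dots> = ?diff y"
      by (intro nn_integral_cong) (auto simp: indicator_def)
    finally have "ennreal (V * \<bar>F y - c\<bar>) \<le> ?diff y"
      using V by (simp add: eq[symmetric] abs_mult abs_minus_commute)
    then have "ennreal (1 / V) * ennreal (V * \<bar>F y - c\<bar>) \<le> ennreal (1 / V) * ?diff y"
      by (rule mult_left_mono) simp
    then show ?thesis using V by (simp add: ennreal_mult[symmetric])
  qed
  let ?I = "\<lambda>t y v. ?u y v * ?seg t y v * indicator {0..1} t"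
  define J where "J = (\<integral>\<^sup>+z. ennreal (G z) * indicator ?B z \<partial>lborel)"
  have slice: "(\<integral>\<^sup>+y. \<integral>\<^sup>+v. ?I t y v \<partial>lborel \<partial>lborel)
      \<le> ennreal (?c) * J * (ennreal (t powr (1 / n - 1)) * indicator {0..1} t)"
    if t0: "t \<noteq> 0" for t
  proof (cases "0 \<le> t \<and> t \<le> 1")
    case False
    then have "indicator {0..1} t = (0::ennreal)" by auto
    then show ?thesis by simp
  next
    case True
    then have t: "0 < t" "t \<le> 1" using t0 by auto
    let ?T = "\<lambda>y z. 2 * ennreal \<bar>\<omega> y\<bar> * (indicator ?B y * indicator {p. dist (snd p) (fst p) < 2 * t} (y, z)) * (ennreal (G z) * indicator ?B z)"
    let ?S = "\<lambda>y z. 2 * ennreal \<bar>\<omega> y\<bar> * (indicator ?B y * indicator (ball z (2 * t)) y) * (ennreal (G z) * indicator ?B z)"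
    have inner: "(\<integral>\<^sup>+v. ?I t y v \<partial>lborel)
        \<le> ennreal ((1/t) ^ n) * (\<integral>\<^sup>+z. ?S y z \<partial>lborel)" for y
    proof -
      \<comment> \<open>The substitution \<open>v = y + (z - y) / t\<close>.\<close>
      have "(\<integral>\<^sup>+v. ?I t y v \<partial>lborel) = ennreal (\<bar>1/t\<bar> ^ DIM('a)) * (\<integral>\<^sup>+z. ?I t y ((y - (1/t) *\<^sub>R y) + (1/t) *\<^sub>R z) \<partial>lborel)"
        using t by (intro nn_integral_lborel_affine) auto
      also have "\<bar>1/t\<bar> ^ DIM('a) = (1/t) ^ n" using t by (simp add: n_def)
      also have "ennreal ((1/t) ^ n) * (\<integral>\<^sup>+z. ?I t y ((y - (1/t) *\<^sub>R y) + (1/t) *\<^sub>R z) \<partial>lborel) \<le> ennreal ((1/t) ^ n) * (\<integral>\<^sup>+z. ?S y z \<partial>lborel)"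
      proof (rule mult_left_mono, rule nn_integral_mono)
        fix z
        define v where "v = (y - (1/t) *\<^sub>R y) + (1/t) *\<^sub>R z"
        show "?I t y ((y - (1/t) *\<^sub>R y) + (1/t) *\<^sub>R z) \<le> ?S y z"
          unfolding v_def[symmetric]
        proof (cases "y \<in> ?B \<and> v \<in> ?B")
          case True
          then have yv: "norm y < 1" "norm v < 1" by auto
          have z: "y + t *\<^sub>R (v - y) = z" using t by (simp add: v_def algebra_simps)
          have "z = (1 - t) *\<^sub>R y + t *\<^sub>R v" using z by (simp add: algebra_simps)
          then have "norm z \<le> (1 - t) * norm y + t * norm v"
            using norm_triangle_ineq[of "(1 - t) *\<^sub>R y" "t *\<^sub>R v"] t by simp
          also have "\<dots> < (1 - t) * 1 + t * 1"
            using t yv by (intro add_le_less_mono mult_left_mono mult_strict_left_mono) auto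
          finally have zB: "z \<in> ?B" by simp
          have nvy: "norm (v - y) \<le> 2" "norm (v - y) < 2" using norm_triangle_ineq4[of v y] yv by auto
          have "dist z y = t * norm (v - y)" unfolding z[symmetric] using t by (simp add: dist_norm)
          also have "\<dots> < t * 2" using t nvy by (intro mult_strict_left_mono) auto
          finally have "y \<in> ball z (2 * t)" by simp
          moreover have "ennreal (G z * norm (v - y)) \<le> ennreal (G z * 2)"
            using nvy G(2)[of z] by (intro ennreal_leI mult_left_mono) auto
          then have "ennreal \<bar>\<omega> y\<bar> * ennreal (G z * norm (v - y)) \<le> ennreal \<bar>\<omega> y\<bar> * (ennreal (G z) * 2)"
            using G(2)[of z] by (intro mult_left_mono) (simp_all add: ennreal_mult)
          ultimately show "?I t y v \<le> ?S y z"
            using True t zB by (simp add: z mult_ac)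
        qed (auto simp: indicator_def)
      qed simp
      finally show ?thesis .
    qed
    have "(\<integral>\<^sup>+y. \<integral>\<^sup>+v. ?I t y v \<partial>lborel \<partial>lborel)
       \<le> (\<integral>\<^sup>+y. ennreal ((1/t) ^ n) * (\<integral>\<^sup>+z. ?S y z \<partial>lborel) \<partial>lborel)"
      by (intro nn_integral_mono inner)
    also have "\<dots> = ennreal ((1/t) ^ n) * (\<integral>\<^sup>+y. \<integral>\<^sup>+z. ?T y z \<partial>lborel \<partial>lborel)"
      by (subst nn_integral_cmult) (auto simp: indicator_def)
    also have "(\<integral>\<^sup>+y. \<integral>\<^sup>+z. ?T y z \<partial>lborel \<partial>lborel)
       = (\<integral>\<^sup>+z. \<integral>\<^sup>+y. ?T y z \<partial>lborel \<partial>lborel)"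
      by (rule lborel_pair.Fubini'[symmetric]) (simp add: case_prod_beta, measurable)
    also have "\<dots> \<le> (\<integral>\<^sup>+z. ennreal (?P t) * (ennreal (G z) * indicator ?B z) \<partial>lborel)"
    proof (rule nn_integral_mono)
      fix z :: 'a
      show "(\<integral>\<^sup>+y. ?T y z \<partial>lborel)
         \<le> ennreal (?P t) * (ennreal (G z) * indicator ?B z)"
      proof (cases "z \<in> ?B")
        case True
        have "(\<integral>\<^sup>+y. ?T y z \<partial>lborel)
          = (\<integral>\<^sup>+y. (2 * ennreal (G z)) * (ennreal \<bar>\<omega> y\<bar> * indicator (?B \<inter> ball z (2 * t)) y) \<partial>lborel)"
          using True by (intro nn_integral_cong) (auto simp: indicator_def mult_ac)
        also have "\<dots> = (2 * ennreal (G z)) * (\<integral>\<^sup>+y. ennreal \<bar>\<omega> y\<bar> * indicator (?B \<inter> ball z (2 * t)) y \<partial>lborel)"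
          by (rule nn_integral_cmult) measurable
        also have "\<dots> \<le> (2 * ennreal (G z)) * ennreal (morrey_const n * M * (2 * t) powr \<beta>)"
          unfolding n_def \<beta>_def using True t by (intro mult_left_mono morrey) auto
        also have "\<dots> = ennreal (?P t) * (ennreal (G z) * indicator ?B z)"
          using True n M_pos morrey_const_pos[of n] by (simp add: ennreal_mult mult_ac)
        finally show ?thesis .
      qed simp
    qed
    also have "\<dots> = ennreal (?P t) * J"
      unfolding J_def by (rule nn_integral_cmult) measurable
    finally have "(\<integral>\<^sup>+y. \<integral>\<^sup>+v. ?I t y v \<partial>lborel \<partial>lborel)
       \<le> ennreal ((1/t) ^ n) * (ennreal (?P t) * J)"
      by (simp add: mult_left_mono)
    also have "\<dots> = ennreal ((1/t) ^ n * (?P t)) * J"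
      using t n M_pos morrey_const_pos[of n] by (simp add: ennreal_mult mult.assoc)
    also have "(1/t) ^ n * (?P t) = (?c) * t powr (1 / n - 1)"
    proof -
      have "(1/t) ^ n * (2 * t) powr \<beta> = 2 powr \<beta> * (t powr \<beta> / t powr n)"
        using t by (simp add: powr_mult powr_realpow power_divide)
      also have "t powr \<beta> / t powr n = t powr (1 / n - 1)"
        by (simp add: powr_diff[symmetric] \<beta>_def morrey_exponent_def)
      finally show ?thesis by (simp add: mult_ac)
    qed
    also have "ennreal (?c * t powr (1 / n - 1)) * J
      = ennreal (?c) * J * (ennreal (t powr (1 / n - 1)) * indicator {0..1} t)"
      using True n M_pos morrey_const_pos[of n] by (simp add: ennreal_mult mult_ac)
    finally show ?thesis .
  qed
  have "(\<integral>\<^sup>+y. ennreal \<bar>\<omega> y\<bar> * ennreal \<bar>F y - c\<bar> * indicator ?B y \<partial>lborel)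
     \<le> (\<integral>\<^sup>+y. ennreal (1 / V) * (\<integral>\<^sup>+v. \<integral>\<^sup>+t. ?I t y v \<partial>lborel \<partial>lborel) \<partial>lborel)"
  proof (rule nn_integral_mono)
    fix y
    have "ennreal \<bar>\<omega> y\<bar> * ennreal \<bar>F y - c\<bar> * indicator ?B y
       \<le> ennreal \<bar>\<omega> y\<bar> * (ennreal (1 / V) * ?diff y) * indicator ?B y"
      by (intro mult_mono avg) auto
    also have "\<dots> = ennreal (1 / V) * (ennreal \<bar>\<omega> y\<bar> * indicator ?B y * ?diff y)"
      by (simp add: mult_ac)
    also have "\<dots> = ennreal (1 / V) * (\<integral>\<^sup>+v. ennreal \<bar>\<omega> y\<bar> * indicator ?B y * (ennreal \<bar>F v - F y\<bar> * indicator ?B v) \<partial>lborel)"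
      by (subst nn_integral_cmult) auto
    also have "\<dots> \<le> ennreal (1 / V) * (\<integral>\<^sup>+v. \<integral>\<^sup>+t. ?I t y v \<partial>lborel \<partial>lborel)"
    proof (intro mult_left_mono nn_integral_mono)
      fix v
      have "ennreal \<bar>\<omega> y\<bar> * indicator ?B y * (ennreal \<bar>F v - F y\<bar> * indicator ?B v)
         = ?u y v * ennreal \<bar>F v - F y\<bar>"
        by (simp add: mult_ac)
      also have "\<dots> \<le> ?u y v *
          (\<integral>\<^sup>+t. ?seg t y v * indicator {0..1} t \<partial>lborel)"
        by (intro mult_left_mono increment_le_segment_integral[OF F bound G]) simp
      also have "\<dots> = (\<integral>\<^sup>+t. ?u y v * (?seg t y v * indicator {0..1} t) \<partial>lborel)"
        by (rule nn_integral_cmult[symmetric]) measurable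
      also have "\<dots> = (\<integral>\<^sup>+t. ?I t y v \<partial>lborel)" by (simp add: mult.assoc)
      finally show "ennreal \<bar>\<omega> y\<bar> * indicator ?B y * (ennreal \<bar>F v - F y\<bar> * indicator ?B v) \<le> (\<integral>\<^sup>+t. ?I t y v \<partial>lborel)" .
    qed simp
    finally show "ennreal \<bar>\<omega> y\<bar> * ennreal \<bar>F y - c\<bar> * indicator ?B y
       \<le> ennreal (1 / V) * (\<integral>\<^sup>+v. \<integral>\<^sup>+t. ?I t y v \<partial>lborel \<partial>lborel)" .
  qed
  also have "\<dots> = ennreal (1 / V) * (\<integral>\<^sup>+y. \<integral>\<^sup>+v. \<integral>\<^sup>+t. ?I t y v \<partial>lborel \<partial>lborel \<partial>lborel)"
    by (rule nn_integral_cmult) measurable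
  also have "(\<integral>\<^sup>+y. \<integral>\<^sup>+v. \<integral>\<^sup>+t. ?I t y v \<partial>lborel \<partial>lborel \<partial>lborel) = (\<integral>\<^sup>+y. \<integral>\<^sup>+t. \<integral>\<^sup>+v. ?I t y v \<partial>lborel \<partial>lborel \<partial>lborel)"
    by (intro nn_integral_cong lborel_pair.Fubini'[symmetric]) (simp add: case_prod_beta, measurable)
  also have "\<dots> = (\<integral>\<^sup>+t. \<integral>\<^sup>+y. \<integral>\<^sup>+v. ?I t y v \<partial>lborel \<partial>lborel \<partial>lborel)"
    by (rule lborel_pair.Fubini'[symmetric]) (simp add: case_prod_beta, measurable)
  also have "\<dots> \<le> (\<integral>\<^sup>+t. ennreal (?c) * J * (ennreal (t powr (1 / n - 1)) * indicator {0..1} t) \<partial>lborel)"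
    using AE_lborel_singleton[of "0::real"] by (intro nn_integral_mono_AE) (auto elim!: eventually_mono intro: slice)
  also have "\<dots> = ennreal (?c) * J * (\<integral>\<^sup>+t. ennreal (t powr (1 / n - 1)) * indicator {0..1} t \<partial>lborel)"
    by (rule nn_integral_cmult) measurable
  also have "(\<integral>\<^sup>+t. ennreal (t powr (1 / n - 1)) * indicator {0..1} t \<partial>lborel) = ennreal n"
    using nn_integral_powr_0_1[of "1 / n"] n by simp
  finally have "(\<integral>\<^sup>+y. ennreal \<bar>\<omega> y\<bar> * ennreal \<bar>F y - c\<bar> * indicator ?B y \<partial>lborel)
     \<le> ennreal (1 / V) * (ennreal (?c) * J * ennreal n)"
    by (simp add: mult_left_mono)
  also have "\<dots> = ennreal (poincare_const n * M) * J"
  proof -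
    have "poincare_const n * M = (1 / V) * (?c) * n"
      by (simp add: poincare_const_def V_def \<beta>_def)
    then have "ennreal (poincare_const n * M) = ennreal (1 / V) * ennreal (?c) * ennreal n"
      using V M_pos n morrey_const_pos[of n]
      by (subst ennreal_mult[symmetric], simp, simp)+ simp
    then show ?thesis by (simp add: mult_ac)
  qed
  finally show ?thesis unfolding n_def J_def by blast
qed

lemma weighted_poincare:
  assumes F: "\<And>y. (F has_derivative F' y) (at y)"
    and bound: "\<And>y h. \<bar>F' y h\<bar> \<le> G y * norm h"
    and G: "continuous_on UNIV G" "\<And>y. G y \<ge> 0" and r: "r > 0"
  shows "\<exists>c. (\<integral>\<^sup>+y. ennreal \<bar>\<omega> y\<bar> * ennreal \<bar>F y - c\<bar> * indicator (ball 0 r) y \<partial>lborel)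
      \<le> ennreal (poincare_const DIM('a) * M * r) * (\<integral>\<^sup>+z. ennreal (G z) * indicator (ball 0 r) z \<partial>lborel)"
proof -
  let ?n = "DIM('a)"
  let ?I = "\<lambda>c. \<integral>\<^sup>+y. ennreal \<bar>\<omega> y\<bar> * ennreal \<bar>F (r *\<^sub>R y) - c\<bar> * indicator (ball 0 1) y \<partial>lborel"
  let ?J' = "\<integral>\<^sup>+z. ennreal (r * G (r *\<^sub>R z)) * indicator (ball 0 1) z \<partial>lborel"
  let ?J = "\<integral>\<^sup>+z. ennreal (G (r *\<^sub>R z)) * indicator (ball 0 1) z \<partial>lborel"
  have Fc: "continuous_on UNIV F" using F has_derivative_continuous by (blast intro: continuous_at_imp_continuous_on)
  have [measurable]: "F \<in> borel_measurable borel" using Fc by (rule borel_measurable_continuous_onI)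
  have [measurable]: "G \<in> borel_measurable borel" using G(1) by (rule borel_measurable_continuous_onI)
  have "\<exists>c. ?I c
      \<le> ennreal (poincare_const DIM('a) * M) * ?J'"
  proof (rule weighted_poincare_unit_ball)
    show "((\<lambda>y. F (r *\<^sub>R y)) has_derivative (\<lambda>h. F' (r *\<^sub>R y) (r *\<^sub>R h))) (at y)" for y
      using has_derivative_compose[OF has_derivative_scaleR_right[OF has_derivative_ident] F, of r y UNIV] by simp
    show "\<bar>F' (r *\<^sub>R y) (r *\<^sub>R h)\<bar> \<le> r * G (r *\<^sub>R y) * norm h" for y h
      using bound[of "r *\<^sub>R y" "r *\<^sub>R h"] r by (simp add: mult_ac)
    show "continuous_on UNIV (\<lambda>y. r * G (r *\<^sub>R y))"
      by (intro continuous_intros continuous_on_compose2[OF G(1)]) auto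
  qed (use G r in auto)
  then obtain c where c: "?I c
      \<le> ennreal (poincare_const DIM('a) * M) * ?J'" by blast
  have ind: "indicator (ball 0 r) (r *\<^sub>R y) = (indicator (ball 0 1) y :: ennreal)" for y :: 'a
    using r by (auto simp: indicator_def)
  have "(\<integral>\<^sup>+y. ennreal \<bar>\<omega> y\<bar> * ennreal \<bar>F y - c\<bar> * indicator (ball 0 r) y \<partial>lborel)
     = ennreal (r ^ ?n) * ?I c"
    using r by (subst nn_integral_lborel_affine[of _ r 0]) (simp_all add: homogeneous ind)
  also have "\<dots> \<le> ennreal (r ^ ?n) * (ennreal (poincare_const ?n * M) * ?J')"
    by (intro mult_left_mono c) simp
  also have "?J' = ennreal r * ?J"
    using r G(2) by (subst nn_integral_cmult[symmetric]) (simp_all add: ennreal_mult mult.assoc)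
  also have "ennreal (r ^ ?n) * (ennreal (poincare_const ?n * M) * (ennreal r * ?J))
    = ennreal (poincare_const ?n * M * r) * (ennreal (r ^ ?n) * ?J)"
    using r M_pos poincare_const_pos[of ?n] by (simp add: ennreal_mult mult_ac)
  also have "ennreal (r ^ ?n) * ?J = (\<integral>\<^sup>+z. ennreal (G z) * indicator (ball 0 r) z \<partial>lborel)"
    using r by (subst nn_integral_lborel_affine[of _ r 0]) (simp_all add: ind)
  finally show ?thesis by blast
qed

end

section \<open>Truncated singular integrals\<close>

text \<open>
  The weight that represents a power as a superposition of indicators: its integral is \<open>a\<^sup>-\<^sup>p\<close> for positive
  \<open>a\<close> and \<open>p\<close>.
\<close>

definition tail_density :: "real \<Rightarrow> real \<Rightarrow> real \<Rightarrow> real" where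
  "tail_density p a r = indicator {a<..} r * (p * r powr (- p - 1))"

lemma tail_density_borel [measurable]:
  assumes [measurable]: "f \<in> borel_measurable N" "g \<in> borel_measurable N"
  shows "(\<lambda>x. tail_density p (f x) (g x)) \<in> borel_measurable N"
proof -
  have "(\<lambda>x. tail_density p (f x) (g x)) = (\<lambda>x. (if f x < g x then 1 else 0) * (p * g x powr (- p - 1)))"
    by (auto simp: tail_density_def)
  also have "\<dots> \<in> borel_measurable N" by measurable
  finally show ?thesis .
qed

lemma tail_density_nonneg: "p \<ge> 0 \<Longrightarrow> tail_density p a r \<ge> 0"
  by (simp add: tail_density_def)

lemma nn_integral_tail_density:
  assumes "p > 0" "a > 0"
  shows "(\<integral>\<^sup>+r. ennreal (tail_density p a r) \<partial>lborel) = ennreal (a powr - p)"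
proof -
  have "((\<lambda>r. r powr (- p - 1)) has_integral - (a powr (- p - 1 + 1)) / (- p - 1 + 1)) {a..}"
    using assms by (intro has_integral_powr_to_inf) auto
  then have "((\<lambda>r. p * r powr (- p - 1)) has_integral p * (- (a powr (- p - 1 + 1)) / (- p - 1 + 1))) {a..}"
    by (rule has_integral_mult_right)
  then have "(\<integral>\<^sup>+r. ennreal (p * r powr (- p - 1)) * indicator {a..} r \<partial>lborel) = ennreal (a powr - p)"
    using assms by (subst nn_integral_has_integral_lebesgue') auto
  moreover have "(\<integral>\<^sup>+r. ennreal (tail_density p a r) \<partial>lborel) = (\<integral>\<^sup>+r. ennreal (p * r powr (- p - 1)) * indicator {a..} r \<partial>lborel)"
    using AE_lborel_singleton[of a]
    by (intro nn_integral_cong_AE) (auto elim!: eventually_mono simp: tail_density_def indicator_def)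
  ultimately show ?thesis by simp
qed

lemma tail_density_integral:
  assumes "p > 0" "a > 0"
  shows "integrable lborel (tail_density p a)" "(LINT r|lborel. tail_density p a r) = a powr - p"
proof -
  have "has_bochner_integral lborel (tail_density p a) (a powr - p)"
    using assms nn_integral_tail_density[OF assms]
    by (intro has_bochner_integral_nn_integral) (auto simp: tail_density_nonneg)
  then show "integrable lborel (tail_density p a)" "(LINT r|lborel. tail_density p a r) = a powr - p"
    by (auto simp: has_bochner_integral_iff)
qed

lemma AE_norm_neq: "AE y in lborel. norm (y::'a::euclidean_space) \<noteq> r"
proof -
  have "sphere (0::'a) r \<in> null_sets lborel"
    using negligible_sphere[of "0::'a" r] by (auto simp: null_sets_completion_iff negligible_iff_null_sets)
  then have "AE y in lborel. y \<notin> sphere (0::'a) r" by (rule AE_not_in)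
  then show ?thesis by eventually_elim simp
qed

lemma nn_integral_homogeneous_ball:
  fixes w :: "'a::euclidean_space \<Rightarrow> ennreal"
  assumes [measurable]: "w \<in> borel_measurable borel" and hom: "\<And>c y. c > 0 \<Longrightarrow> w (c *\<^sub>R y) = w y" and r: "r > 0"
  shows "(\<integral>\<^sup>+y. w y * indicator (ball 0 r) y \<partial>lborel) = ennreal (r ^ DIM('a)) * (\<integral>\<^sup>+y. w y * indicator (ball 0 1) y \<partial>lborel)"
proof -
  have ind: "indicator (ball 0 r) (r *\<^sub>R y) = (indicator (ball 0 1) y :: ennreal)" for y :: 'a
    using r by (auto simp: indicator_def)
  show ?thesis using r by (subst nn_integral_lborel_affine[of _ r 0]) (simp_all add: hom ind)
qed

text \<open>
  Powers of \<open>|y|\<close> are integrated by layers: the part of the integral in \<open>|y| < r\<close> scales like \<open>r\<^sup>n\<close>.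
\<close>

lemma nn_integral_homogeneous_powr_finite:
  fixes w :: "'a::euclidean_space \<Rightarrow> ennreal" and p :: real
  assumes [measurable]: "w \<in> borel_measurable borel" and hom: "\<And>c y. c > 0 \<Longrightarrow> w (c *\<^sub>R y) = w y"
    and fin: "(\<integral>\<^sup>+y. w y * indicator (ball 0 1) y \<partial>lborel) < \<infinity>" and p: "0 < p" "p < DIM('a)"
  shows "(\<integral>\<^sup>+y. w y * ennreal (norm y powr - p) * indicator (ball 0 1) y \<partial>lborel) < \<infinity>"
proof -
  let ?n = "DIM('a)" and ?B = "ball (0::'a) 1"
  let ?near = "\<lambda>r. ennreal (r powr ((?n - p) - 1)) * indicator {0..1} r"
  let ?h = "\<lambda>y r. w y * indicator ?B y * ennreal (tail_density p (norm y) r)"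
  let ?W = "\<integral>\<^sup>+y. w y * indicator ?B y \<partial>lborel"
  have "(\<integral>\<^sup>+y. w y * ennreal (norm y powr - p) * indicator ?B y \<partial>lborel)
      = (\<integral>\<^sup>+y. \<integral>\<^sup>+r. ?h y r \<partial>lborel \<partial>lborel)"
  proof (rule nn_integral_cong_AE)
    show "AE y in lborel. w y * ennreal (norm y powr - p) * indicator ?B y
        = (\<integral>\<^sup>+r. ?h y r \<partial>lborel)"
      using AE_lborel_singleton[of "0::'a"]
    proof eventually_elim
      fix y :: 'a assume "y \<noteq> 0"
      have "(\<integral>\<^sup>+r. ?h y r \<partial>lborel)
         = w y * indicator ?B y * (\<integral>\<^sup>+r. ennreal (tail_density p (norm y) r) \<partial>lborel)"
        by (rule nn_integral_cmult) measurable
      then show "w y * ennreal (norm y powr - p) * indicator ?B y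
        = (\<integral>\<^sup>+r. ?h y r \<partial>lborel)"
        using \<open>y \<noteq> 0\<close> p by (simp add: nn_integral_tail_density mult_ac)
    qed
  qed
  also have "\<dots> = (\<integral>\<^sup>+r. \<integral>\<^sup>+y. ?h y r \<partial>lborel \<partial>lborel)"
    by (rule lborel_pair.Fubini'[symmetric]) (simp add: case_prod_beta, measurable)
  also have "\<dots> \<le> (\<integral>\<^sup>+r. ennreal (p * r powr ((?n - p) - 1)) * indicator {0..1} r * ?W + ennreal (tail_density p 1 r) * ?W \<partial>lborel)"
  proof (rule nn_integral_mono)
    fix r :: real
    show "(\<integral>\<^sup>+y. ?h y r \<partial>lborel)
        \<le> ennreal (p * r powr ((?n - p) - 1)) * indicator {0..1} r * ?W + ennreal (tail_density p 1 r) * ?W"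
    proof (cases "r > 0")
      case False
      then have "tail_density p (norm y) r = 0" for y :: 'a
        using norm_ge_zero[of y] by (auto simp: tail_density_def indicator_def simp del: norm_ge_zero)
      then show ?thesis by simp
    next
      case True
      show ?thesis
      proof (cases "r \<le> 1")
        case r1: True
        have "(\<integral>\<^sup>+y. ?h y r \<partial>lborel)
           \<le> (\<integral>\<^sup>+y. ennreal (p * r powr (- p - 1)) * (w y * indicator (ball 0 r) y) \<partial>lborel)"
          by (intro nn_integral_mono) (auto simp: tail_density_def indicator_def mult_ac)
        also have "\<dots> = ennreal (p * r powr (- p - 1)) * (\<integral>\<^sup>+y. w y * indicator (ball 0 r) y \<partial>lborel)"
          by (rule nn_integral_cmult) measurable
        also have "\<dots> = ennreal (p * r powr (- p - 1)) * (ennreal (r ^ ?n) * ?W)"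
          by (subst nn_integral_homogeneous_ball[OF _ hom True]) simp_all
        also have "\<dots> = ennreal (p * r powr (- p - 1) * r ^ ?n) * ?W"
          using p True by (simp add: ennreal_mult mult_ac)
        also have "p * r powr (- p - 1) * r ^ ?n = p * r powr ((?n - p) - 1)"
          using True by (simp add: powr_realpow[symmetric] powr_add[symmetric] algebra_simps)
        finally show ?thesis using r1 True by (simp add: tail_density_def)
      next
        case False
        have "(\<integral>\<^sup>+y. ?h y r \<partial>lborel)
           \<le> (\<integral>\<^sup>+y. ennreal (tail_density p 1 r) * (w y * indicator ?B y) \<partial>lborel)"
          using False by (intro nn_integral_mono) (auto simp: tail_density_def indicator_def mult_ac)
        also have "\<dots> = ennreal (tail_density p 1 r) * ?W"
          by (rule nn_integral_cmult) measurable
        finally show ?thesis using False by simp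
      qed
    qed
  qed
  also have "\<dots> = (\<integral>\<^sup>+r. ennreal p * ?W * (?near r) + ?W * ennreal (tail_density p 1 r) \<partial>lborel)"
    using p by (intro nn_integral_cong) (simp add: ennreal_mult mult_ac)
  also have "\<dots> = (\<integral>\<^sup>+r. ennreal p * ?W * (?near r) \<partial>lborel) + (\<integral>\<^sup>+r. ?W * ennreal (tail_density p 1 r) \<partial>lborel)"
    by (rule nn_integral_add) measurable
  also have "\<dots> = ennreal p * ?W * (\<integral>\<^sup>+r. ?near r \<partial>lborel) + ?W * (\<integral>\<^sup>+r. ennreal (tail_density p 1 r) \<partial>lborel)"
    by (intro arg_cong2[where f = plus] nn_integral_cmult) measurable
  also have "\<dots> < \<infinity>"
    using p fin by (simp add: nn_integral_powr_0_1 nn_integral_tail_density ennreal_mult_less_top)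
  finally show ?thesis .
qed

lemma lborel_integral_affine:
  fixes t :: "'a::euclidean_space" and f :: "'a \<Rightarrow> 'b::{banach,second_countable_topology}"
  assumes [measurable]: "f \<in> borel_measurable borel" and "c \<noteq> 0"
  shows "(LINT x|lborel. f x) = \<bar>c\<bar> ^ DIM('a) *\<^sub>R (LINT x|lborel. f (t + c *\<^sub>R x))"
proof -
  have e: "(\<lambda>_. ennreal \<bar>c\<bar> ^ DIM('a)) = (\<lambda>_::'a. ennreal (\<bar>c\<bar> ^ DIM('a)))" by (simp add: ennreal_power)
  show ?thesis
    by (subst lborel_affine[OF \<open>c \<noteq> 0\<close>, of t]) (simp add: e integral_density integral_distr)
qed

lemma lborel_integrable_affine:
  fixes t :: "'a::euclidean_space" and f :: "'a \<Rightarrow> real"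
  assumes [measurable]: "f \<in> borel_measurable borel" and "c \<noteq> 0"
  shows "integrable lborel f \<longleftrightarrow> integrable lborel (\<lambda>x. f (t + c *\<^sub>R x))"
proof -
  have e: "(\<lambda>_. ennreal \<bar>c\<bar> ^ DIM('a)) = (\<lambda>_::'a. ennreal (\<bar>c\<bar> ^ DIM('a)))" by (simp add: ennreal_power)
  show ?thesis
    using \<open>c \<noteq> 0\<close>
    by (subst lborel_affine[OF \<open>c \<noteq> 0\<close>, of t]) (simp add: e integrable_density integrable_distr_eq)
qed

locale mean_zero_cone_function = weak_cone_function +
  assumes integrable_unit_ball: "integrable lborel (\<lambda>y. indicator (ball 0 1) y * \<omega> y)"
    and mean_zero_unit_ball: "(LINT y|lborel. indicator (ball 0 1) y * \<omega> y) = 0"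
begin

lemma integrable_ball: "integrable lborel (\<lambda>y. indicator (ball 0 r) y * \<omega> y)"
  and mean_zero_ball: "(LINT y|lborel. indicator (ball 0 r) y * \<omega> y) = 0"
proof -
  have ind: "indicator (ball 0 r) (r *\<^sub>R y) = (indicator (ball 0 1) y :: real)" if "r > 0" for y :: 'a
    using that by (auto simp: indicator_def)
  have "integrable lborel (\<lambda>y. indicator (ball 0 r) y * \<omega> y) \<and> (LINT y|lborel. indicator (ball 0 r) y * \<omega> y) = 0"
  proof (cases "r > 0")
    case True
    then show ?thesis
      using lborel_integral_affine[of "\<lambda>y. indicator (ball 0 r) y * \<omega> y" r 0]
        lborel_integrable_affine[of "\<lambda>y. indicator (ball 0 r) y * \<omega> y" r 0] integrable_unit_ball mean_zero_unit_ball
      by (simp add: ind homogeneous)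
  next
    case False
    then have "indicator (ball 0 r) y = (0::real)" for y :: 'a
      using norm_ge_zero[of y] by (auto simp: indicator_def simp del: norm_ge_zero)
    then show ?thesis by simp
  qed
  then show "integrable lborel (\<lambda>y. indicator (ball 0 r) y * \<omega> y)" "(LINT y|lborel. indicator (ball 0 r) y * \<omega> y) = 0"
    by auto
qed

text \<open>
  By scaling, \<open>\<omega>\<close> has mean zero over every ball about the origin, and the annulus is a difference of two balls up to a
  sphere, which is a null set.
\<close>

lemma mean_zero_annulus:
  "integrable lborel (\<lambda>y. indicator {y. \<epsilon> < norm y \<and> norm y < r} y * \<omega> y)"
  "(LINT y|lborel. indicator {y. \<epsilon> < norm y \<and> norm y < r} y * \<omega> y) = 0"
proof -
  let ?f = "\<lambda>y. indicator {y. \<epsilon> < norm y \<and> norm y < r} y * \<omega> y"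
  have "integrable lborel ?f \<and> integral\<^sup>L lborel ?f = 0"
  proof (cases "\<epsilon> < r")
    case True
    let ?g = "\<lambda>y. indicator (ball 0 r) y * \<omega> y - indicator (ball 0 \<epsilon>) y * \<omega> y"
    have ae: "AE y in lborel. ?f y = ?g y"
      using AE_norm_neq[of \<epsilon>] by eventually_elim (use True in \<open>auto simp: indicator_def\<close>)
    have "integrable lborel ?g" "integral\<^sup>L lborel ?g = 0"
      by (simp_all add: integrable_ball mean_zero_ball)
    then show ?thesis
      using integrable_cong_AE[OF _ _ ae] integral_cong_AE[OF _ _ ae] by simp
  next
    case False
    then have "{y::'a. \<epsilon> < norm y \<and> norm y < r} = {}" by auto
    then show ?thesis by simp
  qed
  then show "integrable lborel ?f" "integral\<^sup>L lborel ?f = 0" by auto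
qed

definition truncated :: "real \<Rightarrow> ('a \<Rightarrow> real) \<Rightarrow> real \<Rightarrow> real" where
  "truncated s F \<epsilon> = (LINT y|lborel. indicator {y. \<epsilon> < norm y} y * (\<omega> y * norm y powr - s * F y))"

lemma integrable_kernel_times:
  assumes [measurable]: "F \<in> borel_measurable borel" and b: "\<And>y. \<bar>F y\<bar> \<le> b" and supp: "\<And>y. norm y \<ge> L \<Longrightarrow> F y = 0"
  shows "integrable lborel (\<lambda>y. \<omega> y * F y)"
proof (rule Bochner_Integration.integrable_bound)
  show "integrable lborel (\<lambda>y. b * (indicator (ball 0 L) y * \<omega> y))" using integrable_ball by simp
  show "AE y in lborel. norm (\<omega> y * F y) \<le> norm (b * (indicator (ball 0 L) y * \<omega> y))"
  proof (rule AE_I2)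
    fix y
    have "b \<ge> 0" using b[of y] by linarith
    then show "norm (\<omega> y * F y) \<le> norm (b * (indicator (ball 0 L) y * \<omega> y))"
      using supp[of y] b[of y] by (auto simp: indicator_def abs_mult not_less mult.commute intro!: mult_right_mono)
  qed
qed simp

text \<open>
  The layer representation of the truncated integral: \<open>A r\<close> is the integral of \<open>\<omega> F\<close> over the annulus
  between the radii \<open>\<epsilon>\<close> and \<open>r\<close>.
\<close>

lemma truncated_layers:
  assumes F[measurable]: "F \<in> borel_measurable borel" and b: "\<And>y. \<bar>F y\<bar> \<le> b" and supp: "\<And>y. norm y \<ge> L \<Longrightarrow> F y = 0"
    and s: "s > 0" and \<epsilon>: "\<epsilon> > 0"
  defines "A \<equiv> \<lambda>r. LINT y|lborel. indicator {y. \<epsilon> < norm y \<and> norm y < r} y * (\<omega> y * F y)"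
  shows "integrable lborel (\<lambda>y. indicator {y. \<epsilon> < norm y} y * (\<omega> y * norm y powr - s * F y))"
    and "integrable lborel (\<lambda>r. tail_density s \<epsilon> r * A r)"
    and "truncated s F \<epsilon> = (LINT r|lborel. tail_density s \<epsilon> r * A r)"
proof -
  let ?k = "\<lambda>y. indicator {y. \<epsilon> < norm y} y * (\<omega> y * norm y powr - s * F y)"
  let ?f = "\<lambda>y r. indicator {y. \<epsilon> < norm y} y * (\<omega> y * F y) * tail_density s (norm y) r"
  have wF: "integrable lborel (\<lambda>y. \<omega> y * F y)" by (rule integrable_kernel_times[OF F b supp])
  show int1: "integrable lborel (\<lambda>y. ?k y)"
  proof (rule Bochner_Integration.integrable_bound)
    show "integrable lborel (\<lambda>y. \<epsilon> powr - s * (\<omega> y * F y))" using wF by simp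
    show "AE y in lborel. norm (?k y) \<le> norm (\<epsilon> powr - s * (\<omega> y * F y))"
    proof (rule AE_I2)
      fix y :: 'a
      show "norm (?k y) \<le> norm (\<epsilon> powr - s * (\<omega> y * F y))"
      proof (cases "\<epsilon> < norm y")
        case True
        then have "norm y powr - s \<le> \<epsilon> powr - s" using s \<epsilon> by (intro powr_mono2') auto
        then have "norm y powr - s * \<bar>\<omega> y * F y\<bar> \<le> \<epsilon> powr - s * \<bar>\<omega> y * F y\<bar>" by (rule mult_right_mono) simp
        then show ?thesis using True by (simp add: abs_mult mult_ac)
      qed simp
    qed
  qed simp
  have norm_int: "(LINT r|lborel. norm (?f y r)) = norm (?k y)" for y
  proof (cases "\<epsilon> < norm y")
    case True
    then have "(LINT r|lborel. norm (?f y r)) = (LINT r|lborel. \<bar>\<omega> y * F y\<bar> * tail_density s (norm y) r)"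
      using s by (intro Bochner_Integration.integral_cong) (simp_all add: abs_mult tail_density_nonneg)
    also have "\<dots> = \<bar>\<omega> y * F y\<bar> * norm y powr - s"
      using s tail_density_integral(2)[OF s less_trans[OF \<epsilon> True]] by simp
    finally show ?thesis using True by (simp add: abs_mult mult_ac)
  qed simp
  have fi: "integrable (lborel \<Otimes>\<^sub>M lborel) (\<lambda>(y, r). ?f y r)"
  proof (rule lborel_pair.Fubini_integrable)
    show "(\<lambda>(y, r). ?f y r) \<in> borel_measurable (lborel \<Otimes>\<^sub>M lborel)" unfolding case_prod_beta by measurable
    show "integrable lborel (\<lambda>y. LINT r|lborel. norm (case (y, r) of (y, r) \<Rightarrow> ?f y r))"
      using int1 by (simp add: norm_int del: real_norm_def)
    show "AE y in lborel. integrable lborel (\<lambda>r. case (y, r) of (y, r) \<Rightarrow> ?f y r)"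
    proof (rule AE_I2)
      show "integrable lborel (\<lambda>r. case (y, r) of (y, r) \<Rightarrow> ?f y r)" for y
        using s \<epsilon> by (cases "\<epsilon> < norm y") (auto intro!: integrable_mult_right tail_density_integral)
    qed
  qed
  have inner: "(LINT y|lborel. ?f y r) = tail_density s \<epsilon> r * A r" for r
  proof -
    have "(LINT y|lborel. ?f y r) = (LINT y|lborel. tail_density s \<epsilon> r * (indicator {y. \<epsilon> < norm y \<and> norm y < r} y * (\<omega> y * F y)))"
      by (intro Bochner_Integration.integral_cong) (auto simp: tail_density_def indicator_def)
    then show ?thesis by (simp add: A_def)
  qed
  show "integrable lborel (\<lambda>r. tail_density s \<epsilon> r * A r)"
    using lborel_pair.integrable_snd[OF fi] by (simp add: inner)
  have "truncated s F \<epsilon> = (LINT y|lborel. LINT r|lborel. ?f y r)"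
    unfolding truncated_def
  proof (intro Bochner_Integration.integral_cong refl)
    fix y
    show "?k y = (LINT r|lborel. ?f y r)"
      using tail_density_integral(2)[OF s less_trans[OF \<epsilon>], of "norm y"] by (cases "\<epsilon> < norm y") simp_all
  qed
  also have "\<dots> = (LINT r|lborel. LINT y|lborel. ?f y r)"
    by (rule lborel_pair.Fubini_integral[symmetric, OF fi])
  finally show "truncated s F \<epsilon> = (LINT r|lborel. tail_density s \<epsilon> r * A r)" by (simp add: inner)
qed

text \<open>
  In every layer the mean-zero condition allows the subtraction of the constant from
  \<open>weighted_poincare\<close>; the sum over the layers turns \<open>r\<^sup>-\<^sup>s\<close>, integrated over \<open>r > |z|\<close>, into a
  multiple of \<open>|z|\<^sup>1\<^sup>-\<^sup>s\<close>.
\<close>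

lemma truncated_le:
  assumes F: "\<And>y. (F has_derivative F' y) (at y)"
    and bound: "\<And>y h. \<bar>F' y h\<bar> \<le> G y * norm h"
    and G: "continuous_on UNIV G" "\<And>y. G y \<ge> 0"
    and b: "\<And>y. \<bar>F y\<bar> \<le> b" and supp: "\<And>y. norm y \<ge> L \<Longrightarrow> F y = 0"
    and s: "s > 1" and \<epsilon>: "\<epsilon> > 0"
  shows "ennreal \<bar>truncated s F \<epsilon>\<bar>
    \<le> ennreal (poincare_const DIM('a) * M * (s / (s - 1))) * (\<integral>\<^sup>+z. ennreal (G z * norm z powr - (s - 1)) \<partial>lborel)"
proof -
  have Fc: "continuous_on UNIV F" using F has_derivative_continuous by (blast intro: continuous_at_imp_continuous_on)
  have Fm[measurable]: "F \<in> borel_measurable borel" using Fc by (rule borel_measurable_continuous_onI)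
  have Gm[measurable]: "G \<in> borel_measurable borel" using G(1) by (rule borel_measurable_continuous_onI)
  let ?K = "poincare_const DIM('a) * M"
  let ?d = "\<lambda>r. ?K * (s / (s - 1)) * ((s - 1) * r powr (- (s - 1) - 1))"
  let ?J = "\<lambda>r. \<integral>\<^sup>+z. ennreal (G z) * indicator (ball 0 r) z \<partial>lborel"
  let ?h = "\<lambda>z r. ennreal (?K * (s / (s - 1))) * ennreal (G z) * ennreal (tail_density (s - 1) (norm z) r)"
  have K: "?K \<ge> 0" using M_pos poincare_const_pos[of "DIM('a)"] by (simp add: less_imp_le)
  define A where "A r = (LINT y|lborel. indicator {y. \<epsilon> < norm y \<and> norm y < r} y * (\<omega> y * F y))" for r
  have A: "ennreal \<bar>A r\<bar> \<le> ennreal (?K * r) * ?J r" if r: "r > 0" for r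
  proof -
    obtain c where c: "(\<integral>\<^sup>+y. ennreal \<bar>\<omega> y\<bar> * ennreal \<bar>F y - c\<bar> * indicator (ball 0 r) y \<partial>lborel)
      \<le> ennreal (?K * r) * ?J r"
      using weighted_poincare[OF F bound G r] by blast
    let ?a = "\<lambda>y. indicator {y. \<epsilon> < norm y \<and> norm y < r} y * \<omega> y"
    have i1: "integrable lborel (\<lambda>y. ?a y * F y)"
    proof (rule Bochner_Integration.integrable_bound)
      show "integrable lborel (\<lambda>y. \<omega> y * F y)" by (rule integrable_kernel_times[OF Fm b supp])
    qed (auto simp: indicator_def)
    have i2: "integrable lborel (\<lambda>y. ?a y * c)" using mean_zero_annulus(1) by (rule integrable_mult_left)
    have "(LINT y|lborel. ?a y * c) = 0" by (simp only: integral_mult_left_zero mean_zero_annulus mult_zero_left)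
    then have "A r = (LINT y|lborel. ?a y * F y) - (LINT y|lborel. ?a y * c)"
      by (simp add: A_def mult.assoc)
    also have "\<dots> = (LINT y|lborel. ?a y * F y - ?a y * c)" using i1 i2 by simp
    finally have "ennreal \<bar>A r\<bar> = ennreal (norm (LINT y|lborel. ?a y * F y - ?a y * c))" by simp
    also have "\<dots> \<le> (\<integral>\<^sup>+y. ennreal (norm (?a y * F y - ?a y * c)) \<partial>lborel)"
      by (intro integral_norm_bound_ennreal Bochner_Integration.integrable_diff i1 i2)
    also have "\<dots> \<le> (\<integral>\<^sup>+y. ennreal \<bar>\<omega> y\<bar> * ennreal \<bar>F y - c\<bar> * indicator (ball 0 r) y \<partial>lborel)"
      by (intro nn_integral_mono)
         (auto simp: indicator_def ennreal_mult[symmetric] abs_mult[symmetric] right_diff_distrib)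
    also note c
    finally show ?thesis .
  qed
  note layers = truncated_layers[OF Fm b supp _ \<epsilon>, where s = s and L = L, folded A_def]
  have "ennreal \<bar>truncated s F \<epsilon>\<bar> = ennreal (norm (LINT r|lborel. tail_density s \<epsilon> r * A r))"
    using s layers(3) by simp
  also have "\<dots> \<le> (\<integral>\<^sup>+r. ennreal (norm (tail_density s \<epsilon> r * A r)) \<partial>lborel)"
    using s layers(2) by (intro integral_norm_bound_ennreal) simp
  also have "\<dots> \<le> (\<integral>\<^sup>+r. \<integral>\<^sup>+z. ?h z r \<partial>lborel \<partial>lborel)"
  proof (rule nn_integral_mono)
    fix r :: real
    show "ennreal (norm (tail_density s \<epsilon> r * A r))
       \<le> (\<integral>\<^sup>+z. ?h z r \<partial>lborel)"
    proof (cases "\<epsilon> < r")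
      case True
      then have r: "r > 0" using \<epsilon> by simp
      have "ennreal (norm (tail_density s \<epsilon> r * A r)) = ennreal (s * r powr (- s - 1)) * ennreal \<bar>A r\<bar>"
        using True s by (simp add: tail_density_def abs_mult ennreal_mult)
      also have "\<dots> \<le> ennreal (s * r powr (- s - 1)) * (ennreal (?K * r) * ?J r)"
        by (intro mult_left_mono A r) simp
      also have "\<dots> = ennreal (s * r powr (- s - 1) * (?K * r)) * ?J r"
      proof -
        have "ennreal (s * r powr (- s - 1) * (?K * r)) = ennreal (s * r powr (- s - 1)) * ennreal (?K * r)"
          using s K r by (intro ennreal_mult) auto
        then show ?thesis by (simp only: mult.assoc)
      qed
      also have "s * r powr (- s - 1) * (?K * r) = ?d r"
      proof -
        have "r powr (- s - 1) * r = r powr (- s - 1) * r powr 1" using r by simp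
        also have "\<dots> = r powr (- (s - 1) - 1)" by (simp only: powr_add[symmetric]) simp
        finally show ?thesis using s by simp
      qed
      also have "ennreal (?d r) * ?J r
          = (\<integral>\<^sup>+z. ennreal (?d r) * (ennreal (G z) * indicator (ball 0 r) z) \<partial>lborel)"
        by (rule nn_integral_cmult[symmetric]) measurable
      also have "\<dots> = (\<integral>\<^sup>+z. ?h z r \<partial>lborel)"
      proof (rule nn_integral_cong)
        fix z :: 'a
        have "ennreal (?d r)
          = ennreal (?K * (s / (s - 1))) * ennreal ((s - 1) * r powr (- (s - 1) - 1))"
          using s K by (intro ennreal_mult) auto
        then show "ennreal (?d r) * (ennreal (G z) * indicator (ball 0 r) z)
          = ?h z r"
          by (cases "norm z < r") (simp_all add: tail_density_def mult_ac)
      qed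
      finally show ?thesis .
    qed (simp add: tail_density_def)
  qed
  also have "\<dots> = (\<integral>\<^sup>+z. \<integral>\<^sup>+r. ?h z r \<partial>lborel \<partial>lborel)"
    by (rule lborel_pair.Fubini'[symmetric]) (simp add: case_prod_beta, measurable)
  also have "\<dots> = (\<integral>\<^sup>+z. ennreal (?K * (s / (s - 1))) * ennreal (G z * norm z powr - (s - 1)) \<partial>lborel)"
  proof (rule nn_integral_cong_AE)
    show "AE z in lborel. (\<integral>\<^sup>+r. ?h z r \<partial>lborel)
       = ennreal (?K * (s / (s - 1))) * ennreal (G z * norm z powr - (s - 1))"
      using AE_lborel_singleton[of "0::'a"]
    proof eventually_elim
      fix z :: 'a assume "z \<noteq> 0"
      have "(\<integral>\<^sup>+r. ?h z r \<partial>lborel)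
         = ennreal (?K * (s / (s - 1))) * ennreal (G z) * (\<integral>\<^sup>+r. ennreal (tail_density (s - 1) (norm z) r) \<partial>lborel)"
        by (rule nn_integral_cmult) measurable
      then show "(\<integral>\<^sup>+r. ?h z r \<partial>lborel)
       = ennreal (?K * (s / (s - 1))) * ennreal (G z * norm z powr - (s - 1))"
        using \<open>z \<noteq> 0\<close> s G(2)[of z] nn_integral_tail_density[of "s - 1" "norm z"] by (simp add: ennreal_mult mult.assoc)
    qed
  qed
  also have "\<dots> = ennreal (?K * (s / (s - 1))) * (\<integral>\<^sup>+z. ennreal (G z * norm z powr - (s - 1)) \<partial>lborel)"
    by (rule nn_integral_cmult) measurable
  finally show ?thesis .
qed

text \<open>
  Subtracting \<open>F(0)\<close> on the unit ball does not change the truncated integrals, as \<open>\<omega> |y|\<^sup>-\<^sup>s\<close> has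
  integral zero over \<open>\<epsilon> < |y| < 1\<close>.  By the Lipschitz bound the new integrand is \<open>O(|\<omega>| |y|\<^sup>1\<^sup>-\<^sup>s)\<close> near the
  origin, hence integrable, and dominated convergence applies.
\<close>

lemma truncated_convergent:
  fixes s :: real
  assumes Fm[measurable]: "F \<in> borel_measurable borel"
    and b: "\<And>y. \<bar>F y\<bar> \<le> b" and supp: "\<And>y. norm y \<ge> L \<Longrightarrow> F y = 0"
    and lip: "\<And>y. norm y < 1 \<Longrightarrow> \<bar>F y - F 0\<bar> \<le> K * norm y"
    and s: "1 < s" "s < DIM('a) + 1"
  shows "\<exists>l. (truncated s F \<longlongrightarrow> l) (at_right 0)"
proof -
  let ?B = "ball (0::'a) 1"
  let ?one = "\<lambda>y. indicator ?B y :: real"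
  let ?out = "\<lambda>\<epsilon> (y::'a). indicator {y. \<epsilon> < norm y} y :: real"
  let ?near = "\<lambda>y. ennreal \<bar>\<omega> y\<bar> * ennreal (norm y powr - (s - 1)) * indicator ?B y"
  \<comment> \<open>The second term has vanishing truncated integrals, see \<open>zero\<close> below.\<close>
  define H where "H y = \<omega> y * norm y powr - s * (F y - F 0 * ?one y)" for y
  have [measurable]: "H \<in> borel_measurable borel" unfolding H_def by measurable
  have K: "K \<ge> 0"
  proof -
    obtain e :: 'a where "e \<in> Basis" using nonempty_Basis by blast
    then have "norm ((1/2) *\<^sub>R e) = 1/2" by simp
    then show ?thesis using lip[of "(1/2) *\<^sub>R e"] by (simp add: field_simps) (smt (verit))
  qed
  have Wfin: "(\<integral>\<^sup>+y. ennreal \<bar>\<omega> y\<bar> * indicator ?B y \<partial>lborel) < \<infinity>"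
  proof -
    have "(\<integral>\<^sup>+y. ennreal \<bar>\<omega> y\<bar> * indicator ?B y \<partial>lborel) = (\<integral>\<^sup>+y. ennreal (norm (?one y * \<omega> y)) \<partial>lborel)"
      by (intro nn_integral_cong) (auto simp: indicator_def)
    then show ?thesis using integrable_unit_ball by (simp add: integrable_iff_bounded)
  qed
  have near: "(\<integral>\<^sup>+y. ?near y \<partial>lborel) < \<infinity>"
    using s by (intro nn_integral_homogeneous_powr_finite Wfin) (auto simp: homogeneous)
  have far: "(\<integral>\<^sup>+y. ennreal \<bar>\<omega> y * F y\<bar> \<partial>lborel) < \<infinity>"
    using integrable_kernel_times[OF Fm b supp] by (simp add: integrable_iff_bounded)
  have Hint: "integrable lborel H"
  proof (rule integrableI_bounded)
    have "(\<integral>\<^sup>+y. ennreal (norm (H y)) \<partial>lborel)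
       \<le> (\<integral>\<^sup>+y. ennreal K * (?near y) + ennreal \<bar>\<omega> y * F y\<bar> \<partial>lborel)"
    proof (rule nn_integral_mono)
      fix y
      show "ennreal (norm (H y)) \<le> ennreal K * (?near y) + ennreal \<bar>\<omega> y * F y\<bar>"
      proof (cases "norm y < 1")
        case True
        have "norm y powr - s * norm y = norm y powr - (s - 1)"
        proof (cases "y = 0")
          case False
          then have "norm y powr - s * norm y = norm y powr - s * norm y powr 1" by simp
          also have "\<dots> = norm y powr - (s - 1)" by (simp only: powr_add[symmetric]) simp
          finally show ?thesis .
        qed simp
        then have e: "\<bar>\<omega> y\<bar> * norm y powr - s * (K * norm y) = K * (\<bar>\<omega> y\<bar> * norm y powr - (s - 1))"
          by (simp add: mult_ac) 
        have "norm (H y) = \<bar>\<omega> y\<bar> * norm y powr - s * \<bar>F y - F 0\<bar>"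
          using True by (simp add: H_def abs_mult)
        also have "\<dots> \<le> \<bar>\<omega> y\<bar> * norm y powr - s * (K * norm y)"
          by (intro mult_left_mono lip True) simp
        finally have "norm (H y) \<le> K * (\<bar>\<omega> y\<bar> * norm y powr - (s - 1))" unfolding e .
        then have "ennreal (norm (H y)) \<le> ennreal K * (?near y)"
          using True K by (simp add: ennreal_mult[symmetric] ennreal_leI)
        then show ?thesis by (rule order_trans) simp
      next
        case False
        have "norm y powr - s \<le> 1" using False s powr_mono2'[of "- s" 1 "norm y"] by simp
        then have "\<bar>\<omega> y * F y\<bar> * norm y powr - s \<le> \<bar>\<omega> y * F y\<bar> * 1" by (rule mult_left_mono) simp
        then have "norm (H y) \<le> \<bar>\<omega> y * F y\<bar>" using False by (simp add: H_def abs_mult mult_ac)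
        then have "ennreal (norm (H y)) \<le> ennreal \<bar>\<omega> y * F y\<bar>" by (rule ennreal_leI)
        then show ?thesis by (rule order_trans) simp
      qed
    qed
    also have "\<dots> = ennreal K * (\<integral>\<^sup>+y. ?near y \<partial>lborel) + (\<integral>\<^sup>+y. ennreal \<bar>\<omega> y * F y\<bar> \<partial>lborel)"
      by (subst nn_integral_add) (simp_all add: nn_integral_cmult)
    also have "\<dots> < \<infinity>" using near far by (simp add: ennreal_mult_less_top)
    finally show "(\<integral>\<^sup>+y. ennreal (norm (H y)) \<partial>lborel) < \<infinity>" .
  qed simp
  have oneb: "\<And>y. \<bar>?one y\<bar> \<le> 1" "\<And>y. norm y \<ge> 1 \<Longrightarrow> ?one y = 0" by (auto simp: indicator_def)
  have zero: "truncated s ?one \<epsilon> = 0" if \<epsilon>: "\<epsilon> > 0" for \<epsilon>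
  proof -
    have "(LINT y|lborel. indicator {y. \<epsilon> < norm y \<and> norm y < r} y * (\<omega> y * ?one y)) = 0" for r
    proof -
      have "(LINT y|lborel. indicator {y. \<epsilon> < norm y \<and> norm y < r} y * (\<omega> y * ?one y))
         = (LINT y|lborel. indicator {y. \<epsilon> < norm y \<and> norm y < min r 1} y * \<omega> y)"
        by (intro Bochner_Integration.integral_cong) (auto simp: indicator_def)
      then show ?thesis by (simp only: mean_zero_annulus(2))
    qed
    moreover have "?one \<in> borel_measurable borel" by measurable
    ultimately show ?thesis using truncated_layers(3)[OF _ oneb, where s = s and \<epsilon> = \<epsilon>] s \<epsilon> by simp
  qed
  have rep: "truncated s F \<epsilon> = (LINT y|lborel. ?out \<epsilon> y * H y)" if \<epsilon>: "\<epsilon> > 0" for \<epsilon>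
  proof -
    have i1: "integrable lborel (\<lambda>y. ?out \<epsilon> y * (\<omega> y * norm y powr - s * F y))"
      using truncated_layers(1)[OF Fm b supp _ \<epsilon>, where s = s and L = L] s by simp
    have om: "?one \<in> borel_measurable borel" by measurable
    have i2: "integrable lborel (\<lambda>y. ?out \<epsilon> y * (\<omega> y * norm y powr - s * ?one y))"
      using truncated_layers(1)[OF om oneb _ \<epsilon>, where s = s] s by simp
    have "(LINT y|lborel. ?out \<epsilon> y * H y)
       = (LINT y|lborel. ?out \<epsilon> y * (\<omega> y * norm y powr - s * F y)
            - F 0 * (?out \<epsilon> y * (\<omega> y * norm y powr - s * ?one y)))"
      by (intro Bochner_Integration.integral_cong) (simp_all add: H_def algebra_simps)
    also have "\<dots> = truncated s F \<epsilon> - F 0 * truncated s ?one \<epsilon>"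
      unfolding truncated_def by (subst Bochner_Integration.integral_diff[OF i1 integrable_mult_right[OF i2]]) simp
    finally show ?thesis by (simp add: zero \<epsilon>)
  qed
  have "(truncated s F \<longlongrightarrow> (LINT y|lborel. H y)) (at_right 0)"
  proof (rule tendsto_at_right_sequentially[of 0 1])
    fix S :: "nat \<Rightarrow> real" assume S: "\<And>n. 0 < S n" "S \<longlonglongrightarrow> 0"
    have "(\<lambda>n. LINT y|lborel. indicator {y. S n < norm y} y * H y) \<longlonglongrightarrow> (LINT y|lborel. H y)"
    proof (rule integral_dominated_convergence[where w = "\<lambda>y. norm (H y)"])
      show "integrable lborel (\<lambda>y. norm (H y))" using Hint by simp
      show "AE y in lborel. (\<lambda>n. indicator {y. S n < norm y} y * H y) \<longlonglongrightarrow> H y"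
        using AE_lborel_singleton[of "0::'a"]
      proof eventually_elim
        fix y :: 'a assume "y \<noteq> 0"
        then have "\<forall>\<^sub>F n in sequentially. S n < norm y" using S(2) by (intro order_tendstoD(2)) auto
        then have "\<forall>\<^sub>F n in sequentially. indicator {y. S n < norm y} y * H y = H y"
          by eventually_elim simp
        then show "(\<lambda>n. indicator {y. S n < norm y} y * H y) \<longlonglongrightarrow> H y" by (rule tendsto_eventually)
      qed
      show "AE y in lborel. norm (indicator {y. S n < norm y} y * H y) \<le> norm (H y)" for n
        by (auto simp: indicator_def)
    qed auto
    then show "(\<lambda>n. truncated s F (S n)) \<longlonglongrightarrow> (LINT y|lborel. H y)" by (simp add: rep S)
  qed simp
  then show ?thesis by blast
qed

end

section \<open>Homogeneous extension of functions on the sphere\<close>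

text \<open>
  This transfers the hypotheses on \<open>\<Omega>\<close> to Lebesgue measure.  As \<open>\<Omega>\<close> is only measurable for the
  completed surface measure, \<open>y \<mapsto> \<Omega>(y / |y|)\<close> is replaced by a Borel function \<open>\<omega>\<close> that
  is still homogeneous of degree 0; the exceptional set is a null set because it is the cone over a surface null set.
  The constant \<open>k\<close> comes from the ratio of surface measure to cone measure, so it is the same for all \<open>\<Omega>\<close>.
  Values \<open>M\<close> above \<open>k\<close> times the weak norm are used because the latter may be 0.
\<close>

lemma homogeneous_representative:
  "\<exists>k>0. \<forall>\<Omega> :: real ^ 'n \<Rightarrow> real. \<Omega> \<in> weak_space \<and> mean_zero \<Omega> \<longrightarrow>
     (\<exists>\<omega>. (AE y in lborel. \<Omega> (y /\<^sub>R norm y) = \<omega> y)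
        \<and> (\<forall>M. M > k * enn2real (weak_norm \<Omega>) \<longrightarrow> mean_zero_cone_function \<omega> M))"
proof -
  let ?S = "sphere (0::real^'n) 1" and ?N = "cone_measure :: (real^'n) measure"
  let ?H = "hausdorff_measure (CARD('n) - 1) :: (real^'n) measure"
  obtain k0 where k0: "k0 > 0"
    and HN: "\<And>A. A \<in> sets borel \<Longrightarrow> emeasure ?H (?S \<inter> A) = ennreal k0 * emeasure ?N A"
    using hausdorff_measure_sphere_eq_cone_measure[where 'n = 'n] by blast
  define R where "R = restrict_space ?H ?S"
  have sm: "sphere_measure = completion R" by (simp add: sphere_measure_def R_def)
  have spR: "space R = ?S" by (simp add: R_def space_restrict_space)
  have Rid[measurable]: "(\<lambda>x. x) \<in> R \<rightarrow>\<^sub>M borel" unfolding R_def by (rule measurable_restrict_space1) simp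
  have setsR: "A \<in> sets R \<longleftrightarrow> A \<in> sets borel \<and> A \<subseteq> ?S" for A
    unfolding R_def by (subst sets_restrict_space_iff) auto
  have emR: "emeasure R A = ennreal k0 * emeasure ?N A" if "A \<in> sets borel" "A \<subseteq> ?S" for A
  proof -
    have "emeasure R A = emeasure ?H A" using that unfolding R_def by (intro emeasure_restrict_space) auto
    moreover have "?S \<inter> A = A" using that by auto
    ultimately show ?thesis using HN[OF that(1)] by simp
  qed
  have distrR: "distr R borel (\<lambda>x. x) = density ?N (\<lambda>_. ennreal k0)"
  proof (rule measure_eqI)
    fix A :: "(real^'n) set" assume "A \<in> sets (distr R borel (\<lambda>x. x))"
    then have A: "A \<in> sets borel" by simp
    have "emeasure (distr R borel (\<lambda>x. x)) A = emeasure R (?S \<inter> A)"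
      using A by (subst emeasure_distr) (auto simp: spR Int_commute)
    also have "\<dots> = emeasure ?H (?S \<inter> A)" using A unfolding R_def by (intro emeasure_restrict_space) auto
    also have "\<dots> = ennreal k0 * emeasure ?N A" by (rule HN) fact
    finally show "emeasure (distr R borel (\<lambda>x. x)) A = emeasure (density ?N (\<lambda>_. ennreal k0)) A"
      using A by (simp add: emeasure_density nn_integral_cmult_indicator)
  qed simp
  have Nfin: "emeasure ?N A < \<infinity>" for A
    using finite_measure.emeasure_finite[OF finite_measure_cone_measure, of A] by (simp add: less_top)
  define k where "k = (1 / k0) powr (1 / real CARD('n))"
  have k: "k > 0" "k ^ CARD('n) = 1 / k0" using k0 by (auto simp: k_def powr_powr simp flip: powr_realpow)
  show ?thesis
  proof (intro exI[of _ k] conjI allI impI)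
    fix \<Omega> :: "real ^ 'n \<Rightarrow> real"
    assume "\<Omega> \<in> weak_space \<and> mean_zero \<Omega>"
    then have meas: "\<Omega> \<in> borel_measurable (completion R)" and wfin: "weak_norm \<Omega> < \<infinity>"
      and int: "integrable (completion R) \<Omega>" and mz: "integral\<^sup>L (completion R) \<Omega> = 0"
      by (auto simp: weak_space_def mean_zero_def sm)
    obtain \<Omega>0 where \<Omega>0: "\<Omega>0 \<in> borel_measurable R" and ae0: "AE x in R. \<Omega> x = \<Omega>0 x"
      using completion_ex_borel_measurable_real[OF meas] by blast
    define \<Omega>1 where "\<Omega>1 x = indicator ?S x *\<^sub>R \<Omega>0 x" for x
    have "\<Omega>1 \<in> borel_measurable ?H"
      unfolding \<Omega>1_def using \<Omega>0 unfolding R_def by (subst (asm) borel_measurable_restrict_space_iff) auto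
    then have \<Omega>1[measurable]: "\<Omega>1 \<in> borel_measurable borel"
      by (simp cong: measurable_cong_sets)
    have \<Omega>1R: "\<Omega>1 \<in> borel_measurable R" using measurable_compose[OF Rid \<Omega>1] by simp
    have ae1: "AE x in R. \<Omega> x = \<Omega>1 x"
      using ae0 AE_space by eventually_elim (simp add: \<Omega>1_def spR)
    have ae1': "AE x in completion R. \<Omega> x = \<Omega>1 x" using ae1 by (rule AE_completion)
    have \<Omega>1C: "\<Omega>1 \<in> borel_measurable (completion R)" using \<Omega>1R by (rule measurable_completion)
    define \<omega> where "\<omega> y = \<Omega>1 (sgn y)" for y
    have \<omega>[measurable]: "\<omega> \<in> borel_measurable borel" unfolding \<omega>_def by measurable
    have lev: "sgn -` {x. t < \<bar>\<Omega>1 x\<bar>} = {y. t < \<bar>\<omega> y\<bar>}" for t by (auto simp: \<omega>_def)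
    have ints: "integrable (completion R) \<Omega>1" "integral\<^sup>L (completion R) \<Omega>1 = 0"
      using integrable_cong_AE[OF meas \<Omega>1C ae1'] integral_cong_AE[OF meas \<Omega>1C ae1'] int mz by auto
    then have ints: "integrable R \<Omega>1" "integral\<^sup>L R \<Omega>1 = 0"
      using \<Omega>1R by (simp_all add: integrable_completion integral_completion)
    then have "integrable (density ?N (\<lambda>_. ennreal k0)) \<Omega>1" "integral\<^sup>L (density ?N (\<lambda>_. ennreal k0)) \<Omega>1 = 0"
      unfolding distrR[symmetric] by (simp_all add: integrable_distr_eq integral_distr)
    then have "integrable ?N \<Omega>1" "integral\<^sup>L ?N \<Omega>1 = 0"
      using k0 integrable_density[of \<Omega>1 ?N "\<lambda>_. k0"] by (simp_all add: integral_density)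
    then have "integrable (restrict_space lborel (ball 0 1)) \<omega>" "integral\<^sup>L (restrict_space lborel (ball 0 1)) \<omega> = 0"
      unfolding cone_measure_def \<omega>_def by (simp_all add: integrable_distr_eq integral_distr)
    then have fin1: "integrable lborel (\<lambda>y. indicator (ball 0 1) y * \<omega> y)"
      and fin2: "(LINT y|lborel. indicator (ball 0 1) y * \<omega> y) = 0"
      by (simp_all add: integrable_restrict_space integral_restrict_space)
    have ae: "AE y in lborel. \<Omega> (y /\<^sub>R norm y) = \<omega> y"
    proof -
      obtain Z where Z: "{x \<in> space R. \<Omega> x \<noteq> \<Omega>1 x} \<subseteq> Z" "Z \<in> null_sets R"
        using ae1 by (auto simp: eventually_ae_filter)
      have Zb: "Z \<in> sets borel" "Z \<subseteq> ?S" and "emeasure R Z = 0" using Z(2) setsR by auto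
      then have "emeasure ?N Z = 0" using emR[of Z] k0 by simp
      then have C0: "emeasure lborel (sgn -` Z \<inter> ball 0 1) = 0" using emeasure_cone_measure[OF Zb(1)] by simp
      have Cb: "sgn -` Z \<in> sets borel"
        using measurable_sets[OF borel_measurable_sgn_vector Zb(1)] by simp
      have "emeasure lborel (sgn -` Z \<inter> ball 0 (real i)) = 0" for i
        using emeasure_cone_ball[OF Cb, of "real i"] C0 by (simp add: sgn_pos_scaleR)
      then have "(\<Union>i. sgn -` Z \<inter> ball 0 (real i)) \<in> null_sets lborel"
        using Cb by (intro null_sets_UN) (auto simp: null_sets_def)
      moreover have "(\<Union>i. sgn -` Z \<inter> ball 0 (real i)) = sgn -` Z"
        by (auto simp: reals_Archimedean2)
      ultimately have "sgn -` Z \<in> null_sets lborel" by simp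
      then have "AE y in lborel. y \<notin> sgn -` Z" by (rule AE_not_in)
      then show ?thesis
        using AE_lborel_singleton[of "0::real^'n"]
      proof eventually_elim
        fix y :: "real^'n" assume y: "y \<notin> sgn -` Z" "y \<noteq> 0"
        then have "sgn y \<in> space R" by (simp add: spR norm_sgn)
        then have "\<Omega> (sgn y) = \<Omega>1 (sgn y)" using Z(1) y by auto
        then show "\<Omega> (y /\<^sub>R norm y) = \<omega> y" by (simp add: \<omega>_def sgn_div_norm)
      qed
    qed
    have level: "emeasure lborel ({y. t < \<bar>\<omega> y\<bar>} \<inter> ball 0 1)
        \<le> ennreal (1 / k0 * (enn2real (weak_norm \<Omega>) / t) ^ CARD('n))" if t: "t > 0" for t
    proof -
      let ?M = "enn2real (weak_norm \<Omega>)"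
      define A where "A = {x \<in> ?S. t < \<bar>\<Omega> x\<bar>}"
      define B where "B = {x \<in> ?S. t < \<bar>\<Omega>1 x\<bar>}"
      have Bb: "B \<in> sets borel" "B \<subseteq> ?S" unfolding B_def by auto
      have "emeasure (completion R) A = emeasure (completion R) B"
      proof (rule emeasure_eq_AE)
        show "AE x in completion R. x \<in> A \<longleftrightarrow> x \<in> B" using ae1' by eventually_elim (simp add: A_def B_def)
        have "A = {x \<in> space (completion R). t < \<bar>\<Omega> x\<bar>}" by (simp add: A_def spR)
        then show "A \<in> sets (completion R)"
          using measurable_sets[OF borel_measurable_abs[OF meas], of "{t<..}"]
          by (simp add: vimage_def Int_def conj_commute)
        show "B \<in> sets (completion R)" using Bb setsR by auto
      qed
      also have "\<dots> = emeasure R B" using Bb setsR by simp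
      also have "\<dots> = ennreal k0 * emeasure ?N B" by (rule emR) fact+
      also have "emeasure ?N B = emeasure ?N {x. t < \<bar>\<Omega>1 x\<bar>}"
      proof (rule emeasure_eq_AE)
        show "AE x in ?N. x \<in> B \<longleftrightarrow> x \<in> {x. t < \<bar>\<Omega>1 x\<bar>}"
          using AE_cone_measure_sphere by eventually_elim (simp add: B_def)
      qed (use Bb in auto)
      also have "\<dots> = emeasure lborel ({y. t < \<bar>\<omega> y\<bar>} \<inter> ball 0 1)"
        by (subst emeasure_cone_measure) (simp_all add: lev[symmetric] vimage_def)
      finally have emA: "emeasure (completion R) A = ennreal k0 * emeasure lborel ({y. t < \<bar>\<omega> y\<bar>} \<inter> ball 0 1)" .
      define l where "l = measure lborel ({y. t < \<bar>\<omega> y\<bar>} \<inter> ball 0 1)"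
      have "emeasure lborel ({y. t < \<bar>\<omega> y\<bar>} \<inter> ball 0 1) \<le> emeasure lborel (ball (0::real^'n) 1)"
        by (rule emeasure_mono) auto
      also have "\<dots> < \<infinity>" by (rule emeasure_lborel_ball_finite)
      finally have l: "emeasure lborel ({y. t < \<bar>\<omega> y\<bar>} \<inter> ball 0 1) = ennreal l"
        unfolding l_def by (intro emeasure_eq_ennreal_measure) auto
      have l0: "l \<ge> 0" by (simp add: l_def)
      have mA: "measure sphere_measure A = k0 * l"
        unfolding measure_def sm emA l using k0 l0 by (simp add: ennreal_mult[symmetric])
      have "ennreal (t * measure sphere_measure A powr (1 / real CARD('n))) \<le> weak_norm \<Omega>"
        unfolding weak_norm_def A_def using t by (intro SUP_upper2[of t]) auto
      then have "t * (k0 * l) powr (1 / real CARD('n)) \<le> ?M"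
        using wfin unfolding mA by (metis enn2real_mono enn2real_ennreal infinity_ennreal_def mult_nonneg_nonneg powr_ge_zero t less_imp_le)
      then have "(k0 * l) powr (1 / real CARD('n)) \<le> ?M / t" using t by (simp add: field_simps)
      then have "((k0 * l) powr (1 / real CARD('n))) ^ CARD('n) \<le> (?M / t) ^ CARD('n)"
        by (rule power_mono) simp
      moreover have "((k0 * l) powr (1 / real CARD('n))) ^ CARD('n) = k0 * l"
      proof (cases "l = 0")
        case False
        then have "k0 * l > 0" using k0 l0 by simp
        then have "((k0 * l) powr (1 / real CARD('n))) ^ CARD('n)
            = ((k0 * l) powr (1 / real CARD('n))) powr real CARD('n)"
          by (intro powr_realpow[symmetric]) (use False k0 in simp)
        also have "\<dots> = k0 * l" using \<open>k0 * l > 0\<close> by (simp only: powr_powr) simp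
        finally show ?thesis .
      qed simp
      ultimately have "k0 * l \<le> (?M / t) ^ CARD('n)" by simp
      then have "1 / k0 * (k0 * l) \<le> 1 / k0 * (?M / t) ^ CARD('n)"
        by (rule mult_left_mono) (use k0 in simp)
      then have "l \<le> 1 / k0 * (?M / t) ^ CARD('n)" using k0 by simp
      then show ?thesis unfolding l by (rule ennreal_leI)
    qed
    have "mean_zero_cone_function \<omega> M" if M: "M > k * enn2real (weak_norm \<Omega>)" for M
    proof unfold_locales
      have M0: "k * enn2real (weak_norm \<Omega>) \<ge> 0" using k by simp
      then show "M > 0" using M by linarith
      show "emeasure lborel ({y. t < \<bar>\<omega> y\<bar>} \<inter> ball 0 1) \<le> ennreal ((M / t) ^ DIM(real^'n))" if t: "t > 0" for t
      proof -
        have "1 / k0 * (enn2real (weak_norm \<Omega>) / t) ^ CARD('n) = (k * enn2real (weak_norm \<Omega>) / t) ^ CARD('n)"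
          unfolding k(2)[symmetric] by (simp add: power_mult_distrib power_divide)
        also have "\<dots> \<le> (M / t) ^ CARD('n)"
          using M M0 t by (intro power_mono divide_right_mono) auto
        finally show ?thesis using order_trans[OF level[OF t] ennreal_leI] by simp
      qed
    qed (use \<omega> fin1 fin2 in \<open>auto simp: \<omega>_def sgn_pos_scaleR\<close>)
    with ae show "\<exists>\<omega>. (AE y in lborel. \<Omega> (y /\<^sub>R norm y) = \<omega> y)
        \<and> (\<forall>M. M > k * enn2real (weak_norm \<Omega>) \<longrightarrow> mean_zero_cone_function \<omega> M)" by blast
  qed (use k in simp)
qed

section \<open>Gaussian integrals\<close>

definition mellin :: "real \<Rightarrow> (real \<Rightarrow> real) \<Rightarrow> ennreal" where
  "mellin a \<phi> = (\<integral>\<^sup>+t. ennreal (t powr (a - 1) * \<phi> t) * indicator {0<..} t \<partial>lborel)"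

lemma mellin_dilation:
  assumes [measurable]: "\<phi> \<in> borel_measurable borel" and d: "d > 0" and \<phi>: "\<And>t. t > 0 \<Longrightarrow> \<phi> t \<ge> 0"
  shows "mellin a (\<lambda>t. \<phi> (d * t)) = ennreal (d powr - a) * mellin a \<phi>"
proof -
  have "mellin a \<phi> = ennreal d * (\<integral>\<^sup>+t. ennreal ((d * t) powr (a - 1) * \<phi> (d * t)) * indicator {0<..} (d * t) \<partial>lborel)"
    unfolding mellin_def using d by (subst nn_integral_real_affine[of _ d 0]) auto
  also have "\<dots> = ennreal d * (\<integral>\<^sup>+t. ennreal (d powr (a - 1)) * (ennreal (t powr (a - 1) * \<phi> (d * t)) * indicator {0<..} t) \<partial>lborel)"
  proof (rule arg_cong2[where f = times], rule refl, rule nn_integral_cong)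
    fix t
    show "ennreal ((d * t) powr (a - 1) * \<phi> (d * t)) * indicator {0<..} (d * t)
       = ennreal (d powr (a - 1)) * (ennreal (t powr (a - 1) * \<phi> (d * t)) * indicator {0<..} t)"
      using d \<phi>[of "d * t"]
      by (cases "t > 0") (auto simp: powr_mult ennreal_mult[symmetric] mult.assoc zero_less_mult_iff indicator_def)
  qed
  also have "\<dots> = ennreal d * (ennreal (d powr (a - 1)) * mellin a (\<lambda>t. \<phi> (d * t)))"
    unfolding mellin_def by (subst nn_integral_cmult) auto
  also have "\<dots> = ennreal (d powr a) * mellin a (\<lambda>t. \<phi> (d * t))"
  proof -
    have "d * d powr (a - 1) = d powr a" using d by (simp add: powr_diff)
    then show ?thesis using d by (simp add: mult.assoc[symmetric] ennreal_mult[symmetric])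
  qed
  finally have "ennreal (d powr - a) * mellin a \<phi> = ennreal (d powr - a) * (ennreal (d powr a) * mellin a (\<lambda>t. \<phi> (d * t)))"
    by simp
  also have "\<dots> = mellin a (\<lambda>t. \<phi> (d * t))"
    using d by (simp add: mult.assoc[symmetric] ennreal_mult[symmetric] powr_minus)
  finally show ?thesis by simp
qed

lemma mellin_finite:
  assumes [measurable]: "\<phi> \<in> borel_measurable borel"
    and near: "\<And>t. 0 < t \<Longrightarrow> t \<le> 1 \<Longrightarrow> \<phi> t \<le> C * t powr k" and far: "\<And>t. t > 1 \<Longrightarrow> \<phi> t \<le> C * t powr - l"
    and a: "a + k > 0" "a - l < 0" and C: "C \<ge> 0"
  shows "mellin a \<phi> < \<infinity>"
proof -
  have "mellin a \<phi> \<le> (\<integral>\<^sup>+t. ennreal C * (ennreal (t powr ((a + k) - 1)) * indicator {0..1} t) + ennreal (C / (l - a)) * ennreal (tail_density (l - a) 1 t) \<partial>lborel)"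
    unfolding mellin_def
  proof (rule nn_integral_mono)
    fix t :: real
    show "ennreal (t powr (a - 1) * \<phi> t) * indicator {0<..} t
      \<le> ennreal C * (ennreal (t powr ((a + k) - 1)) * indicator {0..1} t) + ennreal (C / (l - a)) * ennreal (tail_density (l - a) 1 t)"
    proof (cases "t > 0")
      case True
      show ?thesis
      proof (cases "t \<le> 1")
        case le: True
        have "t powr (a - 1) * \<phi> t \<le> t powr (a - 1) * (C * t powr k)" by (intro mult_left_mono near True le) simp
        also have "\<dots> = C * t powr ((a + k) - 1)" using True by (simp add: powr_add[symmetric] mult.left_commute algebra_simps)
        finally have "ennreal (t powr (a - 1) * \<phi> t) \<le> ennreal C * ennreal (t powr ((a + k) - 1))"
          using C by (simp add: ennreal_mult[symmetric] ennreal_leI)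
        then show ?thesis using True le by (simp add: tail_density_def)
      next
        case False
        then have t: "t > 1" by simp
        have "t powr (a - 1) * \<phi> t \<le> t powr (a - 1) * (C * t powr - l)" by (intro mult_left_mono far t) simp
        also have "\<dots> = C * t powr (- (l - a) - 1)" using True by (simp add: powr_add[symmetric] mult.left_commute algebra_simps)
        also have "\<dots> = C / (l - a) * tail_density (l - a) 1 t" using t a by (simp add: tail_density_def)
        finally have "ennreal (t powr (a - 1) * \<phi> t) \<le> ennreal (C / (l - a)) * ennreal (tail_density (l - a) 1 t)"
          using C a by (simp add: ennreal_mult[symmetric] ennreal_leI tail_density_nonneg)
        then show ?thesis using True False by simp
      qed
    qed simp
  qed
  also have "\<dots> = ennreal C * (\<integral>\<^sup>+t. ennreal (t powr ((a + k) - 1)) * indicator {0..1} t \<partial>lborel) + ennreal (C / (l - a)) * (\<integral>\<^sup>+t. ennreal (tail_density (l - a) 1 t) \<partial>lborel)"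
    by (subst nn_integral_add) (simp_all add: nn_integral_cmult)
  also have "\<dots> < \<infinity>"
    using a by (simp add: nn_integral_powr_0_1 nn_integral_tail_density ennreal_mult_less_top)
  finally show ?thesis .
qed

lemma mellin_pos:
  assumes [measurable]: "\<phi> \<in> borel_measurable borel" and \<phi>: "\<And>t. t > 0 \<Longrightarrow> \<phi> t > 0"
  shows "mellin a \<phi> > 0"
proof (rule ccontr)
  let ?f = "\<lambda>t. ennreal (t powr (a - 1) * \<phi> t) * indicator {0<..} t"
  assume "\<not> ?thesis"
  then have "(\<integral>\<^sup>+t. ?f t \<partial>lborel) = 0" by (simp add: mellin_def)
  then have "emeasure lborel {t \<in> space lborel. ?f t \<noteq> 0} = 0" by (subst (asm) nn_integral_0_iff) auto
  moreover have "emeasure lborel {0<..<1::real} \<le> emeasure lborel {t \<in> space lborel. ?f t \<noteq> 0}"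
  proof (rule emeasure_mono)
    have "ennreal (t powr (a - 1) * \<phi> t) > 0" if "t > 0" for t using \<phi>[OF that] that by simp
    then show "{0<..<1} \<subseteq> {t \<in> space lborel. ?f t \<noteq> 0}" by (auto simp: zero_less_iff_neq_zero)
  qed measurable
  ultimately show False by simp
qed

lemma exp_minus_le_power:
  assumes "x > 0" "k > 0"
  shows "exp (- x) \<le> (real k / x) ^ k"
proof -
  have "x / k \<le> exp (x / k)" using exp_ge_add_one_self[of "x / k"] by linarith
  then have "(x / k) ^ k \<le> exp (x / k) ^ k" using assms by (intro power_mono) auto
  also have "exp (x / k) ^ k = exp x" using assms by (simp add: exp_of_nat_mult[symmetric])
  finally have "inverse (exp x) \<le> inverse ((x / k) ^ k)" using assms by (intro le_imp_inverse_le) auto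
  then show ?thesis by (simp add: exp_minus power_divide)
qed

lemma mellin_gauss: "a > 0 \<Longrightarrow> 0 < mellin a (\<lambda>t. exp (- t\<^sup>2 / 2)) \<and> mellin a (\<lambda>t. exp (- t\<^sup>2 / 2)) < \<infinity>"
proof -
  assume a: "a > 0"
  \<comment> \<open>Any \<open>k\<close> with \<open>2k > a\<close> gives enough decay at infinity.\<close>
  define k where "k = nat \<lceil>a\<rceil>"
  have k: "real k \<ge> a" "k > 0" using a by (auto simp: k_def)
  have "mellin a (\<lambda>t. exp (- t\<^sup>2 / 2)) < \<infinity>"
  proof (rule mellin_finite[where k = 0 and l = "2 * real k" and C = "max 1 ((2 * real k) ^ k)"])
    fix t :: real assume t: "t > 1"
    have "exp (- t\<^sup>2 / 2) \<le> (real k / (t\<^sup>2 / 2)) ^ k"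
      using exp_minus_le_power[of "t\<^sup>2 / 2" k] t k by simp
    also have "\<dots> = (2 * real k) ^ k * t powr - (2 * real k)"
    proof -
      have "t powr - (2 * real k) = 1 / t ^ (2 * k)" using t powr_realpow[of t "2 * k"] by (simp add: powr_minus_divide)
      then show ?thesis by (simp add: power_divide power_mult_distrib power_mult[of t 2 k, symmetric])
    qed
    also have "\<dots> \<le> max 1 ((2 * real k) ^ k) * t powr - (2 * real k)" by (intro mult_right_mono) auto
    finally show "exp (- t\<^sup>2 / 2) \<le> max 1 ((2 * real k) ^ k) * t powr - (2 * real k)" .
  next
    fix t :: real assume "0 < t" "t \<le> 1"
    have "exp (- t\<^sup>2 / 2) \<le> 1" by simp
    also have "1 \<le> max 1 ((2 * real k) ^ k) * t powr 0" using \<open>0 < t\<close> by simp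
    finally show "exp (- t\<^sup>2 / 2) \<le> max 1 ((2 * real k) ^ k) * t powr 0" .
  qed (use a k in auto)
  moreover have "mellin a (\<lambda>t. exp (- t\<^sup>2 / 2)) > 0" by (rule mellin_pos) auto
  ultimately show ?thesis by blast
qed

lemma mellin_inverse_gauss:
  assumes a: "a < 0" and b: "b > 0"
  shows "0 < mellin a (\<lambda>t. exp (- b / t\<^sup>2)) \<and> mellin a (\<lambda>t. exp (- b / t\<^sup>2)) < \<infinity>"
proof -
  \<comment> \<open>Any \<open>k\<close> with \<open>2k > -a\<close> compensates the singularity at 0.\<close>
  define k where "k = nat \<lceil>- a\<rceil>"
  have k: "real k \<ge> - a" "k > 0" using a by (auto simp: k_def)
  have "mellin a (\<lambda>t. exp (- b / t\<^sup>2)) < \<infinity>"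
  proof (rule mellin_finite[where k = "2 * real k" and l = 0 and C = "max 1 ((real k / b) ^ k)"])
    fix t :: real assume t: "0 < t" "t \<le> 1"
    have "exp (- b / t\<^sup>2) \<le> (real k / (b / t\<^sup>2)) ^ k"
      using exp_minus_le_power[of "b / t\<^sup>2" k] t k b by simp
    also have "\<dots> = (real k / b) ^ k * t powr (2 * real k)"
    proof -
      have "t powr (2 * real k) = t ^ (2 * k)" using t powr_realpow[of t "2 * k"] by simp
      then show ?thesis by (simp add: power_divide power_mult_distrib power_mult[of t 2 k, symmetric])
    qed
    also have "\<dots> \<le> max 1 ((real k / b) ^ k) * t powr (2 * real k)" by (intro mult_right_mono) auto
    finally show "exp (- b / t\<^sup>2) \<le> max 1 ((real k / b) ^ k) * t powr (2 * real k)" .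
  next
    fix t :: real assume "1 < t"
    have "exp (- b / t\<^sup>2) \<le> 1" using b by simp
    also have "1 \<le> max 1 ((real k / b) ^ k) * t powr - 0" using \<open>1 < t\<close> by simp
    finally show "exp (- b / t\<^sup>2) \<le> max 1 ((real k / b) ^ k) * t powr - 0" .
  qed (use a k in auto)
  moreover have "mellin a (\<lambda>t. exp (- b / t\<^sup>2)) > 0" by (rule mellin_pos) auto
  ultimately show ?thesis by blast
qed

lemma borel_measurable_cis [measurable]: "cis \<in> borel_measurable borel"
  by (intro borel_measurable_continuous_onI continuous_intros)

lemma gaussian_fourier_real:
  "has_bochner_integral lborel (\<lambda>u. cis (w * u) * complex_of_real (exp (- u\<^sup>2 / 2))) (complex_of_real (sqrt (2 * pi) * exp (- w\<^sup>2 / 2)))"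
proof -
  have gi: "integrable lborel (\<lambda>u::real. exp (- u\<^sup>2 / 2))"
  proof -
    have "integrable lborel std_normal_density" by (rule integrable_normal_density) simp
    then have "integrable lborel (\<lambda>u. sqrt (2 * pi) * std_normal_density u)" by simp
    then show ?thesis by (simp add: std_normal_density_def)
  qed
  have int: "integrable lborel (\<lambda>u. cis (w * u) * complex_of_real (exp (- u\<^sup>2 / 2)))"
    by (rule Bochner_Integration.integrable_bound[OF gi]) (auto simp: norm_mult)
  have "char std_normal_distribution w = (LINT u|lborel. std_normal_density u *\<^sub>R iexp (w * u))"
    unfolding char_def by (subst integral_density) auto
  also have "\<dots> = (LINT u|lborel. complex_of_real (1 / sqrt (2 * pi)) * (cis (w * u) * complex_of_real (exp (- u\<^sup>2 / 2))))"
    by (intro Bochner_Integration.integral_cong refl) (simp add: std_normal_density_def scaleR_conv_of_real cis_conv_exp mult_ac)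
  also have "\<dots> = complex_of_real (1 / sqrt (2 * pi)) * (LINT u|lborel. cis (w * u) * complex_of_real (exp (- u\<^sup>2 / 2)))"
    by (rule integral_mult_right_zero)
  finally have "complex_of_real (1 / sqrt (2 * pi)) * (LINT u|lborel. cis (w * u) * complex_of_real (exp (- u\<^sup>2 / 2)))
    = complex_of_real (exp (- w\<^sup>2 / 2))" by (simp add: char_std_normal_distribution)
  then have "complex_of_real (sqrt (2 * pi)) * (complex_of_real (1 / sqrt (2 * pi)) * (LINT u|lborel. cis (w * u) * complex_of_real (exp (- u\<^sup>2 / 2))))
    = complex_of_real (sqrt (2 * pi)) * complex_of_real (exp (- w\<^sup>2 / 2))" by simp
  then have "(LINT u|lborel. cis (w * u) * complex_of_real (exp (- u\<^sup>2 / 2))) = complex_of_real (sqrt (2 * pi) * exp (- w\<^sup>2 / 2))"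
    by (simp add: mult.assoc[symmetric] flip: of_real_mult)
  with int show ?thesis by (simp add: has_bochner_integral_iff)
qed

lemma gaussian_fourier:
  fixes w :: "'a::euclidean_space"
  shows "has_bochner_integral lborel (\<lambda>\<xi>. cis (w \<bullet> \<xi>) * complex_of_real (exp (- (norm \<xi>)\<^sup>2 / 2)))
    (complex_of_real (sqrt (2 * pi) ^ DIM('a) * exp (- (norm w)\<^sup>2 / 2)))"
proof -
  interpret product_sigma_finite "\<lambda>_::'a. lborel :: real measure" ..
  let ?P = "Pi\<^sub>M (Basis :: 'a set) (\<lambda>_. lborel :: real measure)"
  let ?T = "\<lambda>f. \<Sum>b\<in>Basis. f b *\<^sub>R b :: 'a"
  let ?k = "\<lambda>b u. cis ((w \<bullet> b) * u) * complex_of_real (exp (- u\<^sup>2 / 2))"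
  let ?g = "\<lambda>\<xi>. cis (w \<bullet> \<xi>) * complex_of_real (exp (- (norm \<xi>)\<^sup>2 / 2))"
  have nsq: "(norm x)\<^sup>2 = (\<Sum>b\<in>Basis. (x \<bullet> b)\<^sup>2)" for x :: 'a
    unfolding power2_norm_eq_inner using euclidean_inner[of x x] by (simp only: power2_eq_square)
  have prod: "?g (?T f) = (\<Prod>b\<in>Basis. ?k b (f b))" for f
  proof -
    have 1: "w \<bullet> ?T f = (\<Sum>b\<in>Basis. (w \<bullet> b) * f b)" by (simp add: inner_sum_right mult.commute)
    have 2: "(norm (?T f))\<^sup>2 = (\<Sum>b\<in>Basis. (f b)\<^sup>2)" by (simp add: nsq)
    show ?thesis
      unfolding 1 2 by (simp add: prod.distrib cis_conv_exp exp_sum[symmetric] sum_distrib_left sum_negf sum_divide_distrib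
        flip: of_real_prod)
  qed
  have [measurable]: "?T \<in> ?P \<rightarrow>\<^sub>M borel" by measurable
  have gm: "?g \<in> borel_measurable borel"
    by measurable
  have int: "integrable lborel (?k b)" and val: "(LINT u|lborel. ?k b u) = complex_of_real (sqrt (2 * pi) * exp (- (w \<bullet> b)\<^sup>2 / 2))" for b
    using gaussian_fourier_real[of "w \<bullet> b"] by (simp_all add: has_bochner_integral_iff)
  have "integrable ?P (\<lambda>f. \<Prod>b\<in>Basis. ?k b (f b))"
    by (rule product_integrable_prod) (simp, rule int)
  then have i: "integrable lborel ?g"
    by (subst lborel_eq, subst integrable_distr_eq[OF _ gm]) (measurable, simp only: prod)
  have "(LINT \<xi>|lborel. ?g \<xi>) = (LINT f|?P. (\<Prod>b\<in>Basis. ?k b (f b)))"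
    by (subst lborel_eq, subst integral_distr[OF _ gm]) (measurable, simp only: prod)
  also have "\<dots> = (\<Prod>b\<in>Basis. (LINT u|lborel. ?k b u))"
    by (rule product_integral_prod) (simp, rule int)
  also have "\<dots> = complex_of_real (\<Prod>b\<in>Basis. sqrt (2 * pi) * exp (- (w \<bullet> b)\<^sup>2 / 2))"
    by (simp only: val of_real_prod)
  also have "(\<Prod>b\<in>Basis. sqrt (2 * pi) * exp (- (w \<bullet> b)\<^sup>2 / 2)) = sqrt (2 * pi) ^ DIM('a) * exp (- (norm w)\<^sup>2 / 2)"
    by (simp add: prod.distrib exp_sum[symmetric] nsq sum_negf sum_divide_distrib)
  finally show ?thesis using i by (simp add: has_bochner_integral_iff)
qed

lemma scaled_gaussian_fourier:
  fixes v :: "'a::euclidean_space"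
  assumes t: "t > 0"
  shows "integrable lborel (\<lambda>\<xi>::'a. exp (- (t * norm \<xi>)\<^sup>2 / 2))"
    and "(LINT \<xi>|lborel. cis (2 * pi * (v \<bullet> \<xi>)) * complex_of_real (exp (- (t * norm \<xi>)\<^sup>2 / 2)))
      = complex_of_real (sqrt (2 * pi) ^ DIM('a) * t powr - real DIM('a) * exp (- (2 * pi\<^sup>2) * (norm v)\<^sup>2 / t\<^sup>2))"
proof -
  let ?g = "\<lambda>\<xi>. cis (2 * pi * (v \<bullet> \<xi>)) * complex_of_real (exp (- (t * norm \<xi>)\<^sup>2 / 2))"
  have gm: "?g \<in> borel_measurable borel" by measurable
  have "integrable lborel (\<lambda>\<xi>. norm (cis ((0::'a) \<bullet> \<xi>) * complex_of_real (exp (- (norm \<xi>)\<^sup>2 / 2))))"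
    using gaussian_fourier[of "0::'a"] unfolding has_bochner_integral_iff by (intro integrable_norm) blast
  then have "integrable lborel (\<lambda>\<xi>::'a. exp (- (norm \<xi>)\<^sup>2 / 2))" by (simp add: norm_mult)
  then show "integrable lborel (\<lambda>\<xi>::'a. exp (- (t * norm \<xi>)\<^sup>2 / 2))"
    using t lborel_integrable_affine[of "\<lambda>\<xi>::'a. exp (- (norm \<xi>)\<^sup>2 / 2)" t 0] by simp
  define w where "w = (2 * pi / t) *\<^sub>R v"
  have "(LINT \<xi>|lborel. ?g \<xi>) = \<bar>1 / t\<bar> ^ DIM('a) *\<^sub>R (LINT \<xi>|lborel. ?g (0 + (1 / t) *\<^sub>R \<xi>))"
    using t gm by (intro lborel_integral_affine) auto
  also have "(\<lambda>\<xi>. ?g (0 + (1 / t) *\<^sub>R \<xi>)) = (\<lambda>\<xi>. cis (w \<bullet> \<xi>) * complex_of_real (exp (- (norm \<xi>)\<^sup>2 / 2)))"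
    using t by (simp add: w_def fun_eq_iff)
  also have "(LINT \<xi>|lborel. cis (w \<bullet> \<xi>) * complex_of_real (exp (- (norm \<xi>)\<^sup>2 / 2))) = complex_of_real (sqrt (2 * pi) ^ DIM('a) * exp (- (norm w)\<^sup>2 / 2))"
    using gaussian_fourier[of w] by (simp add: has_bochner_integral_iff)
  also have "\<bar>1 / t\<bar> ^ DIM('a) = t powr - real DIM('a)" using t by (simp add: powr_minus_divide powr_realpow power_divide)
  also have "- (norm w)\<^sup>2 / 2 = - (2 * pi\<^sup>2) * (norm v)\<^sup>2 / t\<^sup>2"
    using t by (simp add: w_def power_mult_distrib power_divide)
  finally show "(LINT \<xi>|lborel. ?g \<xi>) = complex_of_real (sqrt (2 * pi) ^ DIM('a) * t powr - real DIM('a) * exp (- (2 * pi\<^sup>2) * (norm v)\<^sup>2 / t\<^sup>2))"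
    by (simp add: scaleR_conv_of_real mult_ac)
qed

section \<open>The normalising constant of the Riesz potential\<close>

lemma gauss_mellin_integral:
  assumes a: "a > 0" and l: "l > 0" and D: "ennreal D = mellin a (\<lambda>t. exp (- t\<^sup>2 / 2))" "D \<ge> 0"
  shows "has_bochner_integral lborel (\<lambda>t. indicator {0<..} t * (t powr (a - 1) * exp (- (t * l)\<^sup>2 / 2))) (D * l powr - a)"
proof (rule has_bochner_integral_nn_integral)
  have "(\<integral>\<^sup>+t. ennreal (indicator {0<..} t * (t powr (a - 1) * exp (- (t * l)\<^sup>2 / 2))) \<partial>lborel)
      = mellin a (\<lambda>t. exp (- (l * t)\<^sup>2 / 2))"
    unfolding mellin_def by (intro nn_integral_cong) (auto simp: indicator_def mult.commute)
  also have "\<dots> = ennreal (l powr - a) * mellin a (\<lambda>t. exp (- t\<^sup>2 / 2))"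
    using l by (intro mellin_dilation[of "\<lambda>t. exp (- t\<^sup>2 / 2)"]) auto
  also have "\<dots> = ennreal (D * l powr - a)"
    unfolding D(1)[symmetric] using D(2) by (simp add: ennreal_mult mult.commute)
  finally show "(\<integral>\<^sup>+t. ennreal (indicator {0<..} t * (t powr (a - 1) * exp (- (t * l)\<^sup>2 / 2))) \<partial>lborel) = ennreal (D * l powr - a)" .
qed (use D in \<open>auto simp: indicator_def\<close>)

lemma inverse_gauss_mellin_integral:
  assumes b: "b > 0" and l: "l > 0" and E: "ennreal E = mellin (- p) (\<lambda>t. exp (- b / t\<^sup>2))" "E \<ge> 0"
  shows "has_bochner_integral lborel (\<lambda>t. indicator {0<..} t * (t powr (- p - 1) * exp (- b * l\<^sup>2 / t\<^sup>2))) (E * l powr - p)"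
proof (rule has_bochner_integral_nn_integral)
  have "(\<integral>\<^sup>+t. ennreal (indicator {0<..} t * (t powr (- p - 1) * exp (- b * l\<^sup>2 / t\<^sup>2))) \<partial>lborel)
      = mellin (- p) (\<lambda>t. exp (- b / (1 / l * t)\<^sup>2))"
    unfolding mellin_def using l by (intro nn_integral_cong) (auto simp: indicator_def power_divide)
  also have "\<dots> = ennreal ((1 / l) powr - (- p)) * mellin (- p) (\<lambda>t. exp (- b / t\<^sup>2))"
    using l by (intro mellin_dilation[of "\<lambda>t. exp (- b / t\<^sup>2)"]) auto
  also have "(1 / l) powr - (- p) = l powr - p" using l by (simp add: powr_minus_divide powr_divide)
  also have "ennreal (l powr - p) * mellin (- p) (\<lambda>t. exp (- b / t\<^sup>2)) = ennreal (E * l powr - p)"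
    unfolding E(1)[symmetric] using E(2) by (simp add: ennreal_mult mult.commute)
  finally show "(\<integral>\<^sup>+t. ennreal (indicator {0<..} t * (t powr (- p - 1) * exp (- b * l\<^sup>2 / t\<^sup>2))) \<partial>lborel) = ennreal (E * l powr - p)" .
qed (use E in \<open>auto simp: indicator_def\<close>)

lemma nn_integral_norm_powr_ball_finite:
  fixes p :: real
  assumes "0 < p" "p < real DIM('a)"
  shows "(\<integral>\<^sup>+y. ennreal (norm (y::'a::euclidean_space) powr - p) * indicator (ball 0 1) y \<partial>lborel) < \<infinity>"
  using nn_integral_homogeneous_powr_finite[of "\<lambda>_::'a. 1" p] emeasure_lborel_ball_finite[of "0::'a" 1] assms by simp

lemma nn_integral_reflect:
  fixes x :: "'a::euclidean_space"
  assumes [measurable]: "f \<in> borel_measurable borel"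
  shows "(\<integral>\<^sup>+y. f (x - y) \<partial>lborel) = (\<integral>\<^sup>+y. f y \<partial>lborel)"
  using nn_integral_lborel_affine[of f "-1" x] by simp

lemma riesz_kernel_integrable:
  fixes g :: "'a::euclidean_space \<Rightarrow> complex" and p :: real
  assumes [measurable]: "g \<in> borel_measurable borel" and gi: "integrable lborel g" and gB: "\<And>y. norm (g y) \<le> B"
    and p: "0 < p" "p < real DIM('a)"
  shows "integrable lborel (\<lambda>y. norm (x - y) powr - p * norm (g y))"
proof (rule integrableI_bounded)
  let ?k = "\<lambda>y. norm (norm (x - y) powr - p * norm (g y))"
  let ?b = "\<lambda>z. ennreal (norm z powr - p) * indicator (ball (0::'a) 1) z"
  have B: "B \<ge> 0" using gB[of 0] norm_ge_zero[of "g 0"] by linarith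
  have "(\<integral>\<^sup>+y. ennreal (?k y) \<partial>lborel)
     \<le> (\<integral>\<^sup>+y. ennreal B * (?b (x - y)) + ennreal (norm (g y)) \<partial>lborel)"
  proof (rule nn_integral_mono)
    fix y
    show "ennreal (?k y)
      \<le> ennreal B * (?b (x - y)) + ennreal (norm (g y))"
    proof (cases "norm (x - y) < 1")
      case True
      have "?k y \<le> B * norm (x - y) powr - p"
        using mult_left_mono[OF gB[of y], of "norm (x - y) powr - p"] by (simp add: mult.commute)
      then have "ennreal (?k y) \<le> ennreal B * (?b (x - y))"
        using True B by (simp add: ennreal_mult[symmetric] ennreal_leI)
      then show ?thesis by (rule order_trans) simp
    next
      case False
      have "norm (x - y) powr - p \<le> 1" using False p powr_mono2'[of "- p" 1 "norm (x - y)"] by simp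
      then have "?k y \<le> norm (g y)"
        using mult_right_mono[of "norm (x - y) powr - p" 1 "norm (g y)"] by simp
      then have "ennreal (?k y) \<le> ennreal (norm (g y))" by (rule ennreal_leI)
      then show ?thesis by (rule order_trans) simp
    qed
  qed
  also have "\<dots> = ennreal B * (\<integral>\<^sup>+y. ?b (x - y) \<partial>lborel) + (\<integral>\<^sup>+y. ennreal (norm (g y)) \<partial>lborel)"
    by (subst nn_integral_add) (auto simp: nn_integral_cmult)
  also have "(\<integral>\<^sup>+y. ?b (x - y) \<partial>lborel)
     = (\<integral>\<^sup>+y. ennreal (norm (y::'a) powr - p) * indicator (ball 0 1) y \<partial>lborel)"
    by (rule nn_integral_reflect[where f = "\<lambda>z. ennreal (norm z powr - p) * indicator (ball 0 1) z"]) measurable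
  also have "ennreal B * (\<integral>\<^sup>+y. ennreal (norm (y::'a) powr - p) * indicator (ball 0 1) y \<partial>lborel) + (\<integral>\<^sup>+y. ennreal (norm (g y)) \<partial>lborel) < \<infinity>"
    using nn_integral_norm_powr_ball_finite[OF p] gi by (simp add: ennreal_mult_less_top integrable_iff_bounded)
  finally show "(\<integral>\<^sup>+y. ennreal (?k y) \<partial>lborel) < \<infinity>" .
qed measurable

text \<open>
  Gaussian subordination.  Both \<open>|\<xi>|\<^sup>-\<^sup>\<alpha>\<close> and \<open>|v|\<^sup>\<alpha>\<^sup>-\<^sup>n\<close> are Mellin integrals, by dilation: the former of
  \<open>exp(-t\<^sup>2|\<xi>|\<^sup>2/2)\<close>, the latter of \<open>t\<^sup>-\<^sup>n exp(-2\<pi>\<^sup>2|v|\<^sup>2/t\<^sup>2)\<close>, and these two functions are Fourier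
  transforms of each other up to a constant.  The constants \<open>D\<close> and \<open>E\<close> are the Mellin
  integrals of the two profiles.
\<close>

lemma riesz_fourier_identity:
  fixes g :: "'a::euclidean_space \<Rightarrow> complex" and x :: 'a and \<alpha> D E :: real
  assumes gm[measurable]: "g \<in> borel_measurable borel" and gi: "integrable lborel g" and gB: "\<And>y. norm (g y) \<le> B"
    and \<alpha>: "0 < \<alpha>" "\<alpha> < real DIM('a)"
  defines "h \<equiv> \<lambda>\<xi>. LINT y|lborel. cis (- 2 * pi * (y \<bullet> \<xi>)) * g y"
  assumes hi: "integrable lborel (\<lambda>\<xi>. norm \<xi> powr - \<alpha> *\<^sub>R h \<xi>)"
    and D: "ennreal D = mellin \<alpha> (\<lambda>t. exp (- t\<^sup>2 / 2))" "D \<ge> 0"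
    and E: "ennreal E = mellin (- (DIM('a) - \<alpha>)) (\<lambda>t. exp (- (2 * pi\<^sup>2) / t\<^sup>2))" "E \<ge> 0"
  shows "complex_of_real D * (LINT \<xi>|lborel. cis (2 * pi * (x \<bullet> \<xi>)) * (norm \<xi> powr - \<alpha> *\<^sub>R h \<xi>))
    = complex_of_real (sqrt (2 * pi) ^ DIM('a) * E) * (LINT y|lborel. norm (x - y) powr - (DIM('a) - \<alpha>) *\<^sub>R g y)"
proof -
  let ?m = "\<lambda>\<xi>. cis (2 * pi * (x \<bullet> \<xi>)) * (norm \<xi> powr - \<alpha> *\<^sub>R h \<xi>)"
  define n where "n = real DIM('a)"
  define C where "C = sqrt (2 * pi) ^ DIM('a)"
  have C: "C > 0" by (simp add: C_def)
  let ?k = "\<lambda>t y. complex_of_real (C * t powr - n * exp (- (2 * pi\<^sup>2) * (norm (x - y))\<^sup>2 / t\<^sup>2))"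
  have [measurable]: "h \<in> borel_measurable borel"
  proof -
    have "(\<lambda>\<xi>. LINT y|lborel. cis (- 2 * pi * (y \<bullet> \<xi>)) * g y) \<in> borel_measurable lborel"
      by (rule lborel.borel_measurable_lebesgue_integral) (simp add: case_prod_beta, measurable)
    then show ?thesis by (simp add: h_def)
  qed
  let ?p = "\<lambda>t l. indicator {0<..} t * (t powr (\<alpha> - 1) * exp (- (t * l)\<^sup>2 / 2)) :: real"
  let ?q = "\<lambda>t l. indicator {0<..} t * (t powr (- (n - \<alpha>) - 1) * exp (- (2 * pi\<^sup>2) * l\<^sup>2 / t\<^sup>2)) :: real"
  have p: "integrable lborel (\<lambda>t. ?p t l)" "(LINT t|lborel. ?p t l) = D * l powr - \<alpha>" if "l > 0" for l
    using gauss_mellin_integral[OF \<alpha>(1) that D] unfolding has_bochner_integral_iff by blast+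
  have q: "integrable lborel (\<lambda>t. ?q t l)" "(LINT t|lborel. ?q t l) = E * l powr - (n - \<alpha>)" if "l > 0" for l
    using inverse_gauss_mellin_integral[OF _ that E] unfolding has_bochner_integral_iff n_def by simp_all
  define I where "I t = (LINT \<xi>|lborel. cis (2 * pi * (x \<bullet> \<xi>)) * h \<xi> * complex_of_real (exp (- (t * norm \<xi>)\<^sup>2 / 2)))" for t
  define w where "w t = complex_of_real (indicator {0<..} t * t powr (\<alpha> - 1))" for t :: real
  \<comment> \<open>Expand \<open>|\<xi>|\<^sup>-\<^sup>\<alpha>\<close> into Gaussians.\<close>
  have step1: "complex_of_real D * (LINT \<xi>|lborel. ?m \<xi>) = (LINT t|lborel. w t * I t)"
  proof -
    let ?f = "\<lambda>\<xi> t. cis (2 * pi * (x \<bullet> \<xi>)) * h \<xi> * complex_of_real (?p t (norm \<xi>))"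
    have fi: "integrable (lborel \<Otimes>\<^sub>M lborel) (\<lambda>(\<xi>, t). ?f \<xi> t)"
    proof (rule lborel_pair.Fubini_integrable)
      show "(\<lambda>(\<xi>, t). ?f \<xi> t) \<in> borel_measurable (lborel \<Otimes>\<^sub>M lborel)" unfolding case_prod_beta by measurable
      show "AE \<xi> in lborel. integrable lborel (\<lambda>t. case (\<xi>, t) of (\<xi>, t) \<Rightarrow> ?f \<xi> t)"
        using AE_lborel_singleton[of "0::'a"]
        by eventually_elim (simp only: case_prod_conv, intro integrable_mult_right integrable_of_real p(1), simp)
      have "AE \<xi> in lborel. D * norm (norm \<xi> powr - \<alpha> *\<^sub>R h \<xi>) = (LINT t|lborel. norm (case (\<xi>, t) of (\<xi>, t) \<Rightarrow> ?f \<xi> t))"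
        using AE_lborel_singleton[of "0::'a"]
      proof eventually_elim
        fix \<xi> :: 'a assume "\<xi> \<noteq> 0"
        have "(LINT t|lborel. norm (case (\<xi>, t) of (\<xi>, t) \<Rightarrow> ?f \<xi> t)) = (LINT t|lborel. norm (h \<xi>) * ?p t (norm \<xi>))"
          by (intro Bochner_Integration.integral_cong refl) (simp add: norm_mult abs_mult del: of_real_mult)
        also have "\<dots> = norm (h \<xi>) * (D * norm \<xi> powr - \<alpha>)"
          using p(2)[of "norm \<xi>"] \<open>\<xi> \<noteq> 0\<close> by (subst integral_mult_right_zero) simp
        finally show "D * norm (norm \<xi> powr - \<alpha> *\<^sub>R h \<xi>) = (LINT t|lborel. norm (case (\<xi>, t) of (\<xi>, t) \<Rightarrow> ?f \<xi> t))"
          by (simp add: mult_ac)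
      qed
      moreover have "integrable lborel (\<lambda>\<xi>. D * norm (norm \<xi> powr - \<alpha> *\<^sub>R h \<xi>))"
        by (intro integrable_mult_right integrable_norm hi)
      moreover have "(\<lambda>\<xi>. LINT t|lborel. norm (case (\<xi>, t) of (\<xi>, t) \<Rightarrow> ?f \<xi> t)) \<in> borel_measurable lborel"
        by (rule lborel.borel_measurable_lebesgue_integral) (simp add: case_prod_beta, measurable)
      ultimately show "integrable lborel (\<lambda>\<xi>. LINT t|lborel. norm (case (\<xi>, t) of (\<xi>, t) \<Rightarrow> ?f \<xi> t))"
        by - (rule integrable_cong_AE_imp)
    qed
    have "complex_of_real D * (LINT \<xi>|lborel. ?m \<xi>)
       = (LINT \<xi>|lborel. complex_of_real D * (?m \<xi>))"
      by (rule integral_mult_right_zero[symmetric])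
    also have "\<dots> = (LINT \<xi>|lborel. LINT t|lborel. ?f \<xi> t)"
    proof (rule integral_cong_AE)
      show "(\<lambda>\<xi>. LINT t|lborel. ?f \<xi> t) \<in> borel_measurable lborel"
        by (rule lborel.borel_measurable_lebesgue_integral) (simp add: case_prod_beta, measurable)
      show "AE \<xi> in lborel. complex_of_real D * (?m \<xi>) = (LINT t|lborel. ?f \<xi> t)"
        using AE_lborel_singleton[of "0::'a"]
      proof eventually_elim
        fix \<xi> :: 'a assume "\<xi> \<noteq> 0"
        have "(LINT t|lborel. ?f \<xi> t) = cis (2 * pi * (x \<bullet> \<xi>)) * h \<xi> * complex_of_real (LINT t|lborel. ?p t (norm \<xi>))"
          by (simp only: integral_mult_right_zero integral_complex_of_real)
        then show "complex_of_real D * (?m \<xi>) = (LINT t|lborel. ?f \<xi> t)"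
          using p(2)[of "norm \<xi>"] \<open>\<xi> \<noteq> 0\<close> by (simp only: zero_less_norm_iff) (simp add: scaleR_conv_of_real mult_ac)
      qed
    qed measurable
    also have "\<dots> = (LINT t|lborel. LINT \<xi>|lborel. ?f \<xi> t)"
      by (rule lborel_pair.Fubini_integral[symmetric, OF fi])
    also have "\<dots> = (LINT t|lborel. w t * I t)"
    proof (intro Bochner_Integration.integral_cong refl)
      fix t :: real
      have "(LINT \<xi>|lborel. ?f \<xi> t) = (LINT \<xi>|lborel. w t * (cis (2 * pi * (x \<bullet> \<xi>)) * h \<xi> * complex_of_real (exp (- (t * norm \<xi>)\<^sup>2 / 2))))"
        by (intro Bochner_Integration.integral_cong refl) (simp add: w_def mult_ac)
      then show "(LINT \<xi>|lborel. ?f \<xi> t) = w t * I t" unfolding I_def by (simp only: integral_mult_right_zero)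
    qed
    finally show ?thesis .
  qed
  \<comment> \<open>Compute each Gaussian mean of the Fourier integral of \<open>g\<close>.\<close>
  have step2: "I t = (LINT y|lborel. g y * ?k t y)" if t: "t > 0" for t
  proof -
    let ?e = "\<lambda>\<xi>::'a. exp (- (t * norm \<xi>)\<^sup>2 / 2)"
    let ?f = "\<lambda>\<xi> y. cis (2 * pi * (x \<bullet> \<xi>)) * complex_of_real (?e \<xi>) * (cis (- 2 * pi * (y \<bullet> \<xi>)) * g y)"
    have fi: "integrable (lborel \<Otimes>\<^sub>M lborel) (\<lambda>(\<xi>, y). ?f \<xi> y)"
    proof (rule lborel_pair.Fubini_integrable)
      show "(\<lambda>(\<xi>, y). ?f \<xi> y) \<in> borel_measurable (lborel \<Otimes>\<^sub>M lborel)" unfolding case_prod_beta by measurable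
      show "AE \<xi> in lborel. integrable lborel (\<lambda>y. case (\<xi>, y) of (\<xi>, y) \<Rightarrow> ?f \<xi> y)"
      proof (rule AE_I2)
        fix \<xi> :: 'a
        have "integrable lborel (\<lambda>y. cis (- 2 * pi * (y \<bullet> \<xi>)) * g y)"
          by (rule Bochner_Integration.integrable_bound[OF gi]) (auto simp: norm_mult)
        then show "integrable lborel (\<lambda>y. case (\<xi>, y) of (\<xi>, y) \<Rightarrow> ?f \<xi> y)"
          unfolding case_prod_conv by (rule integrable_mult_right)
      qed
      have "(LINT y|lborel. norm (case (\<xi>, y) of (\<xi>, y) \<Rightarrow> ?f \<xi> y)) = ?e \<xi> * (LINT y|lborel. norm (g y))" for \<xi>
        by (simp add: norm_mult)
      then show "integrable lborel (\<lambda>\<xi>. LINT y|lborel. norm (case (\<xi>, y) of (\<xi>, y) \<Rightarrow> ?f \<xi> y))"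
        using scaled_gaussian_fourier(1)[OF t, where 'a = 'a] by simp
    qed
    have "I t = (LINT \<xi>|lborel. LINT y|lborel. ?f \<xi> y)"
      unfolding I_def
    proof (intro Bochner_Integration.integral_cong refl)
      fix \<xi> :: 'a
      have "(LINT y|lborel. ?f \<xi> y) = cis (2 * pi * (x \<bullet> \<xi>)) * complex_of_real (?e \<xi>) * h \<xi>"
        unfolding h_def by (rule integral_mult_right_zero)
      then show "cis (2 * pi * (x \<bullet> \<xi>)) * h \<xi> * complex_of_real (?e \<xi>) = (LINT y|lborel. ?f \<xi> y)" by (simp add: mult_ac)
    qed
    also have "\<dots> = (LINT y|lborel. LINT \<xi>|lborel. ?f \<xi> y)"
      by (rule lborel_pair.Fubini_integral[symmetric, OF fi])
    also have "\<dots> = (LINT y|lborel. g y * ?k t y)"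
    proof (intro Bochner_Integration.integral_cong refl)
      fix y
      have "(LINT \<xi>|lborel. ?f \<xi> y) = (LINT \<xi>|lborel. g y * (cis (2 * pi * ((x - y) \<bullet> \<xi>)) * complex_of_real (?e \<xi>)))"
      proof (intro Bochner_Integration.integral_cong refl)
        fix \<xi> :: 'a
        have "cis (2 * pi * ((x - y) \<bullet> \<xi>)) = cis (2 * pi * (x \<bullet> \<xi>)) * cis (- 2 * pi * (y \<bullet> \<xi>))"
          by (simp add: cis_mult inner_diff_left algebra_simps)
        then show "?f \<xi> y = g y * (cis (2 * pi * ((x - y) \<bullet> \<xi>)) * complex_of_real (?e \<xi>))" by (simp add: mult_ac)
      qed
      also have "\<dots> = g y * (LINT \<xi>|lborel. cis (2 * pi * ((x - y) \<bullet> \<xi>)) * complex_of_real (?e \<xi>))"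
        by (rule integral_mult_right_zero)
      also have "\<dots> = g y * ?k t y"
        unfolding C_def n_def scaled_gaussian_fourier(2)[OF t, of "x - y"] ..
      finally show "(LINT \<xi>|lborel. ?f \<xi> y) = g y * ?k t y" .
    qed
    finally show ?thesis .
  qed
  \<comment> \<open>Sum the heat-type kernels to the Riesz kernel.\<close>
  have step3: "(LINT t|lborel. w t * I t) = complex_of_real (C * E) * (LINT y|lborel. norm (x - y) powr - (n - \<alpha>) *\<^sub>R g y)"
  proof -
    let ?f = "\<lambda>y t. complex_of_real C * g y * complex_of_real (?q t (norm (x - y)))"
    have ne: "AE y in lborel. y \<noteq> x" by (rule AE_lborel_singleton)
    have fi: "integrable (lborel \<Otimes>\<^sub>M lborel) (\<lambda>(y, t). ?f y t)"
    proof (rule lborel_pair.Fubini_integrable)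
      show "(\<lambda>(y, t). ?f y t) \<in> borel_measurable (lborel \<Otimes>\<^sub>M lborel)" unfolding case_prod_beta by measurable
      show "AE y in lborel. integrable lborel (\<lambda>t. case (y, t) of (y, t) \<Rightarrow> ?f y t)"
        using ne by eventually_elim (simp only: case_prod_conv, intro integrable_mult_right integrable_of_real q(1), simp)
      have "AE y in lborel. C * E * (norm (x - y) powr - (n - \<alpha>) * norm (g y)) = (LINT t|lborel. norm (case (y, t) of (y, t) \<Rightarrow> ?f y t))"
        using ne
      proof eventually_elim
        fix y assume "y \<noteq> x"
        have "(LINT t|lborel. norm (case (y, t) of (y, t) \<Rightarrow> ?f y t)) = (LINT t|lborel. (C * norm (g y)) * ?q t (norm (x - y)))"
          using C by (intro Bochner_Integration.integral_cong refl) (simp add: norm_mult abs_mult del: of_real_mult)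
        also have "\<dots> = (C * norm (g y)) * (E * norm (x - y) powr - (n - \<alpha>))"
          using q(2)[of "norm (x - y)"] \<open>y \<noteq> x\<close> by (subst integral_mult_right_zero) simp
        finally show "C * E * (norm (x - y) powr - (n - \<alpha>) * norm (g y)) = (LINT t|lborel. norm (case (y, t) of (y, t) \<Rightarrow> ?f y t))"
          by (simp add: mult_ac)
      qed
      moreover have "integrable lborel (\<lambda>y. C * E * (norm (x - y) powr - (n - \<alpha>) * norm (g y)))"
        using \<alpha> by (intro integrable_mult_right riesz_kernel_integrable[OF gm gi gB]) (auto simp: n_def)
      moreover have "(\<lambda>y. LINT t|lborel. norm (case (y, t) of (y, t) \<Rightarrow> ?f y t)) \<in> borel_measurable lborel"
        by (rule lborel.borel_measurable_lebesgue_integral) (simp add: case_prod_beta, measurable)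
      ultimately show "integrable lborel (\<lambda>y. LINT t|lborel. norm (case (y, t) of (y, t) \<Rightarrow> ?f y t))"
        by - (rule integrable_cong_AE_imp)
    qed
    have "(LINT t|lborel. w t * I t) = (LINT t|lborel. LINT y|lborel. ?f y t)"
    proof (intro Bochner_Integration.integral_cong refl)
      fix t :: real
      show "w t * I t = (LINT y|lborel. ?f y t)"
      proof (cases "t > 0")
        case True
        have e: "complex_of_real (t powr - n) * complex_of_real (t powr (\<alpha> - 1)) = complex_of_real (t powr (\<alpha> - n - 1))"
          by (simp only: of_real_mult[symmetric] powr_add[symmetric]) (simp add: algebra_simps)
        have "w t * I t = (LINT y|lborel. w t * (g y * ?k t y))"
          unfolding step2[OF True] by (rule integral_mult_right_zero[symmetric])
        also have "\<dots> = (LINT y|lborel. ?f y t)"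
          using True by (intro Bochner_Integration.integral_cong refl) (simp add: w_def e mult_ac)
        finally show ?thesis .
      qed (simp add: w_def)
    qed
    also have "\<dots> = (LINT y|lborel. LINT t|lborel. ?f y t)"
      by (rule lborel_pair.Fubini_integral[OF fi])
    also have "\<dots> = (LINT y|lborel. complex_of_real (C * E) * (norm (x - y) powr - (n - \<alpha>) *\<^sub>R g y))"
    proof (rule integral_cong_AE)
      show "(\<lambda>y. LINT t|lborel. ?f y t) \<in> borel_measurable lborel"
        by (rule lborel.borel_measurable_lebesgue_integral) (simp add: case_prod_beta, measurable)
      show "AE y in lborel. (LINT t|lborel. ?f y t) = complex_of_real (C * E) * (norm (x - y) powr - (n - \<alpha>) *\<^sub>R g y)"
        using ne
      proof eventually_elim
        fix y assume "y \<noteq> x"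
        have "(LINT t|lborel. ?f y t) = complex_of_real C * g y * complex_of_real (LINT t|lborel. ?q t (norm (x - y)))"
          by (simp only: integral_mult_right_zero integral_complex_of_real)
        then show "(LINT t|lborel. ?f y t) = complex_of_real (C * E) * (norm (x - y) powr - (n - \<alpha>) *\<^sub>R g y)"
          using q(2)[of "norm (x - y)"] \<open>y \<noteq> x\<close> by (simp add: scaleR_conv_of_real mult_ac)
      qed
    qed measurable
    also have "\<dots> = complex_of_real (C * E) * (LINT y|lborel. norm (x - y) powr - (n - \<alpha>) *\<^sub>R g y)"
      by (rule integral_mult_right_zero)
    finally show ?thesis .
  qed
  show ?thesis using step1 step3 by (simp add: C_def n_def)
qed

lemma borel_representative_complex:
  fixes g :: "'a::euclidean_space \<Rightarrow> complex"
  assumes "g \<in> borel_measurable lebesgue" and B: "\<And>y. norm (g y) \<le> B"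
  obtains g' where "g' \<in> borel_measurable borel" "AE y in lborel. g y = g' y" "\<And>y. norm (g' y) \<le> B"
proof -
  have "(\<lambda>y. Re (g y)) \<in> borel_measurable lebesgue" "(\<lambda>y. Im (g y)) \<in> borel_measurable lebesgue"
    using assms(1) by measurable
  then obtain r i where r: "r \<in> borel_measurable lborel" "AE y in lborel. Re (g y) = r y"
    and i: "i \<in> borel_measurable lborel" "AE y in lborel. Im (g y) = i y"
    using completion_ex_borel_measurable_real by metis
  have [measurable]: "r \<in> borel_measurable borel" "i \<in> borel_measurable borel" using r i by simp_all
  \<comment> \<open>Cutting off where the bound fails changes \<open>g\<close> on a null set only.\<close>
  define g' where "g' y = (if norm (Complex (r y) (i y)) \<le> B then Complex (r y) (i y) else 0)" for y
  have B0: "B \<ge> 0" using B[of 0] norm_ge_zero[of "g 0"] by linarith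
  show ?thesis
  proof
    show "g' \<in> borel_measurable borel" unfolding g'_def Complex_eq by measurable
    show "norm (g' y) \<le> B" for y using B0 by (simp add: g'_def)
    show "AE y in lborel. g y = g' y"
      using r(2) i(2)
    proof eventually_elim
      fix y assume "Re (g y) = r y" "Im (g y) = i y"
      then have "g y = Complex (r y) (i y)" by (simp add: complex_eq_iff)
      then show "g y = g' y" using B[of y] by (simp add: g'_def)
    qed
  qed
qed

text \<open>
  Lebesgue measure is complete.
\<close>

lemma borel_measurable_lebesgue_AE:
  fixes f f' :: "'a::euclidean_space \<Rightarrow> 'b::{banach,second_countable_topology}"
  assumes f': "f' \<in> borel_measurable borel" and ae: "AE y in lborel. f y = f' y"
  shows "f \<in> borel_measurable lebesgue"
proof (rule measurableI)
  fix A :: "'b set" assume "A \<in> sets borel"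
  then have "f' -` A \<in> sets lebesgue" using measurable_sets[OF f', of A] by simp
  moreover have "AE y in lebesgue. y \<in> f' -` A \<longleftrightarrow> y \<in> f -` A"
    using AE_completion[OF ae] by eventually_elim simp
  ultimately have "f -` A \<in> sets lebesgue"
    by - (rule completion.in_sets_AE, assumption, assumption, simp)
  then show "f -` A \<inter> space lebesgue \<in> sets lebesgue" by simp
qed simp

lemma lebesgue_integral_eq_lborel:
  fixes f f' :: "'a::euclidean_space \<Rightarrow> 'b::{banach,second_countable_topology}"
  assumes f': "f' \<in> borel_measurable borel" and ae: "AE y in lborel. f y = f' y"
  shows "integral\<^sup>L lebesgue f = integral\<^sup>L lborel f'" "integrable lebesgue f \<longleftrightarrow> integrable lborel f'"
proof -
  have f: "f \<in> borel_measurable lebesgue" using f' ae by (rule borel_measurable_lebesgue_AE)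
  have f'': "f' \<in> borel_measurable lebesgue" using f' by (intro measurable_completion) simp
  have ae': "AE y in lebesgue. f y = f' y" using ae by (rule AE_completion)
  show "integral\<^sup>L lebesgue f = integral\<^sup>L lborel f'"
    using integral_cong_AE[OF f f'' ae'] f' by (simp add: integral_completion)
  show "integrable lebesgue f \<longleftrightarrow> integrable lborel f'"
    using integrable_cong_AE[OF f f'' ae'] f' by (simp add: integrable_completion)
qed

lemma ex_riesz_const:
  assumes \<alpha>: "0 < \<alpha>" "\<alpha> < real CARD('n)"
  shows "\<exists>\<kappa>. is_riesz_const TYPE('n::finite) \<alpha> \<kappa>"
proof -
  let ?n = "real CARD('n)"
  define D where "D = enn2real (mellin \<alpha> (\<lambda>t. exp (- t\<^sup>2 / 2)))"
  define E where "E = enn2real (mellin (- (?n - \<alpha>)) (\<lambda>t. exp (- (2 * pi\<^sup>2) / t\<^sup>2)))"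
  have D: "ennreal D = mellin \<alpha> (\<lambda>t. exp (- t\<^sup>2 / 2))" "D > 0"
    using mellin_gauss[OF \<alpha>(1)] by (auto simp: D_def enn2real_positive_iff)
  have E: "ennreal E = mellin (- (?n - \<alpha>)) (\<lambda>t. exp (- (2 * pi\<^sup>2) / t\<^sup>2))" "E > 0"
    using mellin_inverse_gauss[of "- (?n - \<alpha>)" "2 * pi\<^sup>2"] \<alpha> by (auto simp: E_def enn2real_positive_iff)
  define C where "C = sqrt (2 * pi) ^ CARD('n)"
  have C: "C > 0" by (simp add: C_def)
  have "is_riesz_const TYPE('n) \<alpha> (C * E / D)"
    unfolding is_riesz_const_def
  proof (intro conjI allI impI)
    show "C * E / D > 0" using C D E by simp
    fix g :: "real ^ 'n \<Rightarrow> complex" and x :: "real ^ 'n"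
    assume "integrable lebesgue g \<and> bounded (range g) \<and> integrable lebesgue (riesz_multiplier \<alpha> g)"
    then have gi: "integrable lebesgue g" and bd: "bounded (range g)" and mi: "integrable lebesgue (riesz_multiplier \<alpha> g)"
      by auto
    have gm: "g \<in> borel_measurable lebesgue" using gi by simp
    obtain B where B: "\<And>y. norm (g y) \<le> B" using bd by (auto simp: bounded_iff)
    obtain g' where g'[measurable]: "g' \<in> borel_measurable borel" and ae: "AE y in lborel. g y = g' y" and B': "\<And>y. norm (g' y) \<le> B"
      using borel_representative_complex[OF gm B] by blast
    have gi': "integrable lborel g'" using lebesgue_integral_eq_lborel(2)[OF g' ae] gi by simp
    define h where "h \<xi> = (LINT y|lborel. cis (- 2 * pi * (y \<bullet> \<xi>)) * g' y)" for \<xi>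
    have four: "fourier g \<xi> = h \<xi>" for \<xi>
      unfolding fourier_def h_def
    proof (rule lebesgue_integral_eq_lborel)
      show "AE y in lborel. cis (- 2 * pi * (y \<bullet> \<xi>)) * g y = cis (- 2 * pi * (y \<bullet> \<xi>)) * g' y"
        using ae by eventually_elim simp
    qed measurable
    have hm[measurable]: "h \<in> borel_measurable borel"
    proof -
      have "(\<lambda>\<xi>. LINT y|lborel. cis (- 2 * pi * (y \<bullet> \<xi>)) * g' y) \<in> borel_measurable lborel"
        by (rule lborel.borel_measurable_lebesgue_integral) (simp add: case_prod_beta, measurable)
      then show ?thesis by (simp add: h_def[abs_def])
    qed
    have mult: "riesz_multiplier \<alpha> g = (\<lambda>\<xi>. norm \<xi> powr - \<alpha> *\<^sub>R h \<xi>)"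
      by (simp add: riesz_multiplier_def fun_eq_iff four)
    have mi': "integrable lborel (\<lambda>\<xi>. norm \<xi> powr - \<alpha> *\<^sub>R h \<xi>)"
      using mi unfolding mult by (subst (asm) integrable_completion) measurable
    have inv: "inverse_fourier (riesz_multiplier \<alpha> g) x = (LINT \<xi>|lborel. cis (2 * pi * (x \<bullet> \<xi>)) * (norm \<xi> powr - \<alpha> *\<^sub>R h \<xi>))"
      unfolding inverse_fourier_def mult by (rule integral_completion) measurable
    have riesz: "riesz_integral \<alpha> g x = (LINT y|lborel. norm (x - y) powr - (?n - \<alpha>) *\<^sub>R g' y)"
      unfolding riesz_integral_def
    proof (rule lebesgue_integral_eq_lborel)
      show "AE y in lborel. (1 / norm (x - y) powr (?n - \<alpha>)) *\<^sub>R g y = norm (x - y) powr - (?n - \<alpha>) *\<^sub>R g' y"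
        using ae by eventually_elim (simp only: powr_minus_divide)
    qed measurable
    have dim: "DIM(real^'n) = CARD('n)" by simp
    have "complex_of_real D * inverse_fourier (riesz_multiplier \<alpha> g) x = complex_of_real (C * E) * riesz_integral \<alpha> g x"
      unfolding inv riesz C_def
      using riesz_fourier_identity[OF g' gi' B', of \<alpha> D E x, unfolded dim, folded h_def, OF \<alpha> mi' D(1) _ E(1)] D E
      by (simp add: less_imp_le)
    then have "inverse_fourier (riesz_multiplier \<alpha> g) x = complex_of_real (C * E) * riesz_integral \<alpha> g x / complex_of_real D"
      using D by (simp add: field_simps)
    then show "(C * E / D) *\<^sub>R riesz_integral \<alpha> g x = inverse_fourier (riesz_multiplier \<alpha> g) x"
      by (simp add: scaleR_conv_of_real)
  qed
  then show ?thesis by blast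
qed

lemma riesz_const_pos:
  assumes \<alpha>: "0 < \<alpha>" "\<alpha> < real CARD('n)"
  shows "riesz_const TYPE('n::finite) \<alpha> > 0"
  using someI_ex[OF ex_riesz_const[OF assms]] unfolding riesz_const_def is_riesz_const_def by blast

section \<open>The pointwise estimate\<close>

lemma Cc_smooth_has_gradient:
  fixes f :: "real ^ 'n \<Rightarrow> real"
  assumes "f \<in> Cc_smooth"
  shows "(f has_derivative (\<lambda>h. gradient f y \<bullet> h)) (at y)" and "continuous_on UNIV (gradient f)"
proof -
  have "C_k 1 f" using assms by (simp add: Cc_smooth_def)
  then have diff: "\<And>y. f differentiable (at y)" and cont: "\<And>i. continuous_on UNIV (partial_deriv i f)"
    by auto
  have D: "(f has_derivative frechet_derivative f (at y)) (at y)"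
    using diff by (simp add: frechet_derivative_works)
  then have lin: "linear (frechet_derivative f (at y))" by (rule has_derivative_linear)
  have "frechet_derivative f (at y) = (\<lambda>h. gradient f y \<bullet> h)"
  proof
    fix h :: "real ^ 'n"
    have "frechet_derivative f (at y) h = frechet_derivative f (at y) (\<Sum>i\<in>UNIV. (h $ i) *\<^sub>R axis i 1)"
      using basis_expansion[of h] by (simp add: scalar_mult_eq_scaleR)
    also have "\<dots> = (\<Sum>i\<in>UNIV. (h $ i) * frechet_derivative f (at y) (axis i 1))"
      by (simp add: linear_sum[OF lin] linear_scale[OF lin])
    also have "\<dots> = gradient f y \<bullet> h"
      by (simp add: inner_vec_def gradient_def partial_deriv_def mult.commute)
    finally show "frechet_derivative f (at y) h = gradient f y \<bullet> h" .
  qed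
  with D show "(f has_derivative (\<lambda>h. gradient f y \<bullet> h)) (at y)" by simp
  show "continuous_on UNIV (gradient f)"
    unfolding gradient_def[abs_def] using cont by (intro continuous_on_vec_lambda) auto
qed

lemma Cc_smooth_support:
  fixes f :: "real ^ 'n \<Rightarrow> real"
  assumes "f \<in> Cc_smooth"
  obtains L where "L > 0" "\<And>y. norm y \<ge> L \<Longrightarrow> f y = 0" "\<And>y. norm y \<ge> L \<Longrightarrow> gradient f y = 0"
proof -
  let ?S = "closure {x. f x \<noteq> 0}"
  have "bounded ?S" using assms by (simp add: Cc_smooth_def compact_imp_bounded)
  then obtain L where L: "L > 0" "\<And>y. y \<in> ?S \<Longrightarrow> norm y \<le> L" by (auto simp: bounded_pos)
  have out: "y \<notin> ?S" if "norm y \<ge> L + 1" for y using L(2)[of y] that by auto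
  show ?thesis
  proof (rule that[of "L + 1"])
    show "f y = 0" if "norm y \<ge> L + 1" for y
      using out[OF that] closure_subset[of "{x. f x \<noteq> 0}"] by auto
    show "gradient f y = 0" if "norm y \<ge> L + 1" for y
    proof -
      have "(f has_derivative (\<lambda>h. gradient f y \<bullet> h)) (at y)" by (rule Cc_smooth_has_gradient[OF assms])
      moreover have "(f has_derivative (\<lambda>h. 0)) (at y)"
      proof (rule has_derivative_transform_within_open[of "\<lambda>_. 0" _ _ _ "- ?S"])
        show "0 = f z" if "z \<in> - ?S" for z using that closure_subset[of "{x. f x \<noteq> 0}"] by auto
      qed (use out[OF that] in auto)
      ultimately have "(\<lambda>h. gradient f y \<bullet> h) = (\<lambda>h. 0)" by (rule has_derivative_unique)
      then have "gradient f y \<bullet> gradient f y = 0" by (rule fun_cong)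
      then show ?thesis by simp
    qed
  qed (use L in simp)
qed

lemma continuous_compact_support_bounded:
  fixes h :: "'a::euclidean_space \<Rightarrow> 'b::real_normed_vector"
  assumes "continuous_on UNIV h" "\<And>y. norm y \<ge> L \<Longrightarrow> h y = 0"
  obtains K where "K \<ge> 0" "\<And>y. norm (h y) \<le> K"
proof -
  have "compact (h ` cball 0 L)" by (intro compact_continuous_image continuous_on_subset[OF assms(1)]) auto
  then obtain K where K: "K > 0" "\<And>z. z \<in> h ` cball 0 L \<Longrightarrow> norm z \<le> K" using compact_imp_bounded bounded_pos by metis
  show ?thesis
  proof
    show "norm (h y) \<le> K" for y using K assms(2)[of y] by (cases "norm y \<ge> L") auto
  qed (use K in simp)
qed

lemma riesz_integral_gradient:
  fixes f :: "real ^ 'n \<Rightarrow> real"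
  assumes f: "f \<in> Cc_smooth" and \<alpha>: "0 < \<alpha>" "\<alpha> < real CARD('n)"
  shows "(\<integral>\<^sup>+z. ennreal (norm (gradient f (x - z)) * norm z powr - (real CARD('n) - \<alpha>)) \<partial>lborel)
      = ennreal (riesz_integral \<alpha> (\<lambda>y. norm (gradient f y)) x)"
    and "riesz_integral \<alpha> (\<lambda>y. norm (gradient f y)) x \<ge> 0"
proof -
  let ?p = "real CARD('n) - \<alpha>"
  let ?g = "\<lambda>y. complex_of_real (norm (gradient f y))"
  have gc: "continuous_on UNIV (gradient f)" by (rule Cc_smooth_has_gradient[OF f])
  then have gm[measurable]: "gradient f \<in> borel_measurable borel" by (rule borel_measurable_continuous_onI)
  obtain L where L: "L > 0" "\<And>y. norm y \<ge> L \<Longrightarrow> gradient f y = 0" using Cc_smooth_support[OF f] by metis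
  obtain K where K: "K \<ge> 0" "\<And>y. norm (gradient f y) \<le> K"
    using continuous_compact_support_bounded[OF gc L(2)] by blast
  have "integrable lborel ?g"
  proof (rule Bochner_Integration.integrable_bound)
    show "integrable lborel (\<lambda>y::real^'n. K * indicator (ball 0 L) y)"
      using emeasure_lborel_ball_finite[of "0::real^'n" L] by (intro integrable_mult_right) (auto simp: integrable_indicator_iff)
    show "AE y in lborel. norm (?g y) \<le> norm (K * indicator (ball 0 L) y :: real)"
      using K L(2) by (intro AE_I2) (auto simp: indicator_def not_less)
  qed measurable
  then have int: "integrable lborel (\<lambda>y. norm (x - y) powr - ?p * norm (?g y))"
    using K \<alpha> by (intro riesz_kernel_integrable[where B = K]) auto
  let ?k = "\<lambda>y. norm (gradient f y) * norm (x - y) powr - ?p"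
  have int': "integrable lborel ?k" using int by (simp add: mult.commute)
  have R: "riesz_integral \<alpha> (\<lambda>y. norm (gradient f y)) x = (LINT y|lborel. ?k y)"
    unfolding riesz_integral_def
  proof (rule lebesgue_integral_eq_lborel)
    show "AE y in lborel. (1 / norm (x - y) powr ?p) *\<^sub>R norm (gradient f y) = ?k y"
      unfolding powr_minus_divide by (intro AE_I2) simp
  qed measurable
  show "riesz_integral \<alpha> (\<lambda>y. norm (gradient f y)) x \<ge> 0" unfolding R by (rule Bochner_Integration.integral_nonneg) simp
  have "(\<integral>\<^sup>+z. ennreal (norm (gradient f (x - z)) * norm z powr - ?p) \<partial>lborel) = (\<integral>\<^sup>+z. ennreal (?k (x - z)) \<partial>lborel)"
    by simp
  also have "\<dots> = (\<integral>\<^sup>+y. ennreal (?k y) \<partial>lborel)"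
    by (rule nn_integral_reflect[where f = "\<lambda>y. ennreal (?k y)"]) measurable
  also have "\<dots> = ennreal (LINT y|lborel. ?k y)"
    by (rule nn_integral_eq_integral[OF int']) simp
  finally show "(\<integral>\<^sup>+z. ennreal (norm (gradient f (x - z)) * norm z powr - ?p) \<partial>lborel)
      = ennreal (riesz_integral \<alpha> (\<lambda>y. norm (gradient f y)) x)" unfolding R .
qed

text \<open>
  The results on truncated integrals, applied to \<open>F(y) = f(x - y)\<close> with majorant \<open>G(y) = |\<nabla>f(x - y)|\<close>.
\<close>

lemma rough_op_estimate:
  fixes \<Omega> f :: "real ^ 'n \<Rightarrow> real" and x :: "real ^ 'n"
  assumes \<alpha>: "0 < \<alpha>" "\<alpha> < real CARD('n)"
    and \<omega>: "mean_zero_cone_function \<omega> M"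
    and rep: "AE y in lborel. \<Omega> (y /\<^sub>R norm y) = \<omega> y"
    and f: "f \<in> Cc_smooth"
  defines "n \<equiv> real CARD('n)"
  shows "(truncated_op \<Omega> \<alpha> f x \<longlongrightarrow> rough_op \<Omega> \<alpha> f x) (at_right 0)"
    and "\<bar>rough_op \<Omega> \<alpha> f x\<bar> \<le> poincare_const CARD('n) * M * ((n + 1 - \<alpha>) / (n - \<alpha>)) * riesz_integral \<alpha> (\<lambda>y. norm (gradient f y)) x"
proof -
  interpret mean_zero_cone_function \<omega> M by (rule \<omega>)
  define s where "s = n + 1 - \<alpha>"
  have s: "1 < s" "s < n + 1" using \<alpha> by (auto simp: s_def n_def)
  define F where "F y = f (x - y)" for y
  define G where "G y = norm (gradient f (x - y))" for y
  have df: "(f has_derivative (\<lambda>h. gradient f y \<bullet> h)) (at y)" for y by (rule Cc_smooth_has_gradient[OF f])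
  have gc: "continuous_on UNIV (gradient f)" by (rule Cc_smooth_has_gradient[OF f])
  have fc: "continuous_on UNIV f" using df has_derivative_continuous by (blast intro: continuous_at_imp_continuous_on)
  obtain L where L: "L > 0" "\<And>y. norm y \<ge> L \<Longrightarrow> f y = 0" "\<And>y. norm y \<ge> L \<Longrightarrow> gradient f y = 0"
    using Cc_smooth_support[OF f] by blast
  obtain b where b: "\<And>y. norm (f y) \<le> b" using continuous_compact_support_bounded[OF fc L(2)] by blast
  obtain K where K: "K \<ge> 0" "\<And>y. norm (gradient f y) \<le> K" using continuous_compact_support_bounded[OF gc L(3)] by blast
  have dF: "(F has_derivative (\<lambda>h. gradient f (x - y) \<bullet> (- h))) (at y)" for y
    unfolding F_def
    by (rule has_derivative_compose[of "\<lambda>y. x - y" "\<lambda>h. - h" y UNIV, OF _ df]) (auto intro!: derivative_eq_intros)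
  have bF: "\<bar>gradient f (x - y) \<bullet> (- h)\<bar> \<le> G y * norm h" for y h
    using Cauchy_Schwarz_ineq2[of "gradient f (x - y)" h] by (simp add: G_def)
  have cG: "continuous_on UNIV G" unfolding G_def
    by (intro continuous_intros continuous_on_compose2[OF gc]) auto
  have G0: "G y \<ge> 0" for y by (simp add: G_def)
  have Fc: "continuous_on UNIV F" unfolding F_def by (intro continuous_on_compose2[OF fc] continuous_intros) auto
  have Fm[measurable]: "F \<in> borel_measurable borel" using Fc by (rule borel_measurable_continuous_onI)
  have Fb: "\<bar>F y\<bar> \<le> b" for y using b[of "x - y"] by (simp add: F_def)
  have Fsupp: "F y = 0" if "norm y \<ge> L + norm x" for y
    using that norm_triangle_ineq2[of y x] by (auto simp: F_def norm_minus_commute intro!: L(2))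
  have lip: "\<bar>F y - F 0\<bar> \<le> K * norm y" for y
  proof -
    have "ennreal \<bar>F y - F 0\<bar> \<le> (\<integral>\<^sup>+t. ennreal (G (0 + t *\<^sub>R (y - 0)) * norm (y - 0)) * indicator {0..1} t \<partial>lborel)"
      by (rule increment_le_segment_integral[OF dF bF cG G0])
    also have "\<dots> \<le> (\<integral>\<^sup>+t. ennreal (K * norm y) * indicator {0..1::real} t \<partial>lborel)"
      using K by (intro nn_integral_mono mult_right_mono ennreal_leI) (auto simp: G_def intro!: mult_right_mono)
    also have "\<dots> = ennreal (K * norm y)" by (simp add: nn_integral_cmult_indicator)
    finally show ?thesis using K by (simp add: ennreal_le_iff)
  qed
  have op: "truncated_op \<Omega> \<alpha> f x \<epsilon> = truncated s F \<epsilon>" for \<epsilon>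
    unfolding truncated_op_def truncated_def set_lebesgue_integral_def
  proof (rule lebesgue_integral_eq_lborel)
    show "AE y in lborel. indicator {y. \<epsilon> < norm y} y *\<^sub>R (\<Omega> (y /\<^sub>R norm y) / norm y powr (real CARD('n) + 1 - \<alpha>) * f (x - y))
       = indicator {y. \<epsilon> < norm y} y * (\<omega> y * norm y powr - s * F y)"
      using rep by eventually_elim (simp add: F_def powr_minus_divide[of _ s] s_def[symmetric] n_def[symmetric])
  qed measurable
  then have op: "truncated_op \<Omega> \<alpha> f x = truncated s F" by (rule ext)
  obtain l where l: "(truncated s F \<longlongrightarrow> l) (at_right 0)"
    using truncated_convergent[OF Fm Fb Fsupp lip s(1)] s(2) by (auto simp: n_def)
  have rl: "rough_op \<Omega> \<alpha> f x = l"
    unfolding rough_op_def op by (rule tendsto_Lim[OF _ l]) simp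
  show "(truncated_op \<Omega> \<alpha> f x \<longlongrightarrow> rough_op \<Omega> \<alpha> f x) (at_right 0)" unfolding op rl by (rule l)
  let ?c = "poincare_const CARD('n) * M * (s / (s - 1))" and ?R = "riesz_integral \<alpha> (\<lambda>y. norm (gradient f y)) x"
  have c0: "?c \<ge> 0" using poincare_const_pos[of "CARD('n)"] M_pos s by simp
  have R0: "?R \<ge> 0" by (rule riesz_integral_gradient(2)[OF f \<alpha>])
  have "\<bar>truncated s F \<epsilon>\<bar> \<le> ?c * ?R" if \<epsilon>: "\<epsilon> > 0" for \<epsilon>
  proof -
    have "ennreal \<bar>truncated s F \<epsilon>\<bar> \<le> ennreal ?c * (\<integral>\<^sup>+z. ennreal (G z * norm z powr - (s - 1)) \<partial>lborel)"
      using truncated_le[OF dF bF cG G0 Fb Fsupp s(1) \<epsilon>] by simp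
    also have "(\<integral>\<^sup>+z. ennreal (G z * norm z powr - (s - 1)) \<partial>lborel) = ennreal ?R"
      using riesz_integral_gradient(1)[OF f \<alpha>, of x] by (simp add: G_def s_def n_def)
    also have "ennreal ?c * ennreal ?R = ennreal (?c * ?R)" using c0 R0 by (intro ennreal_mult[symmetric]) auto
    finally show ?thesis using ennreal_le_iff[OF mult_nonneg_nonneg[OF c0 R0]] by simp
  qed
  then have "\<bar>l\<bar> \<le> ?c * ?R"
    by (intro tendsto_upperbound[OF tendsto_rabs[OF l]]) (auto intro!: eventually_at_rightI[of 0 1])
  then show "\<bar>rough_op \<Omega> \<alpha> f x\<bar> \<le> poincare_const CARD('n) * M * ((n + 1 - \<alpha>) / (n - \<alpha>)) * ?R"
    by (simp add: rl s_def)
qed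

theorem theorem1p1:
  fixes \<alpha> :: real
  assumes "0 < \<alpha>" and "\<alpha> < real CARD('n::finite)"
  shows "\<exists>c>0. \<forall>(\<Omega> :: real ^ 'n \<Rightarrow> real) (f :: real ^ 'n \<Rightarrow> real) (x :: real ^ 'n).
           \<Omega> \<in> weak_space \<and> mean_zero \<Omega> \<and> f \<in> Cc_smooth \<longrightarrow>
             (truncated_op \<Omega> \<alpha> f x \<longlongrightarrow> rough_op \<Omega> \<alpha> f x) (at_right 0) \<and>
             \<bar>rough_op \<Omega> \<alpha> f x\<bar>
               \<le> c * enn2real (weak_norm \<Omega>) * riesz_potential \<alpha> (\<lambda>y. norm (gradient f y)) x"
proof -
  let ?n = "real CARD('n)"
  obtain k where k: "k > 0" and rep: "\<And>\<Omega> :: real ^ 'n \<Rightarrow> real. \<Omega> \<in> weak_space \<and> mean_zero \<Omega> \<Longrightarrow>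
     \<exists>\<omega>. (AE y in lborel. \<Omega> (y /\<^sub>R norm y) = \<omega> y)
        \<and> (\<forall>M. M > k * enn2real (weak_norm \<Omega>) \<longrightarrow> mean_zero_cone_function \<omega> M)"
    using homogeneous_representative[where 'n = 'n] by blast
  define \<kappa> where "\<kappa> = riesz_const TYPE('n) \<alpha>"
  have \<kappa>: "\<kappa> > 0" unfolding \<kappa>_def using assms by (rule riesz_const_pos)
  define c0 where "c0 = poincare_const CARD('n) * ((?n + 1 - \<alpha>) / (?n - \<alpha>))"
  have c0: "c0 > 0" using poincare_const_pos[of "CARD('n)"] assms by (simp add: c0_def)
  show ?thesis
  proof (intro exI[of _ "c0 * k / \<kappa>"] conjI allI impI)
    show "c0 * k / \<kappa> > 0" using c0 k \<kappa> by simp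
    fix \<Omega> f :: "real ^ 'n \<Rightarrow> real" and x :: "real ^ 'n"
    assume H: "\<Omega> \<in> weak_space \<and> mean_zero \<Omega> \<and> f \<in> Cc_smooth"
    then have f: "f \<in> Cc_smooth" by simp
    define M0 where "M0 = k * enn2real (weak_norm \<Omega>)"
    obtain \<omega> where ae: "AE y in lborel. \<Omega> (y /\<^sub>R norm y) = \<omega> y"
      and loc: "\<And>M. M > M0 \<Longrightarrow> mean_zero_cone_function \<omega> M"
      using rep[of \<Omega>] H unfolding M0_def by blast
    let ?R = "riesz_integral \<alpha> (\<lambda>y. norm (gradient f y)) x"
    note est = rough_op_estimate[OF assms loc ae f]
    show "(truncated_op \<Omega> \<alpha> f x \<longlongrightarrow> rough_op \<Omega> \<alpha> f x) (at_right 0)"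
      by (rule est(1)[of "M0 + 1"]) simp
    \<comment> \<open>The estimate holds with every \<open>M > M0\<close> in place of \<open>M0\<close>; let \<open>M\<close> decrease to \<open>M0\<close>.\<close>
    have "\<bar>rough_op \<Omega> \<alpha> f x\<bar> \<le> c0 * M0 * ?R"
    proof (rule tendsto_lowerbound)
      show "((\<lambda>M. c0 * M * ?R) \<longlongrightarrow> c0 * M0 * ?R) (at_right M0)" by (intro tendsto_intros)
      show "\<forall>\<^sub>F M in at_right M0. \<bar>rough_op \<Omega> \<alpha> f x\<bar> \<le> c0 * M * ?R"
        using eventually_at_right_less[of M0]
      proof eventually_elim
        case (elim M)
        show ?case using est(2)[OF elim, of x] by (simp add: c0_def mult_ac)
      qed
    qed simp
    also have "\<dots> = c0 * k / \<kappa> * enn2real (weak_norm \<Omega>) * riesz_potential \<alpha> (\<lambda>y. norm (gradient f y)) x"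
      using \<kappa> by (simp add: M0_def riesz_potential_def \<kappa>_def[symmetric])
    finally show "\<bar>rough_op \<Omega> \<alpha> f x\<bar>
      \<le> c0 * k / \<kappa> * enn2real (weak_norm \<Omega>) * riesz_potential \<alpha> (\<lambda>y. norm (gradient f y)) x" .
  qed
qed

end
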